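(* Let $Ags$ be a finite set of agents and $P$ a countable set of propositional letters. For every formula $\varphi$ of the language $\mathcal{L}_{\mathsf{ATL}}$: $\varphi$ is valid with respect to the class of concurrent game structures (i.e. $\mathcal{S},w\models\varphi$ for every concurrent game structure $\mathcal{S}$ and every state $w$ of $\mathcal{S}$) if and only if $Tr(\varphi)$ is valid with respect to the class of deterministic labelled bdt-models (i.e. $\mathcal{M},\langle m,h\rangle\models Tr(\varphi)$ for every deterministic labelled bdt-model $\mathcal{M}$ and every index $\langle m,h\rangle$ of $\mathcal{M}$).
   Context: Fix a finite set $Ags$ of agents and a countable set $P$ of propositional letters; a coalition is a subset $C\subseteq Ags$. ATL syntax. $\mathcal{L}_{\mathsf{ATL}}$: $\varphi ::= p\mid\neg\varphi\mid\varphi\wedge\psi\mid\langle\langle C\rangle\rangle X\varphi\mid\langle\langle C\rangle\rangle\mathsf{G}\varphi\mid\langle\langle C\rangle\rangle\varphi\mathsf{U}\psi$, with $p\in P$, $C\subseteq Ags$. Concurrent game structures (CGS). A CGS is $\mathcal{S}=\langle W,Ags,Act,\delta,\mathcal{V}\rangle$ where: $W$ is a finite non-empty set of states; $Act$ assigns to each agent $\alpha$ and state $w$ a finite non-empty set $Act_\alpha^w$ of action labels; $Act_C^w:=\prod_{\alpha\in C}Act_\alpha^w$ is the set of joint actions of $C$ at $w$ (a single empty tuple if $C=\emptyset$), and $Act_{Ags}:=\bigcup_{w}Act_{Ags}^w$ is the set of action profiles; $\delta:W\times Act_{Ags}\to W$ is the transition function; $\mathcal{V}:P\to 2^W$. For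 $\mathbf{s}\in Act_C^w$, $\delta[w,\mathbf{s}]$ is the set of all $\delta(w,\mathbf{t})$ with $\mathbf{t}\in Act_{Ags}^w$ and $\mathbf{t}_\alpha=\mathbf{s}_\alpha$ for all $\alpha\in C$. $W^+$ is the set of finite non-empty sequences of states, $W^\infty$ the set of infinite sequences of states (indexed from 1); $\mu[1,i]$ is the initial segment of length $i$. A strategy of $\alpha$ is a function $f_\alpha$ assigning to each $w_1,\dots,w_k\in W^+$ an element of $Act_\alpha^{w_k}$; a collective strategy of $C$ is a tuple $f_C=\langle f_\alpha\rangle_{\alpha\in C}$, and $f_C(\lambda)=\langle f_\alpha(\lambda)\rangle_{\alpha\in C}$. $out(w,f_C)$ is the set of $\mu\in W^\infty$ with $\mu(1)=w$ and $\mu(i+1)\in\delta[\mu(i),f_C(\mu[1,i])]$ for all $i\ge 1$. ATL semantics at a state $w$. $\mathcal{S},w\models p$ iff $w\in\mathcal{V}(p)$; Boolean clauses as usual; $\mathcal{S},w\models\langle\langle C\rangle\rangle X\varphi$ iff there is $f_C$ such that $\mathcal{S},\mu(2)\models\varphi$ for all $\mu\in out(w,f_C)$; $\mathcal{S},w\models\langle\langle C\rangle\rangle\mathsf{G}\varphi$ iff there is $f_C$ such that $\mathcal{S},\mu(i)\models\varphi$ for all $\mu\in out(w,f_C)$ and $i\ge1$; $\mathcal{S},w\models\langle\langle C\rangle\rangle\varphi\mathsf{U}\psi$ iff there is $f_C$ such that for each $\mu\in out(w,f_C)$ there is $j\ge1$ with $\mathcal{S},\mu(j)\models\psi$ and $\mathcal{S},\mu(i)\models\varphi$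 for all $1\le i<j$. Stit language. $\mathcal{L}_{\mathsf{SX}}$: $\varphi::=p\mid\neg\varphi\mid\varphi\wedge\psi\mid X\varphi\mid\mathsf{G}\varphi\mid\varphi\mathsf{U}\psi\mid\square\varphi\mid[C]\varphi\mid\langle\langle C\rangle\rangle^s\varphi$. Labelled bdt-models. A labelled bdt-model is $\mathcal{M}=\langle M,\sqsubset,Ags,\mathbf{Choice},Tps,Lbl,Exe,\mathcal{V}\rangle$ where: (1) $M$ is a non-empty set of moments and $\sqsubset$ is a strict partial order on $M$ with no backward branching: if $m'\sqsubset m$ and $m''\sqsubset m$ then $m'=m''$ or $m'\sqsubset m''$ or $m''\sqsubset m'$. A history is a maximal $\sqsubset$-chain; $H$ is the set of histories; $H_m=\{h\in H: m\in h\}$. An index is a pair $\langle m,h\rangle$ with $m\in h\in H$. Time-discreteness: for all $m\in M$, $h\in H_m$ there is a unique $m^{+h}\in h$ with $m\sqsubset m^{+h}$ and $m^{+h}\sqsubseteq m'$ for every $m'\in h$ with $m\sqsubset m'$. Put $m^{+h(0)}=m$ and $m^{+h(i+1)}=(m^{+h(i)})^{+h}$. (2) $\mathbf{Choice}$ maps each agent $\alpha$ and moment $m$ to a partition $\mathbf{Choice}_\alpha^m$ of $H_m$; $\mathbf{Choice}_\alpha^m(h)$ is the cell containing $h$. (NC): if $h,h'\in H_m$ and some $m'\sqsupset m$ lies in $h\cap h'$, then $h,h'$ lie in the same cell of $\mathbf{Choice}_\alpha^m$ for every $\alpha$. (IA): for each $m$ and each function $s$ with $s(\alpha)\in\mathbf{Choice}_\alpha^m$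 for all $\alpha\in Ags$, $\bigcap_{\alpha\in Ags}s(\alpha)\ne\emptyset$ (in $H_m$). (3) $Tps$ is a set of action types; $Lbl$ assigns to each agent $\alpha$, moment $m$ and cell $L\in\mathbf{Choice}_\alpha^m$ a type $Lbl(L)\in Tps$ (depending on $\alpha,m,L$); $Exe$ is a partial function assigning to $\tau\in Tps$, $m\in M$, $\alpha\in Ags$ a cell $Exe_\alpha^m(\tau)\in\mathbf{Choice}_\alpha^m$; (EL) $Exe_\alpha^m(Lbl(\mathbf{Choice}_\alpha^m(h)))=\mathbf{Choice}_\alpha^m(h)$ for each index $\langle m,h\rangle$; (LE) if $Exe_\alpha^m(\tau)$ is defined then $Lbl(Exe_\alpha^m(\tau))=\tau$. (4) $\mathcal{V}$ assigns to each $p\in P$ a set of indices. For a coalition $C$, $\mathbf{Choice}_C^m(h)=\bigcap_{\alpha\in C}\mathbf{Choice}_\alpha^m(h)$ (equal to $H_m$ if $C=\emptyset$). $\mathcal{M}$ is deterministic if $h'\in\mathbf{Choice}_{Ags}^m(h)$ implies $m^{+h}=m^{+h'}$, for all $m$ and $h\in H_m$. Strategies in bdt-models. A strategy of $\alpha$ starting at $m$ is a function $\sigma_\alpha$ on $\{m': m\sqsubseteq m'\}$ with $\sigma_\alpha(m')\in\mathbf{Choice}_\alpha^{m'}$; a collective strategy of $C$ starting at $m$ is $\sigma_C=\langle\sigma_\alpha\rangle_{\alpha\in C}$, and $\sigma_C(m')=\bigcap_{\alpha\in C}\sigma_\alpha(m')$ (equal to $H_{m'}$ if $C=\emptyset$).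 $\mathbf{Adm}_C^m(\sigma_C)=\{h\in H_m: h\in\sigma_C(m^{+h(i)})\text{ for all } i\in\mathbb{N}\}$, with $\mathbb{N}\ni 0$. Stit semantics at an index. $\langle m,h\rangle\models p$ iff $\langle m,h\rangle\in\mathcal{V}(p)$; Boolean clauses as usual; $\langle m,h\rangle\models X\varphi$ iff $\langle m^{+h},h\rangle\models\varphi$; $\langle m,h\rangle\models\mathsf{G}\varphi$ iff $\langle m^{+h(i)},h\rangle\models\varphi$ for all $i\in\mathbb{N}$; $\langle m,h\rangle\models\varphi\mathsf{U}\psi$ iff there is $j\in\mathbb{N}$ with $\langle m^{+h(j)},h\rangle\models\psi$ and $\langle m^{+h(i)},h\rangle\models\varphi$ for all $0\le i<j$; $\langle m,h\rangle\models\square\varphi$ iff $\langle m,h'\rangle\models\varphi$ for all $h'\in H_m$; $\langle m,h\rangle\models[C]\varphi$ iff $\langle m,h'\rangle\models\varphi$ for all $h'\in\mathbf{Choice}_C^m(h)$; $\langle m,h\rangle\models\langle\langle C\rangle\rangle^s\varphi$ iff there is a collective strategy $\sigma_C$ starting at $m$ with $\langle m,h'\rangle\models\varphi$ for all $h'\in\mathbf{Adm}_C^m(\sigma_C)$. Translation $Tr:\mathcal{L}_{\mathsf{ATL}}\to\mathcal{L}_{\mathsf{SX}}$. $Tr(p)=\square p$; $Tr(\neg\varphi)=\neg Tr(\varphi)$; $Tr(\varphi\wedge\psi)=Tr(\varphi)\wedge Tr(\psi)$; $Tr(\langle\langle C\rangle\rangle X\varphi)=\langle\langle C\rangle\rangle^sX\,Tr(\varphi)$;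 $Tr(\langle\langle C\rangle\rangle\mathsf{G}\varphi)=\langle\langle C\rangle\rangle^s\mathsf{G}\,Tr(\varphi)$; $Tr(\langle\langle C\rangle\rangle\varphi\mathsf{U}\psi)=\langle\langle C\rangle\rangle^s(Tr(\varphi)\mathsf{U}\,Tr(\psi))$. *)

theory Defs
  imports Main "HOL-Library.FuncSet" "HOL-Library.Disjoint_Sets"
    "HOL-Library.Countable_Set"
begin

section \<open>Languages\<close>

text \<open>
  The datatypes admit arbitrary sets of agents and arbitrary letters; the sets
  \<open>atl_lang Ags P\<close> and \<open>stit_lang Ags P\<close> cut out the languages over the agents
  \<open>Ags\<close> and the letters \<open>P\<close>.
\<close>

datatype ('a, 'p) atl =
    AProp 'p
  | ANeg "('a, 'p) atl"
  | AConj "('a, 'p) atl" "('a, 'p) atl"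
  | ANext "'a set" "('a, 'p) atl"
  | AGlob "'a set" "('a, 'p) atl"
  | AUntil "'a set" "('a, 'p) atl" "('a, 'p) atl"

inductive_set atl_lang :: "'a set \<Rightarrow> 'p set \<Rightarrow> ('a, 'p) atl set"
  for Ags :: "'a set" and P :: "'p set"
where
  "p \<in> P \<Longrightarrow> AProp p \<in> atl_lang Ags P"
| "\<phi> \<in> atl_lang Ags P \<Longrightarrow> ANeg \<phi> \<in> atl_lang Ags P"
| "\<phi> \<in> atl_lang Ags P \<Longrightarrow> \<psi> \<in> atl_lang Ags P \<Longrightarrow> AConj \<phi> \<psi> \<in> atl_lang Ags P"
| "C \<subseteq> Ags \<Longrightarrow> \<phi> \<in> atl_lang Ags P \<Longrightarrow> ANext C \<phi> \<in> atl_lang Ags P"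
| "C \<subseteq> Ags \<Longrightarrow> \<phi> \<in> atl_lang Ags P \<Longrightarrow> AGlob C \<phi> \<in> atl_lang Ags P"
| "C \<subseteq> Ags \<Longrightarrow> \<phi> \<in> atl_lang Ags P \<Longrightarrow> \<psi> \<in> atl_lang Ags P \<Longrightarrow> AUntil C \<phi> \<psi> \<in> atl_lang Ags P"

text \<open>
  \<open>SBox\<close>, \<open>SStit C\<close> and \<open>SStrat C\<close> are historical necessity, \<open>[C]\<close> and the
  strategic stit operator \<open>\<langle>\<langle>C\<rangle>\<rangle>\<^sup>s\<close>.
\<close>

datatype ('a, 'p) stit =
    SProp 'p
  | SNeg "('a, 'p) stit"
  | SConj "('a, 'p) stit" "('a, 'p) stit"
  | SNext "('a, 'p) stit"
  | SGlob "('a, 'p) stit"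
  | SUntil "('a, 'p) stit" "('a, 'p) stit"
  | SBox "('a, 'p) stit"
  | SStit "'a set" "('a, 'p) stit"
  | SStrat "'a set" "('a, 'p) stit"

inductive_set stit_lang :: "'a set \<Rightarrow> 'p set \<Rightarrow> ('a, 'p) stit set"
  for Ags :: "'a set" and P :: "'p set"
where
  "p \<in> P \<Longrightarrow> SProp p \<in> stit_lang Ags P"
| "\<phi> \<in> stit_lang Ags P \<Longrightarrow> SNeg \<phi> \<in> stit_lang Ags P"
| "\<phi> \<in> stit_lang Ags P \<Longrightarrow> \<psi> \<in> stit_lang Ags P \<Longrightarrow> SConj \<phi> \<psi> \<in> stit_lang Ags P"
| "\<phi> \<in> stit_lang Ags P \<Longrightarrow> SNext \<phi> \<in> stit_lang Ags P"
| "\<phi> \<in> stit_lang Ags P \<Longrightarrow> SGlob \<phi> \<in> stit_lang Ags P"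
| "\<phi> \<in> stit_lang Ags P \<Longrightarrow> \<psi> \<in> stit_lang Ags P \<Longrightarrow> SUntil \<phi> \<psi> \<in> stit_lang Ags P"
| "\<phi> \<in> stit_lang Ags P \<Longrightarrow> SBox \<phi> \<in> stit_lang Ags P"
| "C \<subseteq> Ags \<Longrightarrow> \<phi> \<in> stit_lang Ags P \<Longrightarrow> SStit C \<phi> \<in> stit_lang Ags P"
| "C \<subseteq> Ags \<Longrightarrow> \<phi> \<in> stit_lang Ags P \<Longrightarrow> SStrat C \<phi> \<in> stit_lang Ags P"

primrec Tr :: "('a, 'p) atl \<Rightarrow> ('a, 'p) stit" where
  "Tr (AProp p) = SBox (SProp p)"
| "Tr (ANeg \<phi>) = SNeg (Tr \<phi>)"
| "Tr (AConj \<phi> \<psi>) = SConj (Tr \<phi>) (Tr \<psi>)"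
| "Tr (ANext C \<phi>) = SStrat C (SNext (Tr \<phi>))"
| "Tr (AGlob C \<phi>) = SStrat C (SGlob (Tr \<phi>))"
| "Tr (AUntil C \<phi> \<psi>) = SStrat C (SUntil (Tr \<phi>) (Tr \<psi>))"

lemma Tr_in_stit_lang: "\<phi> \<in> atl_lang Ags P \<Longrightarrow> Tr \<phi> \<in> stit_lang Ags P"
  by (induction rule: atl_lang.induct) (simp_all add: stit_lang.intros)


section \<open>Concurrent game structures\<close>

record ('w, 'a, 'l, 'p) cgs =
  states :: "'w set"
  acts :: "'a \<Rightarrow> 'w \<Rightarrow> 'l set"
  delta :: "'w \<Rightarrow> ('a \<Rightarrow> 'l) \<Rightarrow> 'w"
  cgs_val :: "'p \<Rightarrow> 'w set"

text \<open>
  Joint actions are extensional functions (\<open>undefined\<close> outside \<open>C\<close>), so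
  there is exactly one joint action of the empty coalition.
\<close>

definition joint_acts :: "('w, 'a, 'l, 'p) cgs \<Rightarrow> 'a set \<Rightarrow> 'w \<Rightarrow> ('a \<Rightarrow> 'l) set" where
  "joint_acts S C w = (\<Pi>\<^sub>E \<alpha>\<in>C. acts S \<alpha> w)"

definition act_profiles :: "'a set \<Rightarrow> ('w, 'a, 'l, 'p) cgs \<Rightarrow> ('a \<Rightarrow> 'l) set" where
  "act_profiles Ags S = (\<Union>w\<in>states S. joint_acts S Ags w)"

text \<open>
  The transition function is total on states and profiles, including profiles that
  are not available at the given state.
\<close>

definition is_cgs :: "'a set \<Rightarrow> 'p set \<Rightarrow> ('w, 'a, 'l, 'p) cgs \<Rightarrow> bool" where
  "is_cgs Ags P S \<longleftrightarrow>
     finite (states S) \<and> states S \<noteq> {} \<and>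
     (\<forall>\<alpha>\<in>Ags. \<forall>w\<in>states S. finite (acts S \<alpha> w) \<and> acts S \<alpha> w \<noteq> {}) \<and>
     (\<forall>w\<in>states S. \<forall>t\<in>act_profiles Ags S. delta S w t \<in> states S) \<and>
     (\<forall>p\<in>P. cgs_val S p \<subseteq> states S)"

definition delta_set :: "'a set \<Rightarrow> ('w, 'a, 'l, 'p) cgs \<Rightarrow> 'a set \<Rightarrow> 'w \<Rightarrow> ('a \<Rightarrow> 'l) \<Rightarrow> 'w set" where
  "delta_set Ags S C w s = {delta S w t | t. t \<in> joint_acts S Ags w \<and> (\<forall>\<alpha>\<in>C. t \<alpha> = s \<alpha>)}"

definition cgs_strategy :: "('w, 'a, 'l, 'p) cgs \<Rightarrow> 'a \<Rightarrow> ('w list \<Rightarrow> 'l) \<Rightarrow> bool" where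
  "cgs_strategy S \<alpha> f \<longleftrightarrow>
     (\<forall>ws. ws \<noteq> [] \<and> set ws \<subseteq> states S \<longrightarrow> f ws \<in> acts S \<alpha> (last ws))"

definition cgs_coll_strategy :: "('w, 'a, 'l, 'p) cgs \<Rightarrow> 'a set \<Rightarrow> ('a \<Rightarrow> 'w list \<Rightarrow> 'l) \<Rightarrow> bool" where
  "cgs_coll_strategy S C f \<longleftrightarrow> (\<forall>\<alpha>\<in>C. cgs_strategy S \<alpha> (f \<alpha>))"

definition strat_action :: "'a set \<Rightarrow> ('a \<Rightarrow> 'w list \<Rightarrow> 'l) \<Rightarrow> 'w list \<Rightarrow> 'a \<Rightarrow> 'l" where
  "strat_action C f ws = (\<lambda>\<alpha>\<in>C. f \<alpha> ws)"

text \<open>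
  Infinite sequences of states are indexed from 0 here, so \<open>\<mu> i\<close> is the usual
  \<open>\<mu>(i+1)\<close> and \<open>map \<mu> [0..<Suc i]\<close> the usual \<open>\<mu>[1,i+1]\<close>.
\<close>

definition out :: "'a set \<Rightarrow> ('w, 'a, 'l, 'p) cgs \<Rightarrow> 'w \<Rightarrow> 'a set \<Rightarrow> ('a \<Rightarrow> 'w list \<Rightarrow> 'l)
    \<Rightarrow> (nat \<Rightarrow> 'w) set" where
  "out Ags S w C f =
     {\<mu>. range \<mu> \<subseteq> states S \<and> \<mu> 0 = w \<and>
         (\<forall>i. \<mu> (Suc i) \<in> delta_set Ags S C (\<mu> i) (strat_action C f (map \<mu> [0..<Suc i])))}"

primrec atl_sat :: "'a set \<Rightarrow> ('w, 'a, 'l, 'p) cgs \<Rightarrow> 'w \<Rightarrow> ('a, 'p) atl \<Rightarrow> bool" where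
  "atl_sat Ags S w (AProp p) \<longleftrightarrow> w \<in> cgs_val S p"
| "atl_sat Ags S w (ANeg \<phi>) \<longleftrightarrow> \<not> atl_sat Ags S w \<phi>"
| "atl_sat Ags S w (AConj \<phi> \<psi>) \<longleftrightarrow> atl_sat Ags S w \<phi> \<and> atl_sat Ags S w \<psi>"
| "atl_sat Ags S w (ANext C \<phi>) \<longleftrightarrow>
     (\<exists>f. cgs_coll_strategy S C f \<and> (\<forall>\<mu>\<in>out Ags S w C f. atl_sat Ags S (\<mu> 1) \<phi>))"
| "atl_sat Ags S w (AGlob C \<phi>) \<longleftrightarrow>
     (\<exists>f. cgs_coll_strategy S C f \<and> (\<forall>\<mu>\<in>out Ags S w C f. \<forall>i. atl_sat Ags S (\<mu> i) \<phi>))"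
| "atl_sat Ags S w (AUntil C \<phi> \<psi>) \<longleftrightarrow>
     (\<exists>f. cgs_coll_strategy S C f \<and>
        (\<forall>\<mu>\<in>out Ags S w C f. \<exists>j. atl_sat Ags S (\<mu> j) \<psi> \<and> (\<forall>i<j. atl_sat Ags S (\<mu> i) \<phi>)))"


section \<open>Labelled bdt-models\<close>

text \<open>
  Histories are sets of moments, so a cell of a choice partition is a set of sets of
  moments.
\<close>

record ('m, 'a, 't, 'p) bdt =
  moments :: "'m set"
  before :: "'m \<Rightarrow> 'm \<Rightarrow> bool"
  choice :: "'a \<Rightarrow> 'm \<Rightarrow> 'm set set set"
  types :: "'t set"
  lbl :: "'a \<Rightarrow> 'm \<Rightarrow> 'm set set \<Rightarrow> 't"
  exe :: "'t \<Rightarrow> 'm \<Rightarrow> 'a \<Rightarrow> 'm set set option"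
  bdt_val :: "'p \<Rightarrow> ('m \<times> 'm set) set"

definition before_eq :: "('m, 'a, 't, 'p) bdt \<Rightarrow> 'm \<Rightarrow> 'm \<Rightarrow> bool" where
  "before_eq M m m' \<longleftrightarrow> before M m m' \<or> m = m'"

definition hists :: "('m, 'a, 't, 'p) bdt \<Rightarrow> 'm set set" where
  "hists M = {h. pred_on.maxchain (moments M) (before M) h}"

definition hists_at :: "('m, 'a, 't, 'p) bdt \<Rightarrow> 'm \<Rightarrow> 'm set set" where
  "hists_at M m = {h \<in> hists M. m \<in> h}"

definition indices :: "('m, 'a, 't, 'p) bdt \<Rightarrow> ('m \<times> 'm set) set" where
  "indices M = {(m, h). h \<in> hists M \<and> m \<in> h}"

definition is_succ :: "('m, 'a, 't, 'p) bdt \<Rightarrow> 'm \<Rightarrow> 'm set \<Rightarrow> 'm \<Rightarrow> bool" where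
  "is_succ M m h m' \<longleftrightarrow>
     m' \<in> h \<and> before M m m' \<and> (\<forall>m''\<in>h. before M m m'' \<longrightarrow> before_eq M m' m'')"

definition succ :: "('m, 'a, 't, 'p) bdt \<Rightarrow> 'm \<Rightarrow> 'm set \<Rightarrow> 'm" where
  "succ M m h = (THE m'. is_succ M m h m')"

definition succ_iter :: "('m, 'a, 't, 'p) bdt \<Rightarrow> 'm \<Rightarrow> 'm set \<Rightarrow> nat \<Rightarrow> 'm" where
  "succ_iter M m h i = ((\<lambda>m. succ M m h) ^^ i) m"

definition cell :: "('m, 'a, 't, 'p) bdt \<Rightarrow> 'a \<Rightarrow> 'm \<Rightarrow> 'm set \<Rightarrow> 'm set set" where
  "cell M \<alpha> m h = (THE L. L \<in> choice M \<alpha> m \<and> h \<in> L)"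

text \<open>
  Intersections indexed by a coalition are taken inside the set of histories through
  the moment; this is what makes the empty coalition yield all of them.
\<close>

definition coll_cell :: "('m, 'a, 't, 'p) bdt \<Rightarrow> 'a set \<Rightarrow> 'm \<Rightarrow> 'm set \<Rightarrow> 'm set set" where
  "coll_cell M C m h = hists_at M m \<inter> (\<Inter>\<alpha>\<in>C. cell M \<alpha> m h)"

definition discrete_tree :: "('m, 'a, 't, 'p) bdt \<Rightarrow> bool" where
  "discrete_tree M \<longleftrightarrow>
     moments M \<noteq> {} \<and>
     irreflp_on (moments M) (before M) \<and> transp_on (moments M) (before M) \<and>
     (\<forall>m\<in>moments M. \<forall>m'\<in>moments M. \<forall>m''\<in>moments M.
        before M m' m \<and> before M m'' m \<longrightarrow> m' = m'' \<or> before M m' m'' \<or> before M m'' m') \<and>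
     (\<forall>m\<in>moments M. \<forall>h\<in>hists_at M m. \<exists>!m'. is_succ M m h m')"

definition choice_conditions :: "'a set \<Rightarrow> ('m, 'a, 't, 'p) bdt \<Rightarrow> bool" where
  "choice_conditions Ags M \<longleftrightarrow>
     (\<forall>\<alpha>\<in>Ags. \<forall>m\<in>moments M. partition_on (hists_at M m) (choice M \<alpha> m)) \<and>
     \<comment> \<open>(NC)\<close>
     (\<forall>m\<in>moments M. \<forall>h\<in>hists_at M m. \<forall>h'\<in>hists_at M m.
        (\<exists>m'\<in>h \<inter> h'. before M m m') \<longrightarrow> (\<forall>\<alpha>\<in>Ags. cell M \<alpha> m h = cell M \<alpha> m h')) \<and>
     \<comment> \<open>(IA)\<close>
     (\<forall>m\<in>moments M. \<forall>s. (\<forall>\<alpha>\<in>Ags. s \<alpha> \<in> choice M \<alpha> m) \<longrightarrow>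
        hists_at M m \<inter> (\<Inter>\<alpha>\<in>Ags. s \<alpha>) \<noteq> {})"

definition label_conditions :: "'a set \<Rightarrow> ('m, 'a, 't, 'p) bdt \<Rightarrow> bool" where
  "label_conditions Ags M \<longleftrightarrow>
     (\<forall>\<alpha>\<in>Ags. \<forall>m\<in>moments M. \<forall>L\<in>choice M \<alpha> m. lbl M \<alpha> m L \<in> types M) \<and>
     (\<forall>\<alpha>\<in>Ags. \<forall>m\<in>moments M. \<forall>\<tau>\<in>types M. \<forall>L. exe M \<tau> m \<alpha> = Some L \<longrightarrow> L \<in> choice M \<alpha> m) \<and>
     \<comment> \<open>(EL)\<close>
     (\<forall>\<alpha>\<in>Ags. \<forall>(m, h)\<in>indices M. exe M (lbl M \<alpha> m (cell M \<alpha> m h)) m \<alpha> = Some (cell M \<alpha> m h)) \<and>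
     \<comment> \<open>(LE)\<close>
     (\<forall>\<alpha>\<in>Ags. \<forall>m\<in>moments M. \<forall>\<tau>\<in>types M. \<forall>L. exe M \<tau> m \<alpha> = Some L \<longrightarrow> lbl M \<alpha> m L = \<tau>)"

definition is_bdt :: "'a set \<Rightarrow> 'p set \<Rightarrow> ('m, 'a, 't, 'p) bdt \<Rightarrow> bool" where
  "is_bdt Ags P M \<longleftrightarrow>
     discrete_tree M \<and> choice_conditions Ags M \<and> label_conditions Ags M \<and>
     (\<forall>p\<in>P. bdt_val M p \<subseteq> indices M)"

definition deterministic :: "'a set \<Rightarrow> ('m, 'a, 't, 'p) bdt \<Rightarrow> bool" where
  "deterministic Ags M \<longleftrightarrow>
     (\<forall>m\<in>moments M. \<forall>h\<in>hists_at M m. \<forall>h'\<in>coll_cell M Ags m h. succ M m h = succ M m h')"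

definition bdt_strategy :: "('m, 'a, 't, 'p) bdt \<Rightarrow> 'a \<Rightarrow> 'm \<Rightarrow> ('m \<Rightarrow> 'm set set) \<Rightarrow> bool" where
  "bdt_strategy M \<alpha> m \<sigma> \<longleftrightarrow> (\<forall>m'\<in>moments M. before_eq M m m' \<longrightarrow> \<sigma> m' \<in> choice M \<alpha> m')"

definition bdt_coll_strategy :: "('m, 'a, 't, 'p) bdt \<Rightarrow> 'a set \<Rightarrow> 'm \<Rightarrow> ('a \<Rightarrow> 'm \<Rightarrow> 'm set set) \<Rightarrow> bool" where
  "bdt_coll_strategy M C m \<sigma> \<longleftrightarrow> (\<forall>\<alpha>\<in>C. bdt_strategy M \<alpha> m (\<sigma> \<alpha>))"

definition strat_cell :: "('m, 'a, 't, 'p) bdt \<Rightarrow> 'a set \<Rightarrow> ('a \<Rightarrow> 'm \<Rightarrow> 'm set set) \<Rightarrow> 'm \<Rightarrow> 'm set set" where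
  "strat_cell M C \<sigma> m = hists_at M m \<inter> (\<Inter>\<alpha>\<in>C. \<sigma> \<alpha> m)"

definition Adm :: "('m, 'a, 't, 'p) bdt \<Rightarrow> 'a set \<Rightarrow> 'm \<Rightarrow> ('a \<Rightarrow> 'm \<Rightarrow> 'm set set) \<Rightarrow> 'm set set" where
  "Adm M C m \<sigma> = {h \<in> hists_at M m. \<forall>i. h \<in> strat_cell M C \<sigma> (succ_iter M m h i)}"

primrec stit_sat :: "('m, 'a, 't, 'p) bdt \<Rightarrow> 'm \<Rightarrow> 'm set \<Rightarrow> ('a, 'p) stit \<Rightarrow> bool" where
  "stit_sat M m h (SProp p) \<longleftrightarrow> (m, h) \<in> bdt_val M p"
| "stit_sat M m h (SNeg \<phi>) \<longleftrightarrow> \<not> stit_sat M m h \<phi>"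
| "stit_sat M m h (SConj \<phi> \<psi>) \<longleftrightarrow> stit_sat M m h \<phi> \<and> stit_sat M m h \<psi>"
| "stit_sat M m h (SNext \<phi>) \<longleftrightarrow> stit_sat M (succ M m h) h \<phi>"
| "stit_sat M m h (SGlob \<phi>) \<longleftrightarrow> (\<forall>i. stit_sat M (succ_iter M m h i) h \<phi>)"
| "stit_sat M m h (SUntil \<phi> \<psi>) \<longleftrightarrow>
     (\<exists>j. stit_sat M (succ_iter M m h j) h \<psi> \<and> (\<forall>i<j. stit_sat M (succ_iter M m h i) h \<phi>))"
| "stit_sat M m h (SBox \<phi>) \<longleftrightarrow> (\<forall>h'\<in>hists_at M m. stit_sat M m h' \<phi>)"
| "stit_sat M m h (SStit C \<phi>) \<longleftrightarrow> (\<forall>h'\<in>coll_cell M C m h. stit_sat M m h' \<phi>)"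
| "stit_sat M m h (SStrat C \<phi>) \<longleftrightarrow>
     (\<exists>\<sigma>. bdt_coll_strategy M C m \<sigma> \<and> (\<forall>h'\<in>Adm M C m \<sigma>. stit_sat M m h' \<phi>))"


section \<open>Universes\<close>

text \<open>
  HOL cannot quantify over types inside a formula, so validity over a class of structures
  is stated with the carrier types as type variables: \<open>'w\<close> (states) and \<open>'l\<close> (action
  labels) for game structures, \<open>'m\<close> (moments) and \<open>'t\<close> (action types) for bdt-models.
  As \<open>states\<close>, \<open>acts\<close>, \<open>moments\<close> and \<open>types\<close> are sets over these types,
  structures with smaller carriers are included.  The four type variables must range over
  infinite types: over a finite type only structures of bounded size would be quantified
  over, which is not the intended class.  Every infinite choice of \<open>'w\<close> and \<open>'l\<close> covers
  all game structures up to isomorphism, since these are finite; bdt-models have no size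
  bound, and \<open>'m\<close> and \<open>'t\<close> may be taken arbitrarily large.
\<close>

end

theory Submission
  imports Defs "HOL-Library.Sublist"
begin

text \<open>
  A deterministic bdt-model is a concurrent game structure whose states are the moments and whose
  actions are the choice cells, except that it may be infinite in both respects; on it, stit
  strategies and perfect-recall strategies have the same outcomes.  Conversely the unravelling of a
  concurrent game structure into its runs is a bdt-model; sending a run to its last state
  preserves what coalitions can force in one step, and hence, by the fixpoint characterisations
  of the temporal operators, all ATL formulas.

  What remains is the finite model property of ATL over structures with arbitrarily many states
  and actions.  The states of the finite structure are the types (sets of true subformulas), paired
  with an eventuality that is currently tracked.  Each such pair copies the one-step game of a
  state of the given type which is closest to fulfilling the tracked eventuality, and this game is
  replaced by a finite one with the same effectivity.
\<close>

section \<open>Effectivity and fixpoints in possibly infinite game structures\<close>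

text \<open>Merging the states of equal type, as in a filtration, would fail twice. A merged state
  can lose its eventualities: each one is fulfilled along states of falling rank, but the good first
  moves for two eventualities of the same type may exist only at different states, and a copy can
  imitate just one of them. Hence one eventuality is tracked at a time, and the tracked one is
  changed in rotation. Besides, the one-step game at a state may have infinitely many inequivalent
  actions although only finitely many types can result from it. What has to survive is merely which
  coalitions can force which sets of types; the new game is built from announcements of such powers,
  and the care goes into not creating new ones. Ranks are counted on types: on the states of an
  infinite structure the stages of a least fixpoint may be transfinite, on finitely many types
  natural numbers suffice. The locale \<open>game\<close> drops finiteness and asks for closure of
  \<open>delta\<close> only at available profiles, because the transition read off a bdt-model is
  arbitrary elsewhere.\<close>

locale game =
  fixes Ags :: "'a set" and S :: "('w, 'a, 'l, 'p) cgs"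
  assumes acts_nonempty: "\<alpha> \<in> Ags \<Longrightarrow> w \<in> states S \<Longrightarrow> acts S \<alpha> w \<noteq> {}"
    and delta_closed: "w \<in> states S \<Longrightarrow> t \<in> joint_acts S Ags w \<Longrightarrow> delta S w t \<in> states S"

lemma is_cgs_game: "is_cgs Ags P S \<Longrightarrow> game Ags S"
  by unfold_locales (auto simp: is_cgs_def act_profiles_def)

text \<open>The one-step effectivity function. The fixpoint lemmas below make truth depend on a
  structure only through it and the valuation, so structures are later compared by it alone.\<close>

definition eff :: "'a set \<Rightarrow> ('w, 'a, 'l, 'p) cgs \<Rightarrow> 'a set \<Rightarrow> 'w \<Rightarrow> 'w set \<Rightarrow> bool" where
  "eff Ags S C w X \<longleftrightarrow> (\<exists>s\<in>joint_acts S C w. delta_set Ags S C w s \<subseteq> X)"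

lemma eff_mono: "eff Ags S C w X \<Longrightarrow> X \<subseteq> Y \<Longrightarrow> eff Ags S C w Y"
  unfolding eff_def by blast

text \<open>The form in which \<open>finite_game_form\<close> compares two one-step games.\<close>

lemma eff_iff:
  "eff Ags S C w X \<longleftrightarrow> (\<exists>s\<in>\<Pi>\<^sub>E \<alpha>\<in>C. acts S \<alpha> w. \<forall>t\<in>\<Pi>\<^sub>E \<alpha>\<in>Ags. acts S \<alpha> w.
     (\<forall>\<alpha>\<in>C. t \<alpha> = s \<alpha>) \<longrightarrow> delta S w t \<in> X)"
proof -
  have "delta_set Ags S C w s \<subseteq> X \<longleftrightarrow>
      (\<forall>t\<in>\<Pi>\<^sub>E \<alpha>\<in>Ags. acts S \<alpha> w. (\<forall>\<alpha>\<in>C. t \<alpha> = s \<alpha>) \<longrightarrow> delta S w t \<in> X)" for s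
    unfolding delta_set_def joint_acts_def by blast
  then show ?thesis by (simp add: eff_def joint_acts_def)
qed

lemma ex_path_by_choice:
  "\<exists>\<mu>. \<mu> 0 = w \<and> (\<forall>i. \<mu> (Suc i) = c (map \<mu> [0..<Suc i]))"
proof -
  \<comment> \<open>The recursion runs on whole prefixes, because the next state depends on all
    earlier ones: \<open>l n\<close> is the prefix with \<open>n + 1\<close> entries.\<close>
  define l where "l = rec_nat [w] (\<lambda>_ ws. ws @ [c ws])"
  define \<mu> where "\<mu> n = last (l n)" for n
  have l: "l 0 = [w]" "\<And>n. l (Suc n) = l n @ [c (l n)]" by (simp_all add: l_def)
  have "map \<mu> [0..<Suc n] = l n" for n
    by (induction n) (simp_all add: l \<mu>_def)
  then have "\<mu> (Suc n) = c (map \<mu> [0..<Suc n])" for n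
    by (simp add: \<mu>_def l)
  then show ?thesis by (intro exI[of _ \<mu>]) (simp add: \<mu>_def l)
qed

section \<open>Strategies and outcomes built from prescribed actions and successors\<close>

context game
begin

lemma some_act: "\<alpha> \<in> Ags \<Longrightarrow> w \<in> states S \<Longrightarrow> (SOME a. a \<in> acts S \<alpha> w) \<in> acts S \<alpha> w"
  using acts_nonempty by (simp add: some_in_eq)

lemma delta_set_nonempty:
  assumes "C \<subseteq> Ags" "w \<in> states S" "s \<in> joint_acts S C w"
  shows "delta_set Ags S C w s \<noteq> {}"
proof -
  define t where "t = (\<lambda>\<alpha>\<in>Ags. if \<alpha> \<in> C then s \<alpha> else SOME a. a \<in> acts S \<alpha> w)"
  have "t \<in> joint_acts S Ags w"
    using assms some_act by (auto simp: t_def joint_acts_def PiE_iff)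
  moreover have "\<forall>\<alpha>\<in>C. t \<alpha> = s \<alpha>" using assms(1) by (auto simp: t_def)
  ultimately show ?thesis by (auto simp: delta_set_def)
qed

lemma delta_set_states:
  "w \<in> states S \<Longrightarrow> delta_set Ags S C w s \<subseteq> states S"
  using delta_closed by (auto simp: delta_set_def)

lemma eff_Int_states:
  "w \<in> states S \<Longrightarrow> eff Ags S C w X \<longleftrightarrow> eff Ags S C w (X \<inter> states S)"
  unfolding eff_def using delta_set_states[of w C] by blast

lemma strat_action_joint:
  assumes "cgs_coll_strategy S C f" "ws \<noteq> []" "set ws \<subseteq> states S"
  shows "strat_action C f ws \<in> joint_acts S C (last ws)"
  using assms by (auto simp: cgs_coll_strategy_def cgs_strategy_def strat_action_def joint_acts_def)

text \<open>\<open>Q\<close> marks the sequences on which \<open>s\<close> is prescribed. Elsewhere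
  an arbitrary available action keeps \<open>f\<close> a strategy on all non-empty sequences of
  states.\<close>

lemma strategy_by_choice:
  assumes "C \<subseteq> Ags"
    and "\<And>ws. ws \<noteq> [] \<Longrightarrow> set ws \<subseteq> states S \<Longrightarrow> Q ws \<Longrightarrow> s ws \<in> joint_acts S C (last ws)"
  shows "\<exists>f. cgs_coll_strategy S C f \<and>
           (\<forall>ws. ws \<noteq> [] \<longrightarrow> set ws \<subseteq> states S \<longrightarrow> Q ws \<longrightarrow> strat_action C f ws = s ws)"
proof -
  define f where "f \<alpha> ws = (if Q ws then s ws \<alpha> else SOME a. a \<in> acts S \<alpha> (last ws))" for \<alpha> ws
  have "f \<alpha> ws \<in> acts S \<alpha> (last ws)"
    if "\<alpha> \<in> C" "ws \<noteq> []" "set ws \<subseteq> states S" for \<alpha> ws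
  proof (cases "Q ws")
    case True
    then show ?thesis using assms(2)[OF that(2,3)] that(1)
      by (auto simp: f_def joint_acts_def)
  next
    case False
    have "last ws \<in> states S" using that by auto
    then show ?thesis using False that(1) assms(1) some_act
      by (auto simp: f_def)
  qed
  then have "cgs_coll_strategy S C f"
    by (auto simp: cgs_coll_strategy_def cgs_strategy_def)
  \<comment> \<open>Equality, and not only agreement on \<open>C\<close>: both sides are
    \<open>undefined\<close> outside \<open>C\<close>.\<close>
  moreover have "strat_action C f ws = s ws" if "ws \<noteq> []" "set ws \<subseteq> states S" "Q ws" for ws
    using assms(2)[OF that] that(3)
    by (auto simp: strat_action_def f_def joint_acts_def PiE_def extensional_def)
  ultimately show ?thesis by blast
qed

lemma ex_strategy: "C \<subseteq> Ags \<Longrightarrow> \<exists>f. cgs_coll_strategy S C f"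
  using strategy_by_choice[of C "\<lambda>_. False"] by auto

text \<open>The dual of \<open>strategy_by_choice\<close>: \<open>c\<close> steers the play wherever
  \<open>R\<close> holds, and some legal successor is taken elsewhere. \<open>R\<close> also sees
  the proposed successor, so legality itself can serve as \<open>R\<close>.\<close>

lemma out_choice:
  assumes "C \<subseteq> Ags" "w \<in> states S" "cgs_coll_strategy S C f"
    and "\<And>ws. ws \<noteq> [] \<Longrightarrow> set ws \<subseteq> states S \<Longrightarrow>
           R ws (c ws) \<Longrightarrow> c ws \<in> delta_set Ags S C (last ws) (strat_action C f ws)"
  shows "\<exists>\<mu>\<in>out Ags S w C f.
           \<forall>i. R (map \<mu> [0..<Suc i]) (c (map \<mu> [0..<Suc i])) \<longrightarrow> \<mu> (Suc i) = c (map \<mu> [0..<Suc i])"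
proof -
  define D where "D ws = delta_set Ags S C (last ws) (strat_action C f ws)" for ws
  define c' where "c' ws = (if R ws (c ws) then c ws else SOME y. y \<in> D ws)" for ws
  obtain \<mu> where \<mu>: "\<mu> 0 = w" "\<And>i. \<mu> (Suc i) = c' (map \<mu> [0..<Suc i])"
    using ex_path_by_choice[of w c'] by blast
  have step: "c' ws \<in> D ws" if "ws \<noteq> []" "set ws \<subseteq> states S" for ws
  proof (cases "R ws (c ws)")
    case True
    then show ?thesis using assms(4)[OF that] by (simp add: c'_def D_def)
  next
    case False
    have "last ws \<in> states S" using that by auto
    then have "D ws \<noteq> {}"
      unfolding D_def using assms that by (intro delta_set_nonempty strat_action_joint)
    then show ?thesis using False by (simp add: c'_def some_in_eq)
  qed
  \<comment> \<open>Strong induction, since \<open>step\<close> applies only once the whole prefix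
    is known to consist of states.\<close>
  have st: "\<mu> i \<in> states S" for i
  proof (induction i rule: less_induct)
    case (less i)
    show ?case
    proof (cases i)
      case 0 then show ?thesis using \<mu> assms by simp
    next
      case (Suc j)
      have "c' (map \<mu> [0..<Suc j]) \<in> D (map \<mu> [0..<Suc j])"
        by (rule step) (use less Suc in auto)
      moreover have "D (map \<mu> [0..<Suc j]) \<subseteq> states S"
        unfolding D_def using less Suc by (intro delta_set_states) auto
      ultimately show ?thesis using \<mu>(2)[of j] Suc by auto
    qed
  qed
  have "\<mu> (Suc i) \<in> D (map \<mu> [0..<Suc i])" for i
    unfolding \<mu>(2) by (rule step) (use st in auto)
  then have "\<mu> \<in> out Ags S w C f"
    using \<mu>(1) st by (auto simp: out_def D_def)
  moreover have "\<forall>i. R (map \<mu> [0..<Suc i]) (c (map \<mu> [0..<Suc i])) \<longrightarrow> \<mu> (Suc i) = c (map \<mu> [0..<Suc i])"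
    using \<mu>(2) by (auto simp: c'_def)
  ultimately show ?thesis by blast
qed

lemma out_states: "\<mu> \<in> out Ags S w C f \<Longrightarrow> \<mu> i \<in> states S"
  by (auto simp: out_def)

section \<open>Next, globally and until in terms of one-step power\<close>

lemma atl_sat_next_eff:
  assumes "C \<subseteq> Ags" "w \<in> states S"
  shows "atl_sat Ags S w (ANext C \<phi>) \<longleftrightarrow> eff Ags S C w {v \<in> states S. atl_sat Ags S v \<phi>}"
proof
  assume "atl_sat Ags S w (ANext C \<phi>)"
  then obtain f where f: "cgs_coll_strategy S C f" "\<And>\<mu>. \<mu> \<in> out Ags S w C f \<Longrightarrow> atl_sat Ags S (\<mu> 1) \<phi>"
    by auto
  have "atl_sat Ags S y \<phi>" if y: "y \<in> delta_set Ags S C w (strat_action C f [w])" for y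
  proof -
    obtain \<mu> where \<mu>: "\<mu> \<in> out Ags S w C f"
      "\<forall>i. map \<mu> [0..<Suc i] = [w] \<longrightarrow> \<mu> (Suc i) = y"
      using out_choice[OF assms f(1), of "\<lambda>ws _. ws = [w]" "\<lambda>_. y"] y by auto
    then have "\<mu> 1 = y" by (auto simp: out_def)
    then show ?thesis using f(2) \<mu> by auto
  qed
  moreover have "strat_action C f [w] \<in> joint_acts S C w"
    using strat_action_joint[OF f(1), of "[w]"] assms by simp
  ultimately show "eff Ags S C w {v \<in> states S. atl_sat Ags S v \<phi>}"
    unfolding eff_def using delta_set_states[OF assms(2)] by blast
next
  assume "eff Ags S C w {v \<in> states S. atl_sat Ags S v \<phi>}"
  then obtain s where s: "s \<in> joint_acts S C w"
    "delta_set Ags S C w s \<subseteq> {v \<in> states S. atl_sat Ags S v \<phi>}"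
    unfolding eff_def by auto
  obtain f where f: "cgs_coll_strategy S C f" "strat_action C f [w] = s"
    using strategy_by_choice[of C "\<lambda>ws. ws = [w]" "\<lambda>_. s"] s assms by auto
  have "atl_sat Ags S (\<mu> 1) \<phi>" if "\<mu> \<in> out Ags S w C f" for \<mu>
  proof -
    have "\<mu> (Suc 0) \<in> delta_set Ags S C (\<mu> 0) (strat_action C f (map \<mu> [0..<Suc 0]))" "\<mu> 0 = w"
      using that unfolding out_def by blast+
    then show ?thesis using f s by auto
  qed
  then show "atl_sat Ags S w (ANext C \<phi>)" using f by auto
qed

text \<open>A perfect-recall strategy yields the set of all states visited by its outcomes. Outcomes
  can be spliced, so every successor still possible after a played prefix is visited too. Conversely
  a positional strategy suffices to stay in \<open>Z\<close>.\<close>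

lemma atl_sat_glob_gfp:
  assumes "C \<subseteq> Ags" "w \<in> states S"
  shows "atl_sat Ags S w (AGlob C \<phi>) \<longleftrightarrow>
    (\<exists>Z\<subseteq>states S. w \<in> Z \<and> (\<forall>v\<in>Z. atl_sat Ags S v \<phi> \<and> eff Ags S C v Z))" (is "?L \<longleftrightarrow> ?R")
proof
  assume ?L
  then obtain f where f: "cgs_coll_strategy S C f" "\<And>\<mu> i. \<mu> \<in> out Ags S w C f \<Longrightarrow> atl_sat Ags S (\<mu> i) \<phi>"
    by auto
  define Z where "Z = {\<mu> i | \<mu> i. \<mu> \<in> out Ags S w C f}"
  have "eff Ags S C (\<mu> i) Z" if \<mu>: "\<mu> \<in> out Ags S w C f" for \<mu> i
  proof -
    define ws where "ws = map \<mu> [0..<Suc i]"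
    have ws: "ws \<noteq> []" "set ws \<subseteq> states S" "last ws = \<mu> i"
      using out_states[OF \<mu>] by (auto simp: ws_def)
    have "y \<in> Z" if y: "y \<in> delta_set Ags S C (\<mu> i) (strat_action C f ws)" for y
    proof -
      \<comment> \<open>The play copies \<mu> up to position \<open>i\<close> and then turns to
        \<open>y\<close>; \<open>R\<close> ends the control there, since \<mu> is no guide after the
        deviation.\<close>
      define c where "c us = (if us = ws then y else \<mu> (length us))" for us
      define R where "R us (z :: 'w) \<longleftrightarrow> length us \<le> Suc i \<and> us = map \<mu> [0..<length us]" for us z
      have "c us \<in> delta_set Ags S C (last us) (strat_action C f us)"
        if us: "us \<noteq> []" "R us (c us)" for us
      proof (cases "us = ws")
        case True
        then show ?thesis using y ws by (simp add: c_def)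
      next
        case False
        obtain j where j: "length us = Suc j" using us by (cases us) auto
        have us': "us = map \<mu> [0..<Suc j]" using us j by (simp add: R_def del: upt_Suc)
        then have "last us = \<mu> j" by simp
        moreover have "\<mu> (Suc j) \<in> delta_set Ags S C (\<mu> j) (strat_action C f us)"
          using \<mu> unfolding us' out_def by blast
        ultimately show ?thesis using False j by (simp add: c_def)
      qed
      then obtain \<mu>' where \<mu>': "\<mu>' \<in> out Ags S w C f"
        "\<And>k. R (map \<mu>' [0..<Suc k]) (c (map \<mu>' [0..<Suc k])) \<Longrightarrow> \<mu>' (Suc k) = c (map \<mu>' [0..<Suc k])"
        using out_choice[OF assms f(1), of R c] by blast
      have eq: "j \<le> i \<Longrightarrow> map \<mu>' [0..<Suc j] = map \<mu> [0..<Suc j]" for j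
      proof (induction j)
        case 0
        then show ?case using \<mu> \<mu>'(1) by (simp add: out_def)
      next
        case (Suc j)
        then have IH: "map \<mu>' [0..<Suc j] = map \<mu> [0..<Suc j]" by simp
        have "\<mu>' (Suc j) = c (map \<mu>' [0..<Suc j])"
          by (rule \<mu>'(2)) (use IH Suc in \<open>simp add: R_def del: upt_Suc\<close>)
        moreover have "map \<mu>' [0..<Suc j] \<noteq> ws"
          using Suc by (auto simp: ws_def dest: arg_cong[of _ _ length])
        ultimately have "\<mu>' (Suc j) = \<mu> (Suc j)" by (simp add: c_def del: upt_Suc)
        then show ?case using IH by simp
      qed
      have "\<mu>' (Suc i) = c (map \<mu>' [0..<Suc i])"
        by (rule \<mu>'(2)) (use eq[of i] in \<open>simp add: R_def del: upt_Suc\<close>)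
      then have "\<mu>' (Suc i) = y" using eq[of i] by (simp add: c_def ws_def del: upt_Suc)
      then show ?thesis using \<mu>'(1) unfolding Z_def by blast
    qed
    then show ?thesis
      unfolding eff_def using strat_action_joint[OF f(1) ws(1,2)] ws(3) by auto
  qed
  moreover have "w \<in> Z"
  proof -
    obtain \<mu> where "\<mu> \<in> out Ags S w C f"
      using out_choice[OF assms f(1), of "\<lambda>_ _. False"] by auto
    then show ?thesis by (auto simp: Z_def out_def)
  qed
  moreover have "Z \<subseteq> states S" using out_states by (auto simp: Z_def)
  ultimately show ?R using f(2) by (intro exI[of _ Z]) (auto simp: Z_def)
next
  assume ?R
  then obtain Z where Z: "Z \<subseteq> states S" "w \<in> Z" "\<And>v. v \<in> Z \<Longrightarrow> atl_sat Ags S v \<phi>"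
    "\<And>v. v \<in> Z \<Longrightarrow> eff Ags S C v Z" by blast
  then obtain s where s: "\<And>v. v \<in> Z \<Longrightarrow> s v \<in> joint_acts S C v \<and> delta_set Ags S C v (s v) \<subseteq> Z"
    unfolding eff_def by metis
  obtain f where f: "cgs_coll_strategy S C f"
    "\<And>ws. ws \<noteq> [] \<Longrightarrow> set ws \<subseteq> states S \<Longrightarrow> last ws \<in> Z \<Longrightarrow> strat_action C f ws = s (last ws)"
    using strategy_by_choice[of C "\<lambda>ws. last ws \<in> Z" "\<lambda>ws. s (last ws)"] s assms by blast
  have "\<mu> i \<in> Z" if \<mu>: "\<mu> \<in> out Ags S w C f" for \<mu> i
  proof (induction i)
    case 0 then show ?case using \<mu> Z by (simp add: out_def)
  next
    case (Suc i)
    have "\<mu> (Suc i) \<in> delta_set Ags S C (\<mu> i) (strat_action C f (map \<mu> [0..<Suc i]))"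
      using \<mu> unfolding out_def by blast
    also have "strat_action C f (map \<mu> [0..<Suc i]) = s (\<mu> i)"
      using f(2)[of "map \<mu> [0..<Suc i]"] out_states[OF \<mu>] Suc by auto
    finally show ?case using s[OF Suc] by blast
  qed
  then show ?L using f(1) Z(3) by auto
qed

text \<open>From left to right: a play starting outside \<open>Z\<close> can be kept outside as long
  as the until formula is pending, but the state reaching the goal lies in \<open>Z\<close>. From
  right to left: the truth set of the formula is itself closed under the step.\<close>

lemma atl_sat_until_lfp:
  assumes "C \<subseteq> Ags" "w \<in> states S"
  shows "atl_sat Ags S w (AUntil C \<phi> \<psi>) \<longleftrightarrow>
    (\<forall>Z. (\<forall>v\<in>states S. atl_sat Ags S v \<psi> \<or> atl_sat Ags S v \<phi> \<and> eff Ags S C v Z \<longrightarrow> v \<in> Z)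
       \<longrightarrow> w \<in> Z)" (is "?L \<longleftrightarrow> ?R")
proof
  assume ?L
  then obtain f where f: "cgs_coll_strategy S C f"
    "\<And>\<mu>. \<mu> \<in> out Ags S w C f \<Longrightarrow> \<exists>j. atl_sat Ags S (\<mu> j) \<psi> \<and> (\<forall>i<j. atl_sat Ags S (\<mu> i) \<phi>)"
    by auto
  show ?R
  proof (intro allI impI, rule ccontr)
    fix Z assume Z: "\<forall>v\<in>states S. atl_sat Ags S v \<psi> \<or> atl_sat Ags S v \<phi> \<and> eff Ags S C v Z \<longrightarrow> v \<in> Z"
      and "w \<notin> Z"
    define D where "D ws = delta_set Ags S C (last ws) (strat_action C f ws)" for ws
    define c where "c ws = (SOME y. y \<in> D ws \<and> y \<notin> Z)" for ws
    \<comment> \<open>Legality of the proposal is the control condition here, because a successor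
      outside \<open>Z\<close> is known to exist only along the play under consideration.\<close>
    obtain \<mu> where \<mu>: "\<mu> \<in> out Ags S w C f"
      "\<And>i. c (map \<mu> [0..<Suc i]) \<in> D (map \<mu> [0..<Suc i]) \<Longrightarrow> \<mu> (Suc i) = c (map \<mu> [0..<Suc i])"
      using out_choice[OF assms f(1), of "\<lambda>ws y. y \<in> D ws" c] unfolding D_def by blast
    obtain j where j: "atl_sat Ags S (\<mu> j) \<psi>" "\<forall>i<j. atl_sat Ags S (\<mu> i) \<phi>"
      using f(2) \<mu>(1) by blast
    have "i \<le> j \<Longrightarrow> \<mu> i \<notin> Z" for i
    proof (induction i)
      case 0 then show ?case using \<mu>(1) \<open>w \<notin> Z\<close> by (simp add: out_def)
    next
      case (Suc i)
      define ws where "ws = map \<mu> [0..<Suc i]"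
      have ws: "ws \<noteq> []" "set ws \<subseteq> states S" "last ws = \<mu> i"
        using out_states[OF \<mu>(1)] by (auto simp: ws_def)
      have "\<not> eff Ags S C (\<mu> i) Z" using Z Suc j(2) out_states[OF \<mu>(1)] by auto
      then have "\<not> D ws \<subseteq> Z"
        unfolding D_def eff_def using strat_action_joint[OF f(1) ws(1,2)] ws(3) by auto
      then have "\<exists>y. y \<in> D ws \<and> y \<notin> Z" by blast
      then have "c ws \<in> D ws \<and> c ws \<notin> Z" unfolding c_def by (rule someI_ex)
      then show ?case using \<mu>(2)[of i] by (simp add: ws_def)
    qed
    then show False using Z j(1) out_states[OF \<mu>(1)] by blast
  qed
next
  assume R: ?R
  define Z where "Z = {v. atl_sat Ags S v (AUntil C \<phi> \<psi>)}"
  have "v \<in> Z" if v: "v \<in> states S" and "atl_sat Ags S v \<psi> \<or> atl_sat Ags S v \<phi> \<and> eff Ags S C v Z" for v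
    using that(2)
  proof
    assume "atl_sat Ags S v \<psi>"
    then have "\<exists>j. atl_sat Ags S (\<mu> j) \<psi> \<and> (\<forall>i<j. atl_sat Ags S (\<mu> i) \<phi>)" if "\<mu> \<in> out Ags S v C f" for \<mu> f
      using that by (intro exI[of _ 0]) (simp add: out_def)
    then show ?thesis
      using ex_strategy[OF assms(1)] unfolding Z_def mem_Collect_eq atl_sat.simps by blast
  next
    assume "atl_sat Ags S v \<phi> \<and> eff Ags S C v Z"
    then obtain s where v\<phi>: "atl_sat Ags S v \<phi>" and s: "s \<in> joint_acts S C v" "delta_set Ags S C v s \<subseteq> Z"
      unfolding eff_def by auto
    \<comment> \<open>Outside \<open>Z\<close> any strategy counts as winning, so that a family
      \<open>g\<close> indexed by all states can be chosen.\<close>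
    define win where "win y g \<longleftrightarrow> cgs_coll_strategy S C g \<and> (y \<in> Z \<longrightarrow> (\<forall>\<mu>\<in>out Ags S y C g.
        \<exists>j. atl_sat Ags S (\<mu> j) \<psi> \<and> (\<forall>i<j. atl_sat Ags S (\<mu> i) \<phi>)))" for y g
    have "\<exists>g. win y g" for y
    proof (cases "y \<in> Z")
      case True
      then show ?thesis unfolding win_def Z_def mem_Collect_eq atl_sat.simps by blast
    next
      case False
      then show ?thesis using ex_strategy[OF assms(1)] by (auto simp: win_def)
    qed
    then obtain g where g: "\<And>y. win y (g y)" by metis
    have gs: "cgs_coll_strategy S C (g y)" for y using g by (simp add: win_def)
    \<comment> \<open>\<open>ws ! 1\<close> is the first successor; its own strategy is run on the
      history without the initial state \<open>v\<close>.\<close>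
    define s' where "s' ws = (if ws = [v] then s else strat_action C (g (ws ! 1)) (tl ws))" for ws
    have "s' ws \<in> joint_acts S C (last ws)"
      if ws: "ws \<noteq> []" "set ws \<subseteq> states S" "length ws > 1 \<or> ws = [v]" for ws
    proof (cases "ws = [v]")
      case False
      then have "tl ws \<noteq> []" "set (tl ws) \<subseteq> states S" "last (tl ws) = last ws"
        using ws by (cases ws; force simp: last_tl)+
      then show ?thesis using strat_action_joint[OF gs, of "tl ws"] False by (simp add: s'_def)
    qed (use s in \<open>simp add: s'_def\<close>)
    then obtain f where f: "cgs_coll_strategy S C f"
      "\<And>ws. ws \<noteq> [] \<Longrightarrow> set ws \<subseteq> states S \<Longrightarrow> length ws > 1 \<or> ws = [v] \<Longrightarrow> strat_action C f ws = s' ws"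
      using strategy_by_choice[OF assms(1), of "\<lambda>ws. length ws > 1 \<or> ws = [v]" s'] by blast
    have "\<exists>j. atl_sat Ags S (\<mu> j) \<psi> \<and> (\<forall>i<j. atl_sat Ags S (\<mu> i) \<phi>)"
      if \<mu>: "\<mu> \<in> out Ags S v C f" for \<mu>
    proof -
      have \<mu>0: "\<mu> 0 = v" and \<mu>S: "\<And>i. \<mu> (Suc i) \<in> delta_set Ags S C (\<mu> i) (strat_action C f (map \<mu> [0..<Suc i]))"
        using \<mu> unfolding out_def by blast+
      have "\<mu> 1 \<in> Z" using \<mu>S[of 0] f(2)[of "[v]"] s v \<mu>0 by (auto simp: s'_def)
      have "(\<lambda>i. \<mu> (Suc i)) \<in> out Ags S (\<mu> 1) C (g (\<mu> 1))"
      proof -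
        have "\<mu> (Suc (Suc i)) \<in> delta_set Ags S C (\<mu> (Suc i))
            (strat_action C (g (\<mu> 1)) (map (\<lambda>i. \<mu> (Suc i)) [0..<Suc i]))" for i
        proof -
          have m: "map \<mu> [0..<Suc (Suc i)] = v # map (\<lambda>i. \<mu> (Suc i)) [0..<Suc i]"
            by (subst upt_conv_Cons, simp) (simp add: \<mu>0 map_Suc_upt[symmetric] del: upt_Suc)
          have "strat_action C f (map \<mu> [0..<Suc (Suc i)]) = s' (map \<mu> [0..<Suc (Suc i)])"
            by (rule f(2)) (use out_states[OF \<mu>] in auto)
          also have "\<dots> = strat_action C (g (\<mu> 1)) (map (\<lambda>i. \<mu> (Suc i)) [0..<Suc i])"
            unfolding m by (simp add: s'_def del: upt_Suc)
          finally show ?thesis using \<mu>S[of "Suc i"] by simp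
        qed
        then show ?thesis using out_states[OF \<mu>] by (auto simp: out_def)
      qed
      moreover have "\<forall>\<nu>\<in>out Ags S (\<mu> 1) C (g (\<mu> 1)). \<exists>j. atl_sat Ags S (\<nu> j) \<psi> \<and> (\<forall>i<j. atl_sat Ags S (\<nu> i) \<phi>)"
        using g[of "\<mu> 1"] \<open>\<mu> 1 \<in> Z\<close> unfolding win_def by blast
      ultimately have "\<exists>j. atl_sat Ags S (\<mu> (Suc j)) \<psi> \<and> (\<forall>i<j. atl_sat Ags S (\<mu> (Suc i)) \<phi>)"
        by (auto dest: bspec)
      then obtain j where j: "atl_sat Ags S (\<mu> (Suc j)) \<psi>" "\<forall>i<j. atl_sat Ags S (\<mu> (Suc i)) \<phi>"
        by blast
      have "\<forall>i<Suc j. atl_sat Ags S (\<mu> i) \<phi>"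
        using j(2) v\<phi> \<mu>0 by (auto simp: less_Suc_eq_0_disj)
      then show ?thesis using j(1) by blast
    qed
    then show ?thesis using f(1) by (auto simp: Z_def)
  qed
  then have "w \<in> Z" using R by blast
  then show ?L by (simp add: Z_def)
qed

text \<open>The greatest post-fixed point is a fixed point: adding a state that satisfies the
  right-hand side to the truth set gives a post-fixed set again.\<close>

lemma atl_sat_glob_unfold:
  assumes "C \<subseteq> Ags" "w \<in> states S"
  shows "atl_sat Ags S w (AGlob C \<phi>) \<longleftrightarrow>
    atl_sat Ags S w \<phi> \<and> eff Ags S C w {v \<in> states S. atl_sat Ags S v (AGlob C \<phi>)}"
proof -
  let ?G = "{v \<in> states S. atl_sat Ags S v (AGlob C \<phi>)}"
  have step: "atl_sat Ags S v \<phi> \<and> eff Ags S C v ?G" if v: "v \<in> ?G" for v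
  proof -
    have vS: "v \<in> states S" using v by blast
    have "atl_sat Ags S v (AGlob C \<phi>)" using v by blast
    then obtain Y where Y: "Y \<subseteq> states S" "v \<in> Y" "\<forall>u\<in>Y. atl_sat Ags S u \<phi> \<and> eff Ags S C u Y"
      unfolding atl_sat_glob_gfp[OF assms(1) vS] by blast
    have "Y \<subseteq> ?G"
    proof
      fix u assume u: "u \<in> Y"
      then have uS: "u \<in> states S" using Y(1) by blast
      then have "atl_sat Ags S u (AGlob C \<phi>)"
        unfolding atl_sat_glob_gfp[OF assms(1) uS] using Y u by blast
      then show "u \<in> ?G" using uS by blast
    qed
    then show ?thesis using Y eff_mono[of Ags S C v Y ?G] by blast
  qed
  show ?thesis
  proof
    assume R: "atl_sat Ags S w \<phi> \<and> eff Ags S C w ?G"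
    have "\<forall>v\<in>insert w ?G. atl_sat Ags S v \<phi> \<and> eff Ags S C v (insert w ?G)"
      using R step eff_mono[of Ags S C _ ?G "insert w ?G"] by blast
    then show "atl_sat Ags S w (AGlob C \<phi>)"
      unfolding atl_sat_glob_gfp[OF assms] using assms(2) by (intro exI[of _ "insert w ?G"]) blast
  qed (use step assms(2) in blast)
qed

text \<open>The least pre-fixed point is a fixed point: the states satisfying the right-hand side
  form a pre-fixed set inside the truth set.\<close>

lemma atl_sat_until_unfold:
  assumes "C \<subseteq> Ags" "w \<in> states S"
  shows "atl_sat Ags S w (AUntil C \<phi> \<psi>) \<longleftrightarrow> atl_sat Ags S w \<psi> \<or>
    atl_sat Ags S w \<phi> \<and> eff Ags S C w {v \<in> states S. atl_sat Ags S v (AUntil C \<phi> \<psi>)}"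
proof -
  let ?U = "{v \<in> states S. atl_sat Ags S v (AUntil C \<phi> \<psi>)}"
  let ?step = "\<lambda>v X. atl_sat Ags S v \<psi> \<or> atl_sat Ags S v \<phi> \<and> eff Ags S C v X"
  have fold: "atl_sat Ags S v (AUntil C \<phi> \<psi>)" if v: "v \<in> states S" "?step v ?U" for v
    unfolding atl_sat_until_lfp[OF assms(1) v(1)]
  proof (intro allI impI)
    fix Z assume Z: "\<forall>v\<in>states S. ?step v Z \<longrightarrow> v \<in> Z"
    have "?U \<subseteq> Z"
    proof
      fix u assume u: "u \<in> ?U"
      then have uS: "u \<in> states S" by blast
      have "atl_sat Ags S u (AUntil C \<phi> \<psi>)" using u by blast
      then show "u \<in> Z" unfolding atl_sat_until_lfp[OF assms(1) uS] using Z by blast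
    qed
    then have "?step v Z" using v(2) eff_mono[of Ags S C v ?U Z] by blast
    then show "v \<in> Z" using Z v(1) by blast
  qed
  let ?Z = "{v \<in> states S. ?step v ?U}"
  have "?Z \<subseteq> ?U" using fold by blast
  then have "\<forall>v\<in>states S. ?step v ?Z \<longrightarrow> v \<in> ?Z" using eff_mono[of Ags S C _ ?Z ?U] by blast
  then have "w \<in> ?Z" if "atl_sat Ags S w (AUntil C \<phi> \<psi>)"
    using that unfolding atl_sat_until_lfp[OF assms] by blast
  then show ?thesis using fold[OF assms(2)] by blast
qed

lemma eff_iff_on_states:
  "w \<in> states S \<Longrightarrow> X \<inter> states S = Y \<inter> states S \<Longrightarrow> eff Ags S C w X \<longleftrightarrow> eff Ags S C w Y"
  using eff_Int_states by metis

lemma eff_mono_on_states: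
  "eff Ags S C w X \<Longrightarrow> w \<in> states S \<Longrightarrow> X \<inter> states S \<subseteq> Y \<Longrightarrow> eff Ags S C w Y"
  using eff_Int_states eff_mono by metis

end

section \<open>Deterministic bdt-models as game structures\<close>

text \<open>Hausdorff's principle yields some maximal chain, not one above \<open>C\<close>. Applied
  to the elements comparable with all of \<open>C\<close> it yields one that absorbs
  \<open>C\<close>; it is maximal in \<open>A\<close> too, since a chain around \<open>C\<close>
  consists of such elements.\<close>

lemma chain_extends_to_maxchain:
  assumes "pred_on.chain A R C"
  shows "\<exists>D. pred_on.maxchain A R D \<and> C \<subseteq> D"
proof -
  have chain: "pred_on.chain X R Y \<longleftrightarrow> Y \<subseteq> X \<and> (\<forall>x\<in>Y. \<forall>y\<in>Y. R x y \<or> x = y \<or> R y x)" for X Y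
    by (auto simp: pred_on.chain_def)
  define B where "B = {x \<in> A. \<forall>c\<in>C. R x c \<or> x = c \<or> R c x}"
  obtain D where D: "pred_on.maxchain B R D" using pred_on.Hausdorff by blast
  then have max: "\<And>E. pred_on.chain B R E \<Longrightarrow> \<not> D \<subset> E"
    by (auto simp: pred_on.maxchain_def)
  have DB: "D \<subseteq> B" "\<forall>x\<in>D. \<forall>y\<in>D. R x y \<or> x = y \<or> R y x"
    using D by (simp_all add: pred_on.maxchain_def chain)
  have CA: "C \<subseteq> A" "\<forall>x\<in>C. \<forall>y\<in>C. R x y \<or> x = y \<or> R y x"
    using assms by (simp_all add: chain)
  have "pred_on.chain B R (C \<union> D)"
    unfolding chain
  proof (intro conjI ballI)
    show "C \<union> D \<subseteq> B" using CA DB(1) unfolding B_def by blast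
    fix x y assume "x \<in> C \<union> D" "y \<in> C \<union> D"
    then show "R x y \<or> x = y \<or> R y x" using CA(2) DB unfolding B_def by blast
  qed
  then have CD: "C \<subseteq> D" using max[of "C \<union> D"] by blast
  have "pred_on.maxchain A R D"
    unfolding pred_on.maxchain_def
  proof (intro conjI notI)
    show "pred_on.chain A R D" using DB unfolding chain B_def by blast
    assume "\<exists>E. pred_on.chain A R E \<and> D \<subset> E"
    then obtain E where E: "pred_on.chain A R E" "D \<subset> E" by blast
    then have "pred_on.chain B R E" using CD unfolding chain B_def by blast
    then show False using max E(2) by blast
  qed
  then show ?thesis using CD by blast
qed

text \<open>The order axioms alone, so that facts about histories are available for the unravelling
  before it is known to be a bdt-model.\<close>

locale tree_order =
  fixes M :: "('m, 'a, 't, 'p) bdt"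
  assumes before_irrefl: "x \<in> moments M \<Longrightarrow> \<not> before M x x"
    and before_trans: "before M x y \<Longrightarrow> before M y z \<Longrightarrow>
      x \<in> moments M \<Longrightarrow> y \<in> moments M \<Longrightarrow> z \<in> moments M \<Longrightarrow> before M x z"
    and before_linear: "before M x z \<Longrightarrow> before M y z \<Longrightarrow>
      x \<in> moments M \<Longrightarrow> y \<in> moments M \<Longrightarrow> z \<in> moments M \<Longrightarrow> x = y \<or> before M x y \<or> before M y x"
begin

lemma hist_moments: "h \<in> hists M \<Longrightarrow> h \<subseteq> moments M"
  by (auto simp: hists_def pred_on.maxchain_def pred_on.chain_def)

lemma hist_comparable: "h \<in> hists M \<Longrightarrow> x \<in> h \<Longrightarrow> y \<in> h \<Longrightarrow> before M x y \<or> x = y \<or> before M y x"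
  by (auto simp: hists_def pred_on.maxchain_def pred_on.chain_def)

lemma hist_maximal:
  assumes "h \<in> hists M" "x \<in> moments M" "\<And>y. y \<in> h \<Longrightarrow> before M x y \<or> x = y \<or> before M y x"
  shows "x \<in> h"
proof (rule ccontr)
  assume "x \<notin> h"
  have "pred_on.chain (moments M) (before M) (insert x h)"
    using hist_moments[OF assms(1)] hist_comparable[OF assms(1)] assms(2,3)
    unfolding pred_on.chain_def by auto
  then show False using assms(1) \<open>x \<notin> h\<close> unfolding hists_def pred_on.maxchain_def by blast
qed

text \<open>Absence of backward branching makes \<open>y\<close> comparable with everything in
  \<open>h\<close> below \<open>x\<close>, transitivity with everything above; maximality then puts
  it into \<open>h\<close>.\<close>

lemma hist_downward:
  assumes "h \<in> hists M" "x \<in> h" "y \<in> moments M" "before M y x"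
  shows "y \<in> h"
proof (rule hist_maximal[OF assms(1,3)])
  fix z assume z: "z \<in> h"
  then have xz: "x \<in> moments M" "z \<in> moments M" using hist_moments assms by blast+
  consider "before M x z" | "x = z" | "before M z x" using hist_comparable assms z by blast
  then show "before M y z \<or> y = z \<or> before M z y"
  proof cases
    case 1 then show ?thesis using before_trans assms xz by blast
  next
    case 3
    then show ?thesis using before_linear[of y x z] assms xz by blast
  qed (use assms in auto)
qed

lemma hist_extending: "pred_on.chain (moments M) (before M) C \<Longrightarrow> \<exists>h\<in>hists M. C \<subseteq> h"
  using chain_extends_to_maxchain[of "moments M" "before M" C] unfolding hists_def by blast

lemma hists_at_nonempty: "m \<in> moments M \<Longrightarrow> hists_at M m \<noteq> {}"
  using hist_extending[of "{m}"] by (auto simp: hists_at_def pred_on.chain_def)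

end

locale det_bdt =
  fixes Ags :: "'a set" and M :: "('m, 'a, 't, 'p) bdt"
  assumes tree: "discrete_tree M" and choices: "choice_conditions Ags M"
    and det: "deterministic Ags M"
begin

sublocale tree_order M
proof
  show "\<not> before M x x" if "x \<in> moments M" for x
    using tree that unfolding discrete_tree_def by (blast dest: irreflp_onD)
  show "before M x z" if "before M x y" "before M y z" "x \<in> moments M" "y \<in> moments M" "z \<in> moments M" for x y z
    using tree that unfolding discrete_tree_def by (blast dest: transp_onD)
  show "x = y \<or> before M x y \<or> before M y x"
    if "before M x z" "before M y z" "x \<in> moments M" "y \<in> moments M" "z \<in> moments M" for x y z
    using tree that unfolding discrete_tree_def by blast
qed

lemma is_succ_succ: "h \<in> hists_at M m \<Longrightarrow> is_succ M m h (succ M m h)"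
proof -
  assume h: "h \<in> hists_at M m"
  then have "m \<in> moments M" using hist_moments by (auto simp: hists_at_def)
  then have "\<exists>!m'. is_succ M m h m'" using tree h unfolding discrete_tree_def by blast
  then show ?thesis unfolding succ_def by (rule theI')
qed

lemma hists_at_succ: "h \<in> hists_at M m \<Longrightarrow> h \<in> hists_at M (succ M m h)"
  using is_succ_succ by (auto simp: hists_at_def is_succ_def)

lemma before_succ: "h \<in> hists_at M m \<Longrightarrow> before M m (succ M m h)"
  using is_succ_succ by (auto simp: is_succ_def)

lemma hists_at_moments: "h \<in> hists_at M m \<Longrightarrow> m \<in> moments M"
  using hist_moments by (auto simp: hists_at_def)

lemma succ_unique:
  assumes "h \<in> hists_at M m" "is_succ M m h m'"
  shows "succ M m h = m'"
proof -
  have "\<exists>!m'. is_succ M m h m'"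
    using tree hists_at_moments[OF assms(1)] assms(1) unfolding discrete_tree_def by blast
  then show ?thesis using is_succ_succ[OF assms(1)] assms(2) by blast
qed

text \<open>A moment of \<open>h'\<close> below the successor along \<open>h\<close> lies on
  \<open>h\<close> by downward closure, so nothing on \<open>h'\<close> comes strictly in
  between.\<close>

lemma succ_eq:
  assumes h: "h \<in> hists_at M m" and h': "h' \<in> hists_at M m" "succ M m h \<in> h'"
  shows "succ M m h' = succ M m h"
proof (rule succ_unique[OF h'(1)])
  have s: "is_succ M m h (succ M m h)" by (rule is_succ_succ[OF h])
  have "before_eq M (succ M m h) m''" if m'': "m'' \<in> h'" "before M m m''" for m''
  proof -
    have "before M (succ M m h) m'' \<or> succ M m h = m'' \<or> before M m'' (succ M m h)"
      using hist_comparable h' m'' by (auto simp: hists_at_def)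
    moreover have "m'' \<in> h" if "before M m'' (succ M m h)"
      using that hist_downward[of h "succ M m h" m''] s h h' m'' hist_moments
      by (auto simp: hists_at_def is_succ_def)
    ultimately show ?thesis using s m'' unfolding is_succ_def before_eq_def by blast
  qed
  then show "is_succ M m h' (succ M m h)"
    using s h' by (auto simp: is_succ_def)
qed

lemma succ_iter_Suc: "succ_iter M m h (Suc i) = succ M (succ_iter M m h i) h"
  by (simp add: succ_iter_def)

lemma succ_iter_0: "succ_iter M m h 0 = m"
  by (simp add: succ_iter_def)

lemma hists_at_succ_iter: "h \<in> hists_at M m \<Longrightarrow> h \<in> hists_at M (succ_iter M m h i)"
  by (induction i) (simp_all add: succ_iter_0 succ_iter_Suc hists_at_succ)

lemma before_increasing:
  assumes "\<And>i. \<mu> i \<in> moments M" "\<And>i. before M (\<mu> i) (\<mu> (Suc i))" "i < j"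
  shows "before M (\<mu> i) (\<mu> j)"
  using assms(3)
proof (induction j)
  case (Suc j)
  then show ?case using assms before_trans[of "\<mu> i" "\<mu> j" "\<mu> (Suc j)"] by (auto simp: less_Suc_eq)
qed simp

lemma succ_iter_before:
  assumes "h \<in> hists_at M m" "i < j"
  shows "before M (succ_iter M m h i) (succ_iter M m h j)"
proof (rule before_increasing[OF _ _ assms(2)])
  fix i
  have "h \<in> hists_at M (succ_iter M m h i)" by (rule hists_at_succ_iter[OF assms(1)])
  then show "succ_iter M m h i \<in> moments M"
    and "before M (succ_iter M m h i) (succ_iter M m h (Suc i))"
    by (simp_all add: succ_iter_Suc before_succ hists_at_moments)
qed

text \<open>A maximal chain extending the path may contain further moments before it or above all of
  it, but none in between, by \<open>succ_eq\<close>; hence its iterated successors are the given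
  ones.\<close>

lemma hist_of_path:
  assumes "\<And>i. \<exists>h\<in>hists_at M (\<mu> i). \<mu> (Suc i) = succ M (\<mu> i) h"
  shows "\<exists>h\<in>hists_at M (\<mu> 0). \<forall>i. succ_iter M (\<mu> 0) h i = \<mu> i"
proof -
  have mom: "\<mu> i \<in> moments M" and bef: "before M (\<mu> i) (\<mu> (Suc i))" for i
    using assms[of i] hists_at_moments before_succ by auto
  have "pred_on.chain (moments M) (before M) (range \<mu>)"
    unfolding pred_on.chain_def
  proof (intro conjI ballI)
    fix x y assume "x \<in> range \<mu>" "y \<in> range \<mu>"
    then obtain i j where "x = \<mu> i" "y = \<mu> j" by blast
    then show "(before M)\<^sup>=\<^sup>= x y \<or> (before M)\<^sup>=\<^sup>= y x"
      using before_increasing[of \<mu> i j] before_increasing[of \<mu> j i] mom bef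
      by (cases i j rule: linorder_cases) auto
  qed (use mom in auto)
  then obtain h where h: "h \<in> hists M" "range \<mu> \<subseteq> h" using hist_extending by blast
  then have at: "h \<in> hists_at M (\<mu> i)" for i by (auto simp: hists_at_def)
  have "succ M (\<mu> i) h = \<mu> (Suc i)" for i
  proof -
    obtain g where "g \<in> hists_at M (\<mu> i)" "\<mu> (Suc i) = succ M (\<mu> i) g" using assms by blast
    then show ?thesis using succ_eq[of g "\<mu> i" h] at[of i] range_subsetD[OF h(2), of "Suc i"] by simp
  qed
  then have "succ_iter M (\<mu> 0) h i = \<mu> i" for i
    by (induction i) (simp_all add: succ_iter_0 succ_iter_Suc)
  then show ?thesis using at by blast
qed

text \<open>The past of a moment is linear, so the steps from \<open>m\<close> to it agree along all
  histories; irreflexivity fixes their number.\<close>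

lemma succ_iter_path_unique:
  assumes h: "h \<in> hists_at M m" and h': "h' \<in> hists_at M m"
    and eq: "succ_iter M m h k = succ_iter M m h' k'"
  shows "map (succ_iter M m h) [0..<Suc k] = map (succ_iter M m h') [0..<Suc k']"
proof -
  have "i \<le> k \<Longrightarrow> succ_iter M m h i = succ_iter M m h' i" for i
  proof (induction i)
    case (Suc i)
    have k: "succ_iter M m h k \<in> h'"
      using hists_at_succ_iter[OF h', of k'] eq by (auto simp: hists_at_def)
    have "succ_iter M m h (Suc i) \<in> h'"
    proof (cases "Suc i = k")
      case False
      then have "before M (succ_iter M m h (Suc i)) (succ_iter M m h k)"
        using succ_iter_before[OF h] Suc by auto
      then show ?thesis
        using hist_downward[OF _ k] h' hists_at_moments[OF hists_at_succ_iter[OF h]]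
        by (auto simp: hists_at_def)
    qed (use k in simp)
    then show ?case
      using succ_eq[OF hists_at_succ_iter[OF h, of i], of h'] hists_at_succ_iter[OF h', of i] Suc
      by (simp add: succ_iter_Suc)
  qed (simp add: succ_iter_0)
  moreover have "k = k'"
  proof (rule ccontr)
    have "succ_iter M m h' k = succ_iter M m h' k'" using calculation[of k] eq by simp
    moreover assume "k \<noteq> k'"
    ultimately show False
      using succ_iter_before[OF h', of k k'] succ_iter_before[OF h', of k' k]
        before_irrefl hists_at_moments[OF hists_at_succ_iter[OF h']]
      by (cases k k' rule: linorder_cases) auto
  qed
  ultimately show ?thesis by auto
qed

section \<open>Choice cells, and the game structure read off them\<close>

lemma choice_partition: "\<alpha> \<in> Ags \<Longrightarrow> m \<in> moments M \<Longrightarrow> partition_on (hists_at M m) (choice M \<alpha> m)"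
  using choices by (auto simp: choice_conditions_def)

lemma cell_eq:
  assumes "\<alpha> \<in> Ags" "m \<in> moments M" "L \<in> choice M \<alpha> m" "h \<in> L"
  shows "cell M \<alpha> m h = L"
  unfolding cell_def
  using partition_onD2[OF choice_partition[OF assms(1,2)]] assms
  by (intro the_equality) (auto simp: disjoint_def)

lemma cell_choice:
  assumes "\<alpha> \<in> Ags" "h \<in> hists_at M m"
  shows "cell M \<alpha> m h \<in> choice M \<alpha> m" "h \<in> cell M \<alpha> m h"
proof -
  have m: "m \<in> moments M" using assms hists_at_moments by blast
  obtain L where "L \<in> choice M \<alpha> m" "h \<in> L"
    using partition_onD1[OF choice_partition[OF assms(1) m]] assms by auto
  then show "cell M \<alpha> m h \<in> choice M \<alpha> m" "h \<in> cell M \<alpha> m h"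
    using cell_eq[OF assms(1) m] by auto
qed

lemma undivided_cell:
  assumes "\<alpha> \<in> Ags" "h \<in> hists_at M m" "h' \<in> hists_at M m" "m' \<in> h" "m' \<in> h'" "before M m m'"
    and "L \<in> choice M \<alpha> m" "h \<in> L"
  shows "h' \<in> L"
proof -
  have m: "m \<in> moments M" using assms hists_at_moments by blast
  then have "cell M \<alpha> m h = cell M \<alpha> m h'"
    using choices assms unfolding choice_conditions_def by blast
  then show ?thesis using cell_eq[OF assms(1) m assms(7,8)] cell_choice[OF assms(1,3)] by simp
qed

text \<open>A profile of cells is met by some history by (IA), and all such histories have the same
  successor by determinism, so \<open>SOME\<close> is harmless at available profiles. Letters are
  read as settled truth, matching the box in their translation.\<close>

definition to_cgs :: "('m, 'a, 'm set set, 'p) cgs" where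
  "to_cgs = \<lparr>states = moments M, acts = choice M,
     delta = (\<lambda>m t. succ M m (SOME h. h \<in> hists_at M m \<and> (\<forall>\<alpha>\<in>Ags. h \<in> t \<alpha>))),
     cgs_val = (\<lambda>p. {m \<in> moments M. \<forall>h\<in>hists_at M m. (m, h) \<in> bdt_val M p})\<rparr>"

lemma to_cgs_sel [simp]:
  "states to_cgs = moments M" "acts to_cgs = choice M"
  "cgs_val to_cgs p = {m \<in> moments M. \<forall>h\<in>hists_at M m. (m, h) \<in> bdt_val M p}"
  by (simp_all add: to_cgs_def)

lemma delta_to_cgs:
  assumes "\<And>\<alpha>. \<alpha> \<in> Ags \<Longrightarrow> t \<alpha> \<in> choice M \<alpha> m"
    and h: "h \<in> hists_at M m" "\<And>\<alpha>. \<alpha> \<in> Ags \<Longrightarrow> h \<in> t \<alpha>"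
  shows "delta to_cgs m t = succ M m h"
proof -
  define h' where "h' = (SOME h. h \<in> hists_at M m \<and> (\<forall>\<alpha>\<in>Ags. h \<in> t \<alpha>))"
  have h': "h' \<in> hists_at M m \<and> (\<forall>\<alpha>\<in>Ags. h' \<in> t \<alpha>)"
    unfolding h'_def by (rule someI[of _ h]) (use h in blast)
  have m: "m \<in> moments M" using h(1) hists_at_moments by blast
  then have "cell M \<alpha> m h = t \<alpha>" if "\<alpha> \<in> Ags" for \<alpha>
    using cell_eq assms that by blast
  then have "h' \<in> coll_cell M Ags m h"
    using h' by (auto simp: coll_cell_def)
  then have "succ M m h = succ M m h'"
    using det m h(1) unfolding deterministic_def by blast
  then show ?thesis by (simp add: to_cgs_def h'_def)
qed

lemma ex_hist_of_profile:
  assumes "m \<in> moments M" "\<And>\<alpha>. \<alpha> \<in> Ags \<Longrightarrow> t \<alpha> \<in> choice M \<alpha> m"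
  shows "\<exists>h\<in>hists_at M m. \<forall>\<alpha>\<in>Ags. h \<in> t \<alpha>"
proof -
  have "hists_at M m \<inter> (\<Inter>\<alpha>\<in>Ags. t \<alpha>) \<noteq> {}"
    using choices[unfolded choice_conditions_def, THEN conjunct2, THEN conjunct2, THEN bspec,
        OF assms(1), THEN spec[of _ t]] assms(2) by blast
  then show ?thesis by auto
qed

text \<open>A history in the cells of \<open>C\<close> also determines cells of all other agents,
  namely those it lies in, and so comes from a full profile; conversely (IA) provides a history for
  every profile.\<close>

lemma delta_set_to_cgs:
  assumes "C \<subseteq> Ags" "m \<in> moments M" "\<And>\<alpha>. \<alpha> \<in> C \<Longrightarrow> s \<alpha> \<in> choice M \<alpha> m"
  shows "delta_set Ags to_cgs C m s = {succ M m h | h. h \<in> hists_at M m \<and> (\<forall>\<alpha>\<in>C. h \<in> s \<alpha>)}"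
proof (intro set_eqI iffI)
  fix x assume "x \<in> delta_set Ags to_cgs C m s"
  then obtain t where t: "x = delta to_cgs m t" "\<And>\<alpha>. \<alpha> \<in> Ags \<Longrightarrow> t \<alpha> \<in> choice M \<alpha> m"
    "\<And>\<alpha>. \<alpha> \<in> C \<Longrightarrow> t \<alpha> = s \<alpha>"
    unfolding delta_set_def joint_acts_def by fastforce
  obtain h where h: "h \<in> hists_at M m" "\<And>\<alpha>. \<alpha> \<in> Ags \<Longrightarrow> h \<in> t \<alpha>"
    using ex_hist_of_profile[of m t] assms(2) t(2) by blast
  have "x = succ M m h" using delta_to_cgs[of t m h] t h by simp
  then show "x \<in> {succ M m h | h. h \<in> hists_at M m \<and> (\<forall>\<alpha>\<in>C. h \<in> s \<alpha>)}"
    using h t(3) assms(1) by force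
next
  fix x assume "x \<in> {succ M m h | h. h \<in> hists_at M m \<and> (\<forall>\<alpha>\<in>C. h \<in> s \<alpha>)}"
  then obtain h where h: "x = succ M m h" "h \<in> hists_at M m" "\<And>\<alpha>. \<alpha> \<in> C \<Longrightarrow> h \<in> s \<alpha>" by blast
  define t where "t = (\<lambda>\<alpha>\<in>Ags. cell M \<alpha> m h)"
  have "delta to_cgs m t = x"
    unfolding h(1) by (rule delta_to_cgs) (use h cell_choice in \<open>auto simp: t_def\<close>)
  moreover have "t \<in> joint_acts to_cgs Ags m"
    using cell_choice[OF _ h(2)] by (auto simp: joint_acts_def t_def)
  moreover have "\<forall>\<alpha>\<in>C. t \<alpha> = s \<alpha>"
    using assms h(3) cell_eq by (auto simp: t_def)
  ultimately show "x \<in> delta_set Ags to_cgs C m s" by (auto simp: delta_set_def)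
qed

sublocale cgs: game Ags to_cgs
proof
  fix \<alpha> m assume a: "\<alpha> \<in> Ags" "m \<in> states to_cgs"
  then obtain h where "h \<in> hists_at M m" using hists_at_nonempty by fastforce
  then show "acts to_cgs \<alpha> m \<noteq> {}" using cell_choice(1)[OF a(1)] by auto
next
  fix m t assume a: "m \<in> states to_cgs" "t \<in> joint_acts to_cgs Ags m"
  then obtain h where h: "h \<in> hists_at M m" "\<And>\<alpha>. \<alpha> \<in> Ags \<Longrightarrow> h \<in> t \<alpha>"
    using ex_hist_of_profile[of m t] by (auto simp: joint_acts_def)
  have "delta to_cgs m t = succ M m h"
    by (rule delta_to_cgs) (use a h in \<open>auto simp: joint_acts_def\<close>)
  then show "delta to_cgs m t \<in> states to_cgs"
    using hists_at_moments[OF hists_at_succ[OF h(1)]] by simp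
qed

text \<open>Each step of an outcome is witnessed by its own history. The path is gathered into a
  single history \<open>h\<close>, and (NC) carries membership in the chosen cells over to
  \<open>h\<close>, since \<open>h\<close> and the witness share the next moment.\<close>

lemma outcome_of_bdt_strategy:
  assumes C: "C \<subseteq> Ags" and m: "m \<in> moments M" and \<sigma>: "bdt_coll_strategy M C m \<sigma>"
  shows "\<exists>f. cgs_coll_strategy to_cgs C f \<and>
           (\<forall>\<mu>\<in>out Ags to_cgs m C f. \<exists>h\<in>Adm M C m \<sigma>. succ_iter M m h = \<mu>)"
proof -
  have \<sigma>': "\<sigma> \<alpha> v \<in> choice M \<alpha> v" if "\<alpha> \<in> C" "v \<in> moments M" "before_eq M m v" for \<alpha> v
    using \<sigma> that by (auto simp: bdt_coll_strategy_def bdt_strategy_def)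
  \<comment> \<open>\<sigma> is constrained only from \<open>m\<close> on, hence the condition on
    \<open>last ws\<close>.\<close>
  obtain f where f: "cgs_coll_strategy to_cgs C f"
    "\<And>ws. ws \<noteq> [] \<Longrightarrow> set ws \<subseteq> moments M \<Longrightarrow> before_eq M m (last ws) \<Longrightarrow>
       strat_action C f ws = (\<lambda>\<alpha>\<in>C. \<sigma> \<alpha> (last ws))"
    using cgs.strategy_by_choice[OF C, of "\<lambda>ws. before_eq M m (last ws)" "\<lambda>ws. \<lambda>\<alpha>\<in>C. \<sigma> \<alpha> (last ws)"]
      \<sigma>' last_in_set by (fastforce simp: joint_acts_def)
  have "\<exists>h\<in>Adm M C m \<sigma>. succ_iter M m h = \<mu>" if \<mu>: "\<mu> \<in> out Ags to_cgs m C f" for \<mu>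
  proof -
    have mom: "\<mu> i \<in> moments M" for i using cgs.out_states[OF \<mu>] by simp
    have step: "\<exists>h\<in>hists_at M (\<mu> i). (\<forall>\<alpha>\<in>C. h \<in> \<sigma> \<alpha> (\<mu> i)) \<and> \<mu> (Suc i) = succ M (\<mu> i) h"
      if b: "before_eq M m (\<mu> i)" for i
    proof -
      have "\<mu> (Suc i) \<in> delta_set Ags to_cgs C (\<mu> i) (strat_action C f (map \<mu> [0..<Suc i]))"
        using \<mu> unfolding out_def by blast
      also have "strat_action C f (map \<mu> [0..<Suc i]) = (\<lambda>\<alpha>\<in>C. \<sigma> \<alpha> (\<mu> i))"
        using f(2)[of "map \<mu> [0..<Suc i]"] b mom by auto
      finally show ?thesis
        using \<sigma>'[OF _ mom b] by (subst (asm) delta_set_to_cgs[OF C mom]) auto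
    qed
    have bef: "before_eq M m (\<mu> i)" for i
    proof (induction i)
      case 0
      then show ?case using \<mu> by (simp add: out_def before_eq_def)
    next
      case (Suc i)
      obtain h where "h \<in> hists_at M (\<mu> i)" "\<mu> (Suc i) = succ M (\<mu> i) h" using step[OF Suc] by blast
      then have "before M (\<mu> i) (\<mu> (Suc i))" using before_succ by simp
      then show ?case using Suc before_trans[OF _ _ m mom mom] by (auto simp: before_eq_def)
    qed
    have m0: "\<mu> 0 = m" using \<mu> by (simp add: out_def)
    obtain h where h: "h \<in> hists_at M m" "\<And>i. succ_iter M m h i = \<mu> i"
      using hist_of_path[of \<mu>] step[OF bef] unfolding m0 by blast
    have "h \<in> \<sigma> \<alpha> (\<mu> i)" if "\<alpha> \<in> C" for \<alpha> i
    proof -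
      obtain h' where h': "h' \<in> hists_at M (\<mu> i)" "\<forall>\<alpha>\<in>C. h' \<in> \<sigma> \<alpha> (\<mu> i)" "\<mu> (Suc i) = succ M (\<mu> i) h'"
        using step[OF bef[of i]] by blast
      have hi: "h \<in> hists_at M (\<mu> i)" "\<mu> (Suc i) \<in> h"
        using hists_at_succ_iter[OF h(1), of i] hists_at_succ_iter[OF h(1), of "Suc i"] h(2)
        by (simp_all add: hists_at_def)
      have "\<mu> (Suc i) \<in> h'" "before M (\<mu> i) (\<mu> (Suc i))"
        using hists_at_succ[OF h'(1)] before_succ[OF h'(1)] h'(3) by (simp_all add: hists_at_def)
      moreover have "\<alpha> \<in> Ags" "h' \<in> \<sigma> \<alpha> (\<mu> i)" using that C h'(2) by blast+
      ultimately show ?thesis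
        using undivided_cell[of \<alpha> h' "\<mu> i" h "\<mu> (Suc i)"] h'(1) hi \<sigma>'[OF that mom bef] by blast
    qed
    then have "h \<in> Adm M C m \<sigma>"
      using h hists_at_succ_iter[OF h(1)] by (auto simp: Adm_def strat_cell_def)
    then show ?thesis using h(2) by blast
  qed
  then show ?thesis using f(1) by blast
qed

text \<open>In a tree a moment determines the path leading to it, so a memoryless strategy can imitate a
  strategy with perfect recall.\<close>

lemma outcome_of_cgs_strategy:
  assumes C: "C \<subseteq> Ags" and m: "m \<in> moments M" and f: "cgs_coll_strategy to_cgs C f"
  shows "\<exists>\<sigma>. bdt_coll_strategy M C m \<sigma> \<and>
           (\<forall>h\<in>Adm M C m \<sigma>. succ_iter M m h \<in> out Ags to_cgs m C f)"
proof -
  define path where "path h k = map (succ_iter M m h) [0..<Suc k]" for h and k :: nat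
  \<comment> \<open>The pair \<open>hk\<close> codes \<open>v\<close> as the
    \<open>snd hk\<close>-th successor of \<open>m\<close> along \<open>fst hk\<close>; by
    \<open>succ_iter_path_unique\<close> the path \<open>p v\<close> does not depend on the
    code.\<close>
  define R where "R v hk \<longleftrightarrow> fst hk \<in> hists_at M m \<and> succ_iter M m (fst hk) (snd hk) = v" for v hk
  define p where "p v = (let hk = SOME hk. R v hk in path (fst hk) (snd hk))" for v
  \<comment> \<open>Moments not reached from \<open>m\<close> in finitely many steps have no code
    and get an arbitrary cell.\<close>
  define \<sigma> where "\<sigma> \<alpha> v = (if \<exists>hk. R v hk then f \<alpha> (p v) else SOME L. L \<in> choice M \<alpha> v)" for \<alpha> v
  have path: "path h k \<noteq> []" "set (path h k) \<subseteq> moments M" "last (path h k) = succ_iter M m h k"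
    if "h \<in> hists_at M m" for h k
    using hists_at_moments[OF hists_at_succ_iter[OF that]] by (auto simp: path_def)
  have p: "p (succ_iter M m h k) = path h k" if "h \<in> hists_at M m" for h k
  proof -
    let ?hk = "SOME hk. R (succ_iter M m h k) hk"
    have "R (succ_iter M m h k) ?hk"
      by (rule someI[of _ "(h, k)"]) (use that in \<open>simp add: R_def\<close>)
    then show ?thesis
      using succ_iter_path_unique[of "fst ?hk" m h "snd ?hk" k] that
      by (simp add: R_def p_def path_def Let_def del: upt_Suc)
  qed
  have "\<sigma> \<alpha> v \<in> choice M \<alpha> v" if "\<alpha> \<in> C" "v \<in> moments M" for \<alpha> v
  proof (cases "\<exists>hk. R v hk")
    case True
    then obtain h k where h: "h \<in> hists_at M m" "v = succ_iter M m h k" by (auto simp: R_def)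
    have "f \<alpha> (path h k) \<in> choice M \<alpha> (last (path h k))"
      using f path(1,2)[OF h(1), of k] that(1)
      unfolding cgs_coll_strategy_def cgs_strategy_def to_cgs_sel by blast
    then have "f \<alpha> (path h k) \<in> choice M \<alpha> v" using path(3)[OF h(1)] h(2) by simp
    then show ?thesis using True p[OF h(1), of k] h(2) by (simp add: \<sigma>_def)
  next
    case False
    then show ?thesis using cgs.some_act[of \<alpha> v] that C by (auto simp: \<sigma>_def)
  qed
  then have "bdt_coll_strategy M C m \<sigma>"
    by (auto simp: bdt_coll_strategy_def bdt_strategy_def)
  moreover have "succ_iter M m h \<in> out Ags to_cgs m C f" if h: "h \<in> Adm M C m \<sigma>" for h
  proof -
    have hm: "h \<in> hists_at M m" using h by (simp add: Adm_def)
    have "succ_iter M m h (Suc i) \<in> delta_set Ags to_cgs C (succ_iter M m h i)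
        (strat_action C f (map (succ_iter M m h) [0..<Suc i]))" for i
    proof -
      let ?v = "succ_iter M m h i"
      have hv: "h \<in> hists_at M ?v" "?v \<in> moments M"
        using hists_at_succ_iter[OF hm] hists_at_moments by blast+
      have "\<sigma> \<alpha> ?v = f \<alpha> (path h i)" for \<alpha>
        using p[OF hm, of i] hm by (auto simp: \<sigma>_def R_def)
      then have "h \<in> f \<alpha> (path h i)" if "\<alpha> \<in> C" for \<alpha>
        using h that by (auto simp: Adm_def strat_cell_def)
      moreover have "strat_action C f (path h i) \<alpha> \<in> choice M \<alpha> ?v" if "\<alpha> \<in> C" for \<alpha>
        using cgs.strat_action_joint[OF f, of "path h i"] path[OF hm, of i] that
        by (auto simp: joint_acts_def)
      ultimately have "succ M ?v h \<in> delta_set Ags to_cgs C ?v (strat_action C f (path h i))"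
        using hv by (subst delta_set_to_cgs[OF C hv(2)]) (auto simp: strat_action_def)
      then show ?thesis by (simp add: path_def succ_iter_Suc)
    qed
    then show ?thesis
      using hists_at_moments[OF hists_at_succ_iter[OF hm]] by (auto simp: out_def succ_iter_0)
  qed
  ultimately show ?thesis by blast
qed

text \<open>Stated for an arbitrary property \<open>Q\<close> of paths, so that next, globally and
  until are instances. In each direction it is enough that the outcomes of the new strategy are
  among those of the old.\<close>

lemma strategy_transfer:
  assumes "C \<subseteq> Ags" "m \<in> moments M"
  shows "(\<exists>\<sigma>. bdt_coll_strategy M C m \<sigma> \<and> (\<forall>h\<in>Adm M C m \<sigma>. Q (succ_iter M m h))) \<longleftrightarrow>
         (\<exists>f. cgs_coll_strategy to_cgs C f \<and> (\<forall>\<mu>\<in>out Ags to_cgs m C f. Q \<mu>))"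
proof
  assume "\<exists>\<sigma>. bdt_coll_strategy M C m \<sigma> \<and> (\<forall>h\<in>Adm M C m \<sigma>. Q (succ_iter M m h))"
  then obtain \<sigma> where \<sigma>: "bdt_coll_strategy M C m \<sigma>" "\<forall>h\<in>Adm M C m \<sigma>. Q (succ_iter M m h)"
    by blast
  obtain f where "cgs_coll_strategy to_cgs C f"
    "\<forall>\<mu>\<in>out Ags to_cgs m C f. \<exists>h\<in>Adm M C m \<sigma>. succ_iter M m h = \<mu>"
    using outcome_of_bdt_strategy[OF assms \<sigma>(1)] by blast
  then show "\<exists>f. cgs_coll_strategy to_cgs C f \<and> (\<forall>\<mu>\<in>out Ags to_cgs m C f. Q \<mu>)"
    using \<sigma>(2) by (intro exI[of _ f]) auto
next
  assume "\<exists>f. cgs_coll_strategy to_cgs C f \<and> (\<forall>\<mu>\<in>out Ags to_cgs m C f. Q \<mu>)"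
  then obtain f where f: "cgs_coll_strategy to_cgs C f" "\<forall>\<mu>\<in>out Ags to_cgs m C f. Q \<mu>"
    by blast
  obtain \<sigma> where "bdt_coll_strategy M C m \<sigma>"
    "\<forall>h\<in>Adm M C m \<sigma>. succ_iter M m h \<in> out Ags to_cgs m C f"
    using outcome_of_cgs_strategy[OF assms f(1)] by blast
  then show "\<exists>\<sigma>. bdt_coll_strategy M C m \<sigma> \<and> (\<forall>h\<in>Adm M C m \<sigma>. Q (succ_iter M m h))"
    using f(2) by (intro exI[of _ \<sigma>]) auto
qed

theorem stit_sat_Tr:
  assumes "\<phi> \<in> atl_lang Ags P" "h \<in> hists_at M m"
  shows "stit_sat M m h (Tr \<phi>) \<longleftrightarrow> atl_sat Ags to_cgs m \<phi>"
  using assms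
proof (induction arbitrary: m h rule: atl_lang.induct)
  case (1 p)
  then show ?case using hists_at_moments by auto
next
  case (4 C \<phi>)
  have "stit_sat M m h (Tr (ANext C \<phi>)) \<longleftrightarrow>
      (\<exists>\<sigma>. bdt_coll_strategy M C m \<sigma> \<and> (\<forall>h\<in>Adm M C m \<sigma>. atl_sat Ags to_cgs (succ_iter M m h 1) \<phi>))"
    using 4(3)[OF hists_at_succ] by (auto simp: succ_iter_def Adm_def)
  also have "\<dots> \<longleftrightarrow> atl_sat Ags to_cgs m (ANext C \<phi>)"
    using strategy_transfer[OF 4(1), of m "\<lambda>\<mu>. atl_sat Ags to_cgs (\<mu> 1) \<phi>"] hists_at_moments[OF 4(4)]
    by simp
  finally show ?case .
next
  case (5 C \<phi>)
  have "stit_sat M m h (Tr (AGlob C \<phi>)) \<longleftrightarrow>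
      (\<exists>\<sigma>. bdt_coll_strategy M C m \<sigma> \<and> (\<forall>h\<in>Adm M C m \<sigma>. \<forall>i. atl_sat Ags to_cgs (succ_iter M m h i) \<phi>))"
    using 5(3)[OF hists_at_succ_iter] by (auto simp: Adm_def)
  also have "\<dots> \<longleftrightarrow> atl_sat Ags to_cgs m (AGlob C \<phi>)"
    using strategy_transfer[OF 5(1), of m "\<lambda>\<mu>. \<forall>i. atl_sat Ags to_cgs (\<mu> i) \<phi>"] hists_at_moments[OF 5(4)]
    by simp
  finally show ?case .
next
  case (6 C \<phi> \<psi>)
  have "stit_sat M m h (Tr (AUntil C \<phi> \<psi>)) \<longleftrightarrow>
      (\<exists>\<sigma>. bdt_coll_strategy M C m \<sigma> \<and> (\<forall>h\<in>Adm M C m \<sigma>. \<exists>j. atl_sat Ags to_cgs (succ_iter M m h j) \<psi> \<and>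
         (\<forall>i<j. atl_sat Ags to_cgs (succ_iter M m h i) \<phi>)))"
    using 6(4)[OF hists_at_succ_iter] 6(5)[OF hists_at_succ_iter] by (simp add: Adm_def)
  also have "\<dots> \<longleftrightarrow> atl_sat Ags to_cgs m (AUntil C \<phi> \<psi>)"
    using strategy_transfer[OF 6(1), of m "\<lambda>\<mu>. \<exists>j. atl_sat Ags to_cgs (\<mu> j) \<psi> \<and> (\<forall>i<j. atl_sat Ags to_cgs (\<mu> i) \<phi>)"]
      hists_at_moments[OF 6(6)]
    by simp
  finally show ?case .
qed simp_all

end

section \<open>Unravelling game structures\<close>

text \<open>The function \<open>f\<close> is an alternating bisimulation, with forth and back
  conditions in terms of effectivity. The sets occurring in the fixpoint characterisations are moved
  along \<open>f\<close>.\<close>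

lemma atl_sat_bisim:
  assumes S1: "game Ags S1" and S2: "game Ags S2"
    and f: "\<And>m. m \<in> states S1 \<Longrightarrow> f m \<in> states S2"
    and val: "\<And>p m. p \<in> P \<Longrightarrow> m \<in> states S1 \<Longrightarrow> m \<in> cgs_val S1 p \<longleftrightarrow> f m \<in> cgs_val S2 p"
    and fwd: "\<And>C m X. C \<subseteq> Ags \<Longrightarrow> m \<in> states S1 \<Longrightarrow> eff Ags S1 C m X \<Longrightarrow> eff Ags S2 C (f m) (f ` X)"
    and bwd: "\<And>C m Y. C \<subseteq> Ags \<Longrightarrow> m \<in> states S1 \<Longrightarrow> eff Ags S2 C (f m) Y \<Longrightarrow>
      eff Ags S1 C m {n \<in> states S1. f n \<in> Y}"
    and \<phi>: "\<phi> \<in> atl_lang Ags P"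
  shows "m \<in> states S1 \<Longrightarrow> atl_sat Ags S1 m \<phi> \<longleftrightarrow> atl_sat Ags S2 (f m) \<phi>"
  using \<phi>
proof (induction arbitrary: m rule: atl_lang.induct)
  case (1 p)
  then show ?case using val by simp
next
  case (4 C \<phi>)
  let ?X = "{v \<in> states S1. atl_sat Ags S1 v \<phi>}" and ?Y = "{v \<in> states S2. atl_sat Ags S2 v \<phi>}"
  have "eff Ags S1 C m ?X \<longleftrightarrow> eff Ags S2 C (f m) ?Y"
  proof
    assume "eff Ags S1 C m ?X"
    from fwd[OF 4(1,4) this] show "eff Ags S2 C (f m) ?Y"
      by (rule eff_mono) (use 4(3) f in auto)
  next
    assume "eff Ags S2 C (f m) ?Y"
    from bwd[OF 4(1,4) this] show "eff Ags S1 C m ?X"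
      by (rule eff_mono) (use 4(3) in auto)
  qed
  then show ?case
    using game.atl_sat_next_eff[OF S1 4(1,4)] game.atl_sat_next_eff[OF S2 4(1) f[OF 4(4)]] by blast
next
  case (5 C \<phi>)
  show ?case
    unfolding game.atl_sat_glob_gfp[OF S1 5(1,4)] game.atl_sat_glob_gfp[OF S2 5(1) f[OF 5(4)]]
  proof
    assume "\<exists>Z\<subseteq>states S1. m \<in> Z \<and> (\<forall>v\<in>Z. atl_sat Ags S1 v \<phi> \<and> eff Ags S1 C v Z)"
    then obtain Z where Z: "Z \<subseteq> states S1" "m \<in> Z" "\<forall>v\<in>Z. atl_sat Ags S1 v \<phi> \<and> eff Ags S1 C v Z"
      by blast
    have "\<forall>v\<in>f ` Z. atl_sat Ags S2 v \<phi> \<and> eff Ags S2 C v (f ` Z)"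
      using Z fwd[OF 5(1)] 5(3) by blast
    then show "\<exists>Z\<subseteq>states S2. f m \<in> Z \<and> (\<forall>v\<in>Z. atl_sat Ags S2 v \<phi> \<and> eff Ags S2 C v Z)"
      using Z(1,2) f by (intro exI[of _ "f ` Z"]) blast
  next
    assume "\<exists>Z\<subseteq>states S2. f m \<in> Z \<and> (\<forall>v\<in>Z. atl_sat Ags S2 v \<phi> \<and> eff Ags S2 C v Z)"
    then obtain Z where Z: "f m \<in> Z" "\<forall>v\<in>Z. atl_sat Ags S2 v \<phi> \<and> eff Ags S2 C v Z" by blast
    let ?Z = "{n \<in> states S1. f n \<in> Z}"
    have "\<forall>v\<in>?Z. atl_sat Ags S1 v \<phi> \<and> eff Ags S1 C v ?Z"
      using Z bwd[OF 5(1)] 5(3) by blast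
    then show "\<exists>Z\<subseteq>states S1. m \<in> Z \<and> (\<forall>v\<in>Z. atl_sat Ags S1 v \<phi> \<and> eff Ags S1 C v Z)"
      using Z(1) 5(4) by (intro exI[of _ ?Z]) blast
  qed
next
  case (6 C \<phi> \<psi>)
  show ?case
    unfolding game.atl_sat_until_lfp[OF S1 6(1,6)] game.atl_sat_until_lfp[OF S2 6(1) f[OF 6(6)]]
  proof (intro iffI allI impI)
    fix Z
    assume L: "\<forall>Z. (\<forall>v\<in>states S1. atl_sat Ags S1 v \<psi> \<or> atl_sat Ags S1 v \<phi> \<and> eff Ags S1 C v Z \<longrightarrow> v \<in> Z)
        \<longrightarrow> m \<in> Z"
      and Z: "\<forall>v\<in>states S2. atl_sat Ags S2 v \<psi> \<or> atl_sat Ags S2 v \<phi> \<and> eff Ags S2 C v Z \<longrightarrow> v \<in> Z"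
    let ?Z = "{n \<in> states S1. f n \<in> Z}"
    have "v \<in> ?Z" if v: "v \<in> states S1" "atl_sat Ags S1 v \<psi> \<or> atl_sat Ags S1 v \<phi> \<and> eff Ags S1 C v ?Z" for v
    proof -
      have "eff Ags S1 C v ?Z \<Longrightarrow> eff Ags S2 C (f v) Z"
        using fwd[OF 6(1) v(1)] by (rule eff_mono) auto
      then have "atl_sat Ags S2 (f v) \<psi> \<or> atl_sat Ags S2 (f v) \<phi> \<and> eff Ags S2 C (f v) Z"
        using v 6(4,5) by blast
      then show ?thesis using Z f[OF v(1)] v(1) by blast
    qed
    then have "m \<in> ?Z" using L by blast
    then show "f m \<in> Z" by blast
  next
    fix Z
    assume L: "\<forall>Z. (\<forall>v\<in>states S2. atl_sat Ags S2 v \<psi> \<or> atl_sat Ags S2 v \<phi> \<and> eff Ags S2 C v Z \<longrightarrow> v \<in> Z)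
        \<longrightarrow> f m \<in> Z"
      and Z: "\<forall>v\<in>states S1. atl_sat Ags S1 v \<psi> \<or> atl_sat Ags S1 v \<phi> \<and> eff Ags S1 C v Z \<longrightarrow> v \<in> Z"
    \<comment> \<open>The universal image of \<open>Z\<close>, right adjoint to the preimage: the
      preimage of \<open>?Z\<close> is contained in \<open>Z\<close>, as the back condition
      requires.\<close>
    let ?Z = "{v \<in> states S2. \<forall>n\<in>states S1. f n = v \<longrightarrow> n \<in> Z}"
    have "v \<in> ?Z" if v: "v \<in> states S2" "atl_sat Ags S2 v \<psi> \<or> atl_sat Ags S2 v \<phi> \<and> eff Ags S2 C v ?Z" for v
    proof -
      have "n \<in> Z" if n: "n \<in> states S1" "f n = v" for n
      proof -
        have "eff Ags S2 C (f n) ?Z \<Longrightarrow> eff Ags S1 C n Z"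
          using bwd[OF 6(1) n(1)] by (rule eff_mono) auto
        then have "atl_sat Ags S1 n \<psi> \<or> atl_sat Ags S1 n \<phi> \<and> eff Ags S1 C n Z"
          using v(2) n 6(4,5) by blast
        then show ?thesis using Z n(1) by blast
      qed
      then show ?thesis using v(1) by blast
    qed
    then have "f m \<in> ?Z" using L by blast
    then show "m \<in> Z" using 6(6) by blast
  qed
qed simp_all

section \<open>Runs of a game structure and their tree\<close>

context game
begin

definition final :: "'w \<Rightarrow> ('a \<Rightarrow> 'l) list \<Rightarrow> 'w" where
  "final w ts = foldl (delta S) w ts"

text \<open>Runs record profiles, not states: distinct profiles that lead to the same state still
  give distinct next moments, so a history reveals every agent's action and cells of distinct
  actions are disjoint.\<close>

inductive_set runs :: "'w \<Rightarrow> ('a \<Rightarrow> 'l) list set" for w where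
  Nil: "[] \<in> runs w"
| snoc: "ts \<in> runs w \<Longrightarrow> t \<in> joint_acts S Ags (final w ts) \<Longrightarrow> ts @ [t] \<in> runs w"

lemma final_Nil: "final w [] = w" by (simp add: final_def)

lemma final_snoc: "final w (ts @ [t]) = delta S (final w ts) t" by (simp add: final_def)

lemma runs_snocD: "ts @ [t] \<in> runs w \<Longrightarrow> ts \<in> runs w \<and> t \<in> joint_acts S Ags (final w ts)"
  by (erule runs.cases) auto

lemma runs_append: "ts @ us \<in> runs w \<Longrightarrow> ts \<in> runs w"
proof (induction us rule: rev_induct)
  case (snoc u us)
  then show ?case using runs_snocD[of "ts @ us"] by simp
qed simp

lemma final_states: "w \<in> states S \<Longrightarrow> ts \<in> runs w \<Longrightarrow> final w ts \<in> states S"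
  by (rotate_tac, induction rule: runs.induct) (auto simp: final_Nil final_snoc delta_closed)

lemma profile_extending:
  assumes "C \<subseteq> Ags" "w \<in> states S" "\<And>\<alpha>. \<alpha> \<in> C \<Longrightarrow> s \<alpha> \<in> acts S \<alpha> w"
  shows "\<exists>t\<in>joint_acts S Ags w. \<forall>\<alpha>\<in>C. t \<alpha> = s \<alpha>"
proof
  show "(\<lambda>\<alpha>\<in>Ags. if \<alpha> \<in> C then s \<alpha> else SOME a. a \<in> acts S \<alpha> w) \<in> joint_acts S Ags w"
    using assms some_act by (auto simp: joint_acts_def)
qed (use assms in auto)

end

text \<open>With this, \<open>exe\<close> as the partial inverse of an injective labelling yields
  (EL) and (LE) together.\<close>

lemma Some_inv_into_eq_iff:
  "inj_on f A \<Longrightarrow> (if y \<in> f ` A then Some (inv_into A f y) else None) = Some x \<longleftrightarrow> x \<in> A \<and> f x = y"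
  by (auto simp: inj_on_eq_iff)

text \<open>The moments of the unravelling are an arbitrary set \<open>Mo\<close> in bijection with the runs from \<open>w0\<close>,
  since runs themselves need not live in the type of moments.\<close>

locale unravelling = game Ags S for Ags :: "'a set" and S :: "('w, 'a, 'l, 'p) cgs" +
  fixes w0 :: 'w and Mo :: "'m set" and D :: "'m \<Rightarrow> ('a \<Rightarrow> 'l) list"
    and g :: "'a \<Rightarrow> 'm \<Rightarrow> 'm set set \<Rightarrow> 't"
  assumes w0: "w0 \<in> states S" and D: "bij_betw D Mo (runs w0)"
begin

definition state_at :: "'m \<Rightarrow> 'w" where "state_at m = final w0 (D m)"

definition branches :: "'m set set" where
  "branches = {h. pred_on.maxchain Mo (\<lambda>x y. strict_prefix (D x) (D y)) h}"

definition doing :: "'a \<Rightarrow> 'm \<Rightarrow> 'l \<Rightarrow> 'm set set" where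
  "doing \<alpha> m a = {h \<in> branches. m \<in> h \<and> (\<exists>n\<in>h. \<exists>t. D n = D m @ [t] \<and> t \<alpha> = a)}"

text \<open>The labelling \<open>g\<close> is a parameter, because it must be injective on the
  cells, which are defined before it.\<close>

definition model :: "('m, 'a, 't, 'p) bdt" where
  "model = \<lparr>moments = Mo, before = (\<lambda>x y. strict_prefix (D x) (D y)),
     choice = (\<lambda>\<alpha> m. doing \<alpha> m ` acts S \<alpha> (state_at m)), types = UNIV, lbl = g,
     exe = (\<lambda>\<tau> m \<alpha>. let L = doing \<alpha> m ` acts S \<alpha> (state_at m) in
        if \<tau> \<in> g \<alpha> m ` L then Some (inv_into L (g \<alpha> m) \<tau>) else None),
     bdt_val = (\<lambda>p. {(m, h). h \<in> branches \<and> m \<in> h \<and> state_at m \<in> cgs_val S p})\<rparr>"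

lemma model_sel [simp]:
  "moments model = Mo" "before model x y = strict_prefix (D x) (D y)"
  "choice model \<alpha> m = doing \<alpha> m ` acts S \<alpha> (state_at m)"
  "types model = UNIV" "lbl model = g"
  "bdt_val model p = {(m, h). h \<in> branches \<and> m \<in> h \<and> state_at m \<in> cgs_val S p}"
  by (simp_all add: model_def)

lemma hists_model: "hists model = branches"
  by (simp add: hists_def branches_def model_def)

lemma hists_at_model: "hists_at model m = {h \<in> branches. m \<in> h}"
  by (simp add: hists_at_def hists_model)

sublocale ord: tree_order model
proof
  fix x y z :: 'm
  assume "x \<in> moments model" "y \<in> moments model"
  then have D_eq: "D x = D y \<Longrightarrow> x = y" using D by (auto simp: bij_betw_def inj_on_def)
  assume "before model x z" "before model y z"
  then show "x = y \<or> before model x y \<or> before model y x"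
    using prefix_same_cases[of "D x" "D z" "D y"] D_eq by (auto simp: strict_prefix_def)
qed auto

lemma D_runs: "m \<in> Mo \<Longrightarrow> D m \<in> runs w0"
  using D by (auto simp: bij_betw_def)

lemma D_inj: "m \<in> Mo \<Longrightarrow> n \<in> Mo \<Longrightarrow> D m = D n \<Longrightarrow> m = n"
  using D by (auto simp: bij_betw_def inj_on_def)

lemma state_at_states: "m \<in> Mo \<Longrightarrow> state_at m \<in> states S"
  unfolding state_at_def by (intro final_states w0 D_runs)

lemma ex_moment: "ts \<in> runs w0 \<Longrightarrow> \<exists>m\<in>Mo. D m = ts"
  using D by (force simp: bij_betw_def)

lemma next_moment:
  assumes "m \<in> Mo" "t \<in> joint_acts S Ags (state_at m)"
  shows "\<exists>n\<in>Mo. D n = D m @ [t] \<and> state_at n = delta S (state_at m) t"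
proof -
  have "D m @ [t] \<in> runs w0"
    using D_runs[OF assms(1)] assms(2) by (auto simp: state_at_def intro: runs.snoc)
  then obtain n where "n \<in> Mo" "D n = D m @ [t]" using ex_moment by blast
  then show ?thesis by (intro bexI[of _ n]) (simp_all add: state_at_def final_snoc)
qed

lemma next_momentD:
  assumes "n \<in> Mo" "D n = D m @ [t]"
  shows "t \<in> joint_acts S Ags (state_at m)" "state_at n = delta S (state_at m) t"
  using runs_snocD[of "D m" t w0] D_runs[OF assms(1)] assms(2)
  by (auto simp: state_at_def final_snoc)

lemma branch_moments: "h \<in> branches \<Longrightarrow> x \<in> h \<Longrightarrow> x \<in> Mo"
  using ord.hist_moments[of h] by (auto simp: hists_model)

lemma branch_prefix:
  "h \<in> branches \<Longrightarrow> x \<in> h \<Longrightarrow> y \<in> h \<Longrightarrow> prefix (D x) (D y) \<or> strict_prefix (D y) (D x)"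
  using ord.hist_comparable[of h x y] by (auto simp: hists_model strict_prefix_def)

lemma branch_downward:
  assumes "h \<in> branches" "x \<in> h" "y \<in> Mo" "prefix (D y) (D x)"
  shows "y \<in> h"
proof (cases "D y = D x")
  case True
  then show ?thesis using D_inj branch_moments assms by metis
next
  case False
  then show ?thesis
    using ord.hist_downward[of h x y] assms by (simp add: hists_model strict_prefix_def)
qed

lemma branch_through: "m \<in> Mo \<Longrightarrow> \<exists>h\<in>branches. m \<in> h"
  using ord.hists_at_nonempty[of m] by (auto simp: hists_at_model)

text \<open>Were \<open>m\<close> last on \<open>h\<close>, a next moment could be added, against
  maximality. The run of a later moment on \<open>h\<close> passes through one exactly one profile
  longer than that of \<open>m\<close>, which is on \<open>h\<close> by downward closure.\<close>

lemma branch_continues: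
  assumes h: "h \<in> branches" "m \<in> h"
  shows "\<exists>n\<in>h. \<exists>t. D n = D m @ [t]"
proof -
  have m: "m \<in> Mo" using branch_moments h by blast
  have "\<exists>y\<in>h. strict_prefix (D m) (D y)"
  proof (rule ccontr)
    assume no: "\<not> (\<exists>y\<in>h. strict_prefix (D m) (D y))"
    obtain t where "t \<in> joint_acts S Ags (state_at m)"
      using profile_extending[of "{}"] state_at_states[OF m] by auto
    then obtain n where n: "n \<in> Mo" "D n = D m @ [t]" using next_moment[OF m] by blast
    have "n \<in> h"
    proof (rule ord.hist_maximal)
      fix y assume "y \<in> h"
      then have "prefix (D y) (D m)"
        using branch_prefix[OF h(1), of y m] no h(2) by blast
      then have "prefix (D y) (D n)" "D y \<noteq> D n"
        using n(2) by (auto dest: prefix_length_le)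
      then show "before model n y \<or> n = y \<or> before model y n"
        by (simp add: strict_prefix_def)
    qed (use h n in \<open>auto simp: hists_model\<close>)
    then show False using no n(2) by (auto simp: strict_prefix_def)
  qed
  then obtain y where y: "y \<in> h" "strict_prefix (D m) (D y)" by blast
  then obtain t us where t: "D y = D m @ [t] @ us"
    by (metis append_Cons append_Nil strict_prefixE')
  then have "D m @ [t] \<in> runs w0"
    using runs_append[of "D m @ [t]" us] D_runs[OF branch_moments[OF h(1) y(1)]] by simp
  then obtain n where n: "n \<in> Mo" "D n = D m @ [t]" using ex_moment by blast
  have "n \<in> h" using branch_downward[OF h(1) y(1) n(1)] n(2) t by simp
  then show ?thesis using n(2) by blast
qed

lemma branch_next_unique:
  assumes "h \<in> branches" "n \<in> h" "n' \<in> h" "D n = D m @ [t]" "D n' = D m @ [t']"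
  shows "n = n' \<and> t = t'"
  using branch_prefix[OF assms(1,2,3)] D_inj branch_moments assms
  by (auto simp: strict_prefix_def)

lemma is_succ_model:
  assumes h: "h \<in> branches" "m \<in> h" and n: "n \<in> h" "D n = D m @ [t]"
  shows "is_succ model m h n' \<longleftrightarrow> n' = n"
proof -
  have least: "before_eq model n y" if y: "y \<in> h" "strict_prefix (D m) (D y)" for y
  proof -
    consider "D n = D y" | "strict_prefix (D n) (D y)" | "strict_prefix (D y) (D n)"
      using branch_prefix[OF h(1) n(1) y(1)] by (auto simp: strict_prefix_def)
    then show ?thesis
    proof cases
      case 1
      then show ?thesis using D_inj branch_moments[OF h(1)] n y by (auto simp: before_eq_def)
    next
      case 3
      then have "prefix (D y) (D m)" using n(2) by (auto simp: strict_prefix_def)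
      then show ?thesis using y(2) by (auto simp: strict_prefix_def)
    qed (simp add: before_eq_def)
  qed
  have "is_succ model m h n"
    using least n by (auto simp: is_succ_def strict_prefix_def)
  moreover have "n' = n" if "is_succ model m h n'"
    using that least[of n'] n by (auto simp: is_succ_def before_eq_def strict_prefix_def)
  ultimately show ?thesis by blast
qed

lemma succ_model:
  assumes h: "h \<in> branches" "m \<in> h" and n: "n \<in> h" "D n = D m @ [t]"
  shows "succ model m h = n"
  using is_succ_model[OF assms] by (simp add: succ_def)

text \<open>A branch through \<open>m\<close> performs exactly one profile there, and questions
  about cells reduce to it.\<close>

lemma doing_cases:
  assumes "h \<in> branches" "m \<in> h"
  obtains n t where "n \<in> h" "D n = D m @ [t]" "t \<in> joint_acts S Ags (state_at m)"
    "state_at n = delta S (state_at m) t" "succ model m h = n"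
    "\<And>\<alpha> a. h \<in> doing \<alpha> m a \<longleftrightarrow> t \<alpha> = a"
proof -
  obtain n t where n: "n \<in> h" "D n = D m @ [t]" using branch_continues[OF assms] by blast
  have "h \<in> doing \<alpha> m a \<longleftrightarrow> t \<alpha> = a" for \<alpha> a
    using branch_next_unique[OF assms(1) n(1) _ n(2)] n assms unfolding doing_def by blast
  then show ?thesis
    using that[OF n] next_momentD[OF branch_moments[OF assms(1) n(1)] n(2)] succ_model[OF assms n]
    by blast
qed

lemma branch_doing:
  assumes "m \<in> Mo" "t \<in> joint_acts S Ags (state_at m)"
  obtains h n where "h \<in> branches" "m \<in> h" "n \<in> h" "state_at n = delta S (state_at m) t"
    "succ model m h = n" "\<And>\<alpha>. h \<in> doing \<alpha> m (t \<alpha>)"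
proof -
  obtain n where n: "n \<in> Mo" "D n = D m @ [t]" "state_at n = delta S (state_at m) t"
    using next_moment[OF assms] by blast
  obtain h where h: "h \<in> branches" "n \<in> h" using branch_through[OF n(1)] by blast
  have "m \<in> h" using branch_downward[OF h assms(1)] n(2) by simp
  then show ?thesis
    using that[of h n] h n succ_model[OF h(1) _ h(2) n(2)] unfolding doing_def by blast
qed

section \<open>Tree, choice and labelling conditions for the unravelling\<close>

lemma discrete_tree_model: "discrete_tree model"
  unfolding discrete_tree_def
proof (intro conjI ballI impI)
  show "moments model \<noteq> {}" using ex_moment[OF runs.Nil] by auto
  show "irreflp_on (moments model) (before model)" by (simp add: irreflp_on_def)
  show "transp_on (moments model) (before model)" by (auto simp: transp_on_def)
next
  fix m m' m'' assume "m \<in> moments model" "m' \<in> moments model" "m'' \<in> moments model"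
    and "before model m' m \<and> before model m'' m"
  then show "m' = m'' \<or> before model m' m'' \<or> before model m'' m'"
    using ord.before_linear by blast
next
  fix m h assume "m \<in> moments model" "h \<in> hists_at model m"
  then have h: "h \<in> branches" "m \<in> h" by (simp_all add: hists_at_model)
  then obtain n t where "n \<in> h" "D n = D m @ [t]" using branch_continues by blast
  then show "\<exists>!m'. is_succ model m h m'" using is_succ_model[OF h, of n t] by auto
qed

lemma partition_model:
  assumes "\<alpha> \<in> Ags" "m \<in> Mo"
  shows "partition_on (hists_at model m) (choice model \<alpha> m)"
proof (rule partition_onI)
  show "\<Union>(choice model \<alpha> m) = hists_at model m"
  proof (intro equalityI subsetI)
    fix h assume "h \<in> hists_at model m"
    then have "h \<in> branches" "m \<in> h" by (simp_all add: hists_at_model)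
    then obtain n t where "t \<in> joint_acts S Ags (state_at m)" "h \<in> doing \<alpha> m (t \<alpha>)"
      using doing_cases by metis
    then show "h \<in> \<Union>(choice model \<alpha> m)" using assms(1) by (auto simp: joint_acts_def)
  qed (auto simp: doing_def hists_at_model)
next
  fix L L' assume "L \<in> choice model \<alpha> m" "L' \<in> choice model \<alpha> m" "L \<noteq> L'"
  then obtain a a' where L: "L = doing \<alpha> m a" "L' = doing \<alpha> m a'" "a \<noteq> a'" by auto
  have False if h: "h \<in> L" "h \<in> L'" for h
  proof -
    have "h \<in> branches" "m \<in> h" using h L by (auto simp: doing_def)
    then show False using doing_cases[of h m] h L by metis
  qed
  then show "disjnt L L'" by (auto simp: disjnt_def)
next
  have "L \<noteq> {}" if L: "L \<in> choice model \<alpha> m" for L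
  proof -
    obtain a where a: "a \<in> acts S \<alpha> (state_at m)" "L = doing \<alpha> m a" using L by auto
    obtain t where t: "t \<in> joint_acts S Ags (state_at m)" "t \<alpha> = a"
      using profile_extending[of "{\<alpha>}" "state_at m" "\<lambda>_. a"] assms a state_at_states by auto
    then obtain h where "h \<in> doing \<alpha> m a" using branch_doing[OF assms(2) t(1)] by metis
    then show ?thesis using a by blast
  qed
  then show "{} \<notin> choice model \<alpha> m" by blast
qed

lemma cell_model:
  assumes "\<alpha> \<in> Ags" "m \<in> Mo" "a \<in> acts S \<alpha> (state_at m)" "h \<in> doing \<alpha> m a"
  shows "cell model \<alpha> m h = doing \<alpha> m a"
  unfolding cell_def
  using partition_onD2[OF partition_model[OF assms(1,2)]] assms(3,4)
  by (intro the_equality) (auto simp: disjoint_def)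

lemma cell_model':
  assumes "\<alpha> \<in> Ags" "h \<in> branches" "m \<in> h" "n \<in> h" "D n = D m @ [t]"
  shows "t \<alpha> \<in> acts S \<alpha> (state_at m)" "cell model \<alpha> m h = doing \<alpha> m (t \<alpha>)"
proof -
  show "t \<alpha> \<in> acts S \<alpha> (state_at m)"
    using next_momentD(1)[OF branch_moments[OF assms(2,4)] assms(5)] assms(1)
    by (auto simp: joint_acts_def)
  then show "cell model \<alpha> m h = doing \<alpha> m (t \<alpha>)"
    by (rule cell_model[OF assms(1) branch_moments[OF assms(2,3)]])
      (use assms in \<open>auto simp: doing_def\<close>)
qed

text \<open>(NC): branches with a common later moment share the next moment as well, hence the
  profile. (IA): independently picked available actions always form a profile, and some branch
  performs it.\<close>

lemma choice_conditions_model: "choice_conditions Ags model"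
  unfolding choice_conditions_def
proof (intro conjI ballI allI impI)
  show "partition_on (hists_at model m) (choice model \<alpha> m)"
    if "\<alpha> \<in> Ags" "m \<in> moments model" for \<alpha> m
    using partition_model that by simp
next
  fix m h h' \<alpha>
  assume a: "m \<in> moments model" "h \<in> hists_at model m" "h' \<in> hists_at model m" "\<alpha> \<in> Ags"
    and "\<exists>m'\<in>h \<inter> h'. before model m m'"
  then obtain y where y: "y \<in> h" "y \<in> h'" "strict_prefix (D m) (D y)" by auto
  have h: "h \<in> branches" "m \<in> h" "h' \<in> branches" "m \<in> h'" using a by (simp_all add: hists_at_model)
  obtain n t where n: "n \<in> h" "D n = D m @ [t]" using branch_continues[OF h(1,2)] by blast
  have "prefix (D n) (D y)"
    using branch_prefix[OF h(1) n(1) y(1)] y(3) n(2) by (auto simp: strict_prefix_def)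
  then have "n \<in> h'" using branch_downward[OF h(3) y(2) branch_moments[OF h(1) n(1)]] by blast
  then show "cell model \<alpha> m h = cell model \<alpha> m h'"
    using cell_model'(2)[OF a(4) h(1,2) n] cell_model'(2)[OF a(4) h(3,4) _ n(2)] by simp
next
  fix m s assume m: "m \<in> moments model" and s: "\<forall>\<alpha>\<in>Ags. s \<alpha> \<in> choice model \<alpha> m"
  have "\<exists>a. a \<in> acts S \<alpha> (state_at m) \<and> s \<alpha> = doing \<alpha> m a" if "\<alpha> \<in> Ags" for \<alpha>
    using s that by auto
  then obtain a where a: "\<And>\<alpha>. \<alpha> \<in> Ags \<Longrightarrow> a \<alpha> \<in> acts S \<alpha> (state_at m) \<and> s \<alpha> = doing \<alpha> m (a \<alpha>)"
    by metis
  obtain t where t: "t \<in> joint_acts S Ags (state_at m)" "\<forall>\<alpha>\<in>Ags. t \<alpha> = a \<alpha>"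
    using profile_extending[of Ags "state_at m" a] a state_at_states m by auto
  obtain h where h: "h \<in> branches" "m \<in> h" "\<And>\<alpha>. h \<in> doing \<alpha> m (t \<alpha>)"
    using branch_doing[OF _ t(1)] m by (metis model_sel(1))
  have "h \<in> s \<alpha>" if "\<alpha> \<in> Ags" for \<alpha> using h(3)[of \<alpha>] a[OF that] t(2) that by simp
  then have "h \<in> hists_at model m \<inter> (\<Inter>\<alpha>\<in>Ags. s \<alpha>)" using h by (simp add: hists_at_model)
  then show "hists_at model m \<inter> (\<Inter>\<alpha>\<in>Ags. s \<alpha>) \<noteq> {}"
    by blast
qed

lemma deterministic_model: "deterministic Ags model"
  unfolding deterministic_def
proof (intro ballI)
  fix m h h' assume m: "m \<in> moments model" and "h \<in> hists_at model m" "h' \<in> coll_cell model Ags m h"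
  then have h: "h \<in> branches" "m \<in> h" "h' \<in> branches" "m \<in> h'"
    and c: "\<And>\<alpha>. \<alpha> \<in> Ags \<Longrightarrow> h' \<in> cell model \<alpha> m h"
    by (simp_all add: hists_at_model coll_cell_def)
  obtain n t where n: "n \<in> h" "D n = D m @ [t]" using branch_continues[OF h(1,2)] by blast
  obtain n' t' where n': "n' \<in> h'" "D n' = D m @ [t']" "\<And>\<alpha> a. h' \<in> doing \<alpha> m a \<longleftrightarrow> t' \<alpha> = a"
    using doing_cases[OF h(3,4)] by metis
  have "t \<alpha> = t' \<alpha>" if "\<alpha> \<in> Ags" for \<alpha>
  proof -
    have "h' \<in> doing \<alpha> m (t \<alpha>)" using c[OF that] cell_model'(2)[OF that h(1,2) n] by simp
    then show ?thesis using n'(3) by simp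
  qed
  moreover have "t \<in> joint_acts S Ags (state_at m)" "t' \<in> joint_acts S Ags (state_at m)"
    using next_momentD(1)[OF branch_moments[OF h(1) n(1)] n(2)]
      next_momentD(1)[OF branch_moments[OF h(3) n'(1)] n'(2)] by simp_all
  \<comment> \<open>Profiles are extensional, so agreement on \<open>Ags\<close> is
    equality.\<close>
  ultimately have "t = t'" unfolding joint_acts_def by (intro PiE_ext)
  then have "n = n'" using D_inj branch_moments h n n' by metis
  then show "succ model m h = succ model m h'"
    using succ_model h n n' by simp
qed

sublocale det: det_bdt Ags model
  by unfold_locales (rule discrete_tree_model choice_conditions_model deterministic_model)+

lemma label_conditions_model:
  assumes inj: "\<And>\<alpha> m. \<alpha> \<in> Ags \<Longrightarrow> m \<in> Mo \<Longrightarrow> inj_on (g \<alpha> m) (doing \<alpha> m ` acts S \<alpha> (state_at m))"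
  shows "label_conditions Ags model"
proof -
  have exe: "exe model \<tau> m \<alpha> = Some L \<longleftrightarrow> L \<in> choice model \<alpha> m \<and> g \<alpha> m L = \<tau>"
    if "\<alpha> \<in> Ags" "m \<in> Mo" for \<tau> m \<alpha> L
    using Some_inv_into_eq_iff[OF inj[OF that]] by (simp add: model_def Let_def)
  have "cell model \<alpha> m h \<in> choice model \<alpha> m" "m \<in> Mo"
    if "\<alpha> \<in> Ags" "(m, h) \<in> indices model" for \<alpha> m h
  proof -
    have "h \<in> hists_at model m" using that(2) by (simp add: indices_def hists_at_def)
    then show "cell model \<alpha> m h \<in> choice model \<alpha> m" "m \<in> Mo"
      using det.cell_choice(1)[OF that(1)] det.hists_at_moments by auto
  qed
  then show ?thesis
    unfolding label_conditions_def using exe by (auto simp del: model_sel(3))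
qed

lemma is_bdt_model:
  assumes "\<And>\<alpha> m. \<alpha> \<in> Ags \<Longrightarrow> m \<in> Mo \<Longrightarrow> inj_on (g \<alpha> m) (doing \<alpha> m ` acts S \<alpha> (state_at m))"
  shows "is_bdt Ags P model"
  using discrete_tree_model choice_conditions_model label_conditions_model[OF assms]
  by (auto simp: is_bdt_def indices_def hists_model)

text \<open>Replaces cells by the actions of \<open>S\<close> that they stand for, so that the two
  structures can be compared.\<close>

lemma eff_model:
  assumes C: "C \<subseteq> Ags" and m: "m \<in> Mo"
  shows "eff Ags (det.to_cgs) C m X \<longleftrightarrow>
    (\<exists>s\<in>joint_acts S C (state_at m). \<forall>h\<in>branches. m \<in> h \<longrightarrow> (\<forall>\<alpha>\<in>C. h \<in> doing \<alpha> m (s \<alpha>)) \<longrightarrow>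
       succ model m h \<in> X)" (is "_ \<longleftrightarrow> ?R")
proof
  assume "eff Ags (det.to_cgs) C m X"
  then obtain b where b: "\<And>\<alpha>. \<alpha> \<in> C \<Longrightarrow> b \<alpha> \<in> choice model \<alpha> m"
    "delta_set Ags (det.to_cgs) C m b \<subseteq> X"
    by (auto simp: eff_def joint_acts_def PiE_iff)
  have "\<exists>a. a \<in> acts S \<alpha> (state_at m) \<and> b \<alpha> = doing \<alpha> m a" if "\<alpha> \<in> C" for \<alpha>
    using b(1)[OF that] by auto
  then obtain a where a: "\<And>\<alpha>. \<alpha> \<in> C \<Longrightarrow> a \<alpha> \<in> acts S \<alpha> (state_at m) \<and> b \<alpha> = doing \<alpha> m (a \<alpha>)"
    by metis
  have "restrict a C \<in> joint_acts S C (state_at m)" using a by (auto simp: joint_acts_def)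
  moreover have "succ model m h \<in> X"
    if "h \<in> branches" "m \<in> h" "\<forall>\<alpha>\<in>C. h \<in> doing \<alpha> m (restrict a C \<alpha>)" for h
  proof -
    have "h \<in> hists_at model m \<and> (\<forall>\<alpha>\<in>C. h \<in> b \<alpha>)" using that a by (simp add: hists_at_model)
    then show ?thesis using b(2) m by (subst (asm) det.delta_set_to_cgs[OF C _ b(1)]) auto
  qed
  ultimately show ?R by blast
next
  assume ?R
  then obtain s where s: "s \<in> joint_acts S C (state_at m)"
    "\<And>h. h \<in> branches \<Longrightarrow> m \<in> h \<Longrightarrow> \<forall>\<alpha>\<in>C. h \<in> doing \<alpha> m (s \<alpha>) \<Longrightarrow> succ model m h \<in> X" by blast
  define b where "b = (\<lambda>\<alpha>\<in>C. doing \<alpha> m (s \<alpha>))"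
  have b: "b \<alpha> \<in> choice model \<alpha> m" if "\<alpha> \<in> C" for \<alpha>
    using s(1) that by (auto simp: b_def joint_acts_def)
  have "delta_set Ags (det.to_cgs) C m b \<subseteq> X"
    using s(2) m by (subst det.delta_set_to_cgs[OF C _ b]) (auto simp: hists_at_model b_def)
  moreover have "b \<in> joint_acts (det.to_cgs) C m"
    using b by (auto simp: joint_acts_def b_def)
  ultimately show "eff Ags (det.to_cgs) C m X" by (auto simp: eff_def)
qed

text \<open>Together with \<open>model_back\<close> this makes \<open>state_at\<close> an
  alternating bisimulation from the game structure of the unravelling to \<open>S\<close>.\<close>

lemma model_forth:
  assumes C: "C \<subseteq> Ags" and m: "m \<in> Mo" and "eff Ags (det.to_cgs) C m X"
  shows "eff Ags S C (state_at m) (state_at ` X)"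
proof -
  obtain s where s: "s \<in> joint_acts S C (state_at m)"
    "\<And>h. h \<in> branches \<Longrightarrow> m \<in> h \<Longrightarrow> \<forall>\<alpha>\<in>C. h \<in> doing \<alpha> m (s \<alpha>) \<Longrightarrow> succ model m h \<in> X"
    using assms(3) unfolding eff_model[OF C m] by blast
  have "delta S (state_at m) t \<in> state_at ` X"
    if t: "t \<in> joint_acts S Ags (state_at m)" "\<forall>\<alpha>\<in>C. t \<alpha> = s \<alpha>" for t
  proof -
    obtain h n where h: "h \<in> branches" "m \<in> h" "state_at n = delta S (state_at m) t"
      "succ model m h = n" "\<And>\<alpha>. h \<in> doing \<alpha> m (t \<alpha>)"
      using branch_doing[OF m t(1)] by metis
    have "\<forall>\<alpha>\<in>C. h \<in> doing \<alpha> m (s \<alpha>)" using h(5) t(2) by metis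
    then have "n \<in> X" using s(2)[OF h(1,2)] h(4) by simp
    then show ?thesis using h(3) by (metis imageI)
  qed
  then show ?thesis using s(1) by (auto simp: eff_def delta_set_def)
qed

lemma model_back:
  assumes C: "C \<subseteq> Ags" and m: "m \<in> Mo" and "eff Ags S C (state_at m) Y"
  shows "eff Ags (det.to_cgs) C m {n \<in> Mo. state_at n \<in> Y}"
proof -
  obtain s where s: "s \<in> joint_acts S C (state_at m)" "delta_set Ags S C (state_at m) s \<subseteq> Y"
    using assms(3) by (auto simp: eff_def)
  have "succ model m h \<in> {n \<in> Mo. state_at n \<in> Y}"
    if h: "h \<in> branches" "m \<in> h" "\<forall>\<alpha>\<in>C. h \<in> doing \<alpha> m (s \<alpha>)" for h
  proof -
    obtain n t where n: "n \<in> h" "t \<in> joint_acts S Ags (state_at m)"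
      "state_at n = delta S (state_at m) t" "succ model m h = n"
      "\<And>\<alpha> a. h \<in> doing \<alpha> m a \<longleftrightarrow> t \<alpha> = a"
      by (rule doing_cases[OF h(1,2)]) blast
    then have "state_at n \<in> delta_set Ags S C (state_at m) s"
      using h(3) by (auto simp: delta_set_def)
    then show ?thesis using n(4) s(2) branch_moments[OF h(1) n(1)] by auto
  qed
  then show ?thesis unfolding eff_model[OF C m] using s(1) by blast
qed

lemma stit_sat_model:
  assumes "\<phi> \<in> atl_lang Ags P" "m \<in> Mo" "h \<in> hists_at model m"
  shows "stit_sat model m h (Tr \<phi>) \<longleftrightarrow> atl_sat Ags S (state_at m) \<phi>"
proof -
  have "atl_sat Ags (det.to_cgs) m \<phi> \<longleftrightarrow> atl_sat Ags S (state_at m) \<phi>"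
  proof (rule atl_sat_bisim[OF det.cgs.game_axioms game_axioms _ _ _ _ assms(1)])
    fix p n assume "n \<in> states (det.to_cgs)"
    then have n: "n \<in> Mo" by simp
    then obtain h where "h \<in> branches" "n \<in> h" using branch_through by blast
    then show "n \<in> cgs_val (det.to_cgs) p \<longleftrightarrow> state_at n \<in> cgs_val S p"
      using n by (auto simp: hists_at_model)
  qed (use assms(2) state_at_states model_forth model_back in auto)
  then show ?thesis using det.stit_sat_Tr[OF assms(1,3)] by simp
qed

end

section \<open>Placing the unravelling in given infinite types\<close>

lemma finite_inj_into_infinite:
  assumes "finite A" "infinite (UNIV :: 'b set)"
  shows "\<exists>f :: 'a \<Rightarrow> 'b. inj_on f A"
proof -
  obtain B :: "'b set" where "finite B" "card B = card A"
    using infinite_arbitrarily_large[OF assms(2)] by blast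
  then show ?thesis using finite_same_card_bij[OF assms(1), of B] by (auto simp: bij_betw_def)
qed

lemma countable_inj_into_infinite:
  assumes "countable A" "infinite (UNIV :: 'b set)"
  shows "\<exists>f :: 'a \<Rightarrow> 'b. inj_on f A"
proof -
  obtain e :: "nat \<Rightarrow> 'b" where "inj e" using infinite_countable_subset[OF assms(2)] by blast
  then have "inj_on (e \<circ> to_nat_on A) A"
    using inj_on_to_nat_on[OF assms(1)] by (intro comp_inj_on) (auto intro: inj_on_subset)
  then show ?thesis by blast
qed

text \<open>A finite structure has countably many runs, which fit into any infinite type of moments,
  and finitely many cells for each agent and moment, which fit into any infinite type of
  labels.\<close>

theorem bdt_of_finite_cgs:
  fixes S :: "('w, 'a, 'l, 'p) cgs"
  assumes "finite Ags" "is_cgs Ags P S" "w \<in> states S"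
    and "infinite (UNIV :: 'm set)" "infinite (UNIV :: 't set)"
  obtains M :: "('m, 'a, 't, 'p) bdt" and m h
  where "is_bdt Ags P M" "deterministic Ags M" "(m, h) \<in> indices M"
    "\<And>\<phi>. \<phi> \<in> atl_lang Ags P \<Longrightarrow> stit_sat M m h (Tr \<phi>) \<longleftrightarrow> atl_sat Ags S w \<phi>"
proof -
  interpret game Ags S using assms(2) by (rule is_cgs_game)
  have fin: "finite (acts S \<alpha> v)" if "\<alpha> \<in> Ags" "v \<in> states S" for \<alpha> v
    using assms(2) that by (auto simp: is_cgs_def)
  have "finite (\<Union>v\<in>states S. joint_acts S Ags v)"
    using assms(1,2) fin by (auto simp: is_cgs_def joint_acts_def intro!: finite_PiE)
  then have "countable (lists (\<Union>v\<in>states S. joint_acts S Ags v))"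
    by (intro countable_lists countable_finite)
  moreover have "runs w \<subseteq> lists (\<Union>v\<in>states S. joint_acts S Ags v)"
  proof
    fix ts assume "ts \<in> runs w"
    then show "ts \<in> lists (\<Union>v\<in>states S. joint_acts S Ags v)"
      by induction (use final_states[OF assms(3)] in auto)
  qed
  ultimately have "countable (runs w)" by (rule countable_subset[rotated])
  then obtain e :: "_ \<Rightarrow> 'm" where e: "inj_on e (runs w)"
    using countable_inj_into_infinite assms(4) by blast
  define D where "D = inv_into (runs w) e"
  \<comment> \<open>Interpreted with a dummy labelling in order to speak about the cells before the
    injective \<open>g\<close> is chosen.\<close>
  interpret u: unravelling Ags S w "e ` runs w" D undefined
    using e assms(3) by unfold_locales (simp_all add: D_def inj_on_imp_bij_betw bij_betw_inv_into)
  have "\<exists>f :: 'm set set \<Rightarrow> 't. inj_on f (u.doing \<alpha> m ` acts S \<alpha> (u.state_at m))"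
    if "\<alpha> \<in> Ags" "m \<in> e ` runs w" for \<alpha> m
    by (rule finite_inj_into_infinite) (use fin that u.state_at_states assms(5) in auto)
  then obtain g :: "'a \<Rightarrow> 'm \<Rightarrow> 'm set set \<Rightarrow> 't"
    where g: "\<And>\<alpha> m. \<alpha> \<in> Ags \<Longrightarrow> m \<in> e ` runs w \<Longrightarrow> inj_on (g \<alpha> m) (u.doing \<alpha> m ` acts S \<alpha> (u.state_at m))"
    by metis
  interpret unravelling Ags S w "e ` runs w" D g
    by (rule u.unravelling_axioms)
  obtain m where m: "m \<in> e ` runs w" "D m = []" using ex_moment[OF runs.Nil] by blast
  obtain h where h: "h \<in> branches" "m \<in> h" using branch_through[OF m(1)] by blast
  show ?thesis
  proof (rule that[of model m h])
    show "is_bdt Ags P model" by (rule is_bdt_model[OF g])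
    show "deterministic Ags model" by (rule deterministic_model)
    show "(m, h) \<in> indices model" using h by (simp add: indices_def hists_model)
    show "stit_sat model m h (Tr \<phi>) \<longleftrightarrow> atl_sat Ags S w \<phi>" if "\<phi> \<in> atl_lang Ags P" for \<phi>
      using stit_sat_model[OF that m(1), of h] h m(2)
      by (simp add: hists_at_model state_at_def final_Nil)
  qed
qed

section \<open>The finite model property\<close>

text \<open>In the finite game form an agent announces a coalition, a target and a number.  A coalition whose
  members announce the same coalition and target plays a fixed witness of its power to force the
  target; the sum of the numbers then selects one of the results still possible.  An agent outside
  a coalition can block every larger one by announcing the empty coalition, and can steer the sum, so
  no power is gained.\<close>

lemma finite_game_form:
  fixes Act :: "'a \<Rightarrow> 'k set" and res :: "('a \<Rightarrow> 'k) \<Rightarrow> 'o" and L :: "'l set"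
    and dec :: "'l \<Rightarrow> 'a set \<times> 'o set \<times> int"
  assumes Ags: "finite Ags" and Out: "finite Out"
    and Act: "\<And>\<alpha>. \<alpha> \<in> Ags \<Longrightarrow> Act \<alpha> \<noteq> {}" and res: "\<And>t. t \<in> PiE Ags Act \<Longrightarrow> res t \<in> Out"
    and dec: "dec ` L = Pow Ags \<times> Pow Out \<times> {0..<int (card Out)}"
  shows "\<exists>res'. (\<forall>t. res' t \<in> Out) \<and> (\<forall>C X. C \<subseteq> Ags \<longrightarrow>
    (\<exists>s\<in>PiE C Act. \<forall>t\<in>PiE Ags Act. (\<forall>\<alpha>\<in>C. t \<alpha> = s \<alpha>) \<longrightarrow> res t \<in> X) \<longleftrightarrow>
    (\<exists>s\<in>C \<rightarrow>\<^sub>E L. \<forall>t\<in>Ags \<rightarrow>\<^sub>E L. (\<forall>\<alpha>\<in>C. t \<alpha> = s \<alpha>) \<longrightarrow> res' t \<in> X))"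
proof -
  define forces where "forces C X s \<longleftrightarrow>
    s \<in> PiE C Act \<and> (\<forall>t\<in>PiE Ags Act. (\<forall>\<alpha>\<in>C. t \<alpha> = s \<alpha>) \<longrightarrow> res t \<in> X)" for C X s
  define wit where "wit C X = (SOME s. forces C X s)" for C X
  have wit: "forces C X (wit C X)" if "forces C X s" for C X s
    unfolding wit_def by (rule someI[of _ s]) (rule that)
  define co where "co (t :: 'a \<Rightarrow> 'l) \<alpha> = fst (dec (t \<alpha>))" for t \<alpha>
  define tg where "tg (t :: 'a \<Rightarrow> 'l) \<alpha> = fst (snd (dec (t \<alpha>)))" for t \<alpha>
  define nm where "nm (t :: 'a \<Rightarrow> 'l) \<alpha> = snd (snd (dec (t \<alpha>)))" for t \<alpha>
  \<comment> \<open>The formed coalitions are pairwise equal or disjoint, so each of their members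
    has a single target to act for. The empty coalition is never formed, as it has no
    member.\<close>
  define formed where "formed t \<alpha> \<longleftrightarrow> \<alpha> \<in> co t \<alpha> \<and> co t \<alpha> \<subseteq> Ags \<and> (\<exists>s. forces (co t \<alpha>) (tg t \<alpha>) s) \<and>
    (\<forall>\<beta>\<in>co t \<alpha>. co t \<beta> = co t \<alpha> \<and> tg t \<beta> = tg t \<alpha>)" for t \<alpha>
  define act where "act t \<alpha> = wit (co t \<alpha>) (tg t \<alpha>) \<alpha>" for t \<alpha>
  \<comment> \<open>The results of the original game that remain when agents in formed coalitions
    play their witnesses and all others are free.\<close>
  define Y where "Y t = res ` {u \<in> PiE Ags Act. \<forall>\<alpha>. formed t \<alpha> \<longrightarrow> u \<alpha> = act t \<alpha>}" for t
  \<comment> \<open>An integer, so that the residue equation for the sum can later be solved by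
    subtraction.\<close>
  define n where "n = int (card Out)"
  obtain e0 where e0: "bij_betw e0 {0..<card Out} Out" using ex_bij_betw_nat_finite[OF Out] by blast
  define e where "e k = e0 (nat k)" for k
  have e: "\<exists>k\<in>{0..<n}. e k = y" if y: "y \<in> Out" for y
  proof -
    have "y \<in> e0 ` {0..<card Out}" using e0 y by (simp add: bij_betw_def)
    then obtain k where "k < card Out" "e0 k = y" by auto
    then show ?thesis by (intro bexI[of _ "int k"]) (auto simp: e_def n_def)
  qed
  \<comment> \<open>The sum only proposes a result; if that one is no longer possible, some possible
    one is taken, so \<open>res' t\<close> never leaves \<open>Y t\<close>.\<close>
  define res' where "res' t = (let y = e ((\<Sum>\<alpha>\<in>Ags. nm t \<alpha>) mod n) in if y \<in> Y t then y else SOME y. y \<in> Y t)" for t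
  have act: "\<alpha> \<in> Ags" "act t \<alpha> \<in> Act \<alpha>" if f: "formed t \<alpha>" for t \<alpha>
  proof -
    have "\<alpha> \<in> co t \<alpha>" "co t \<alpha> \<subseteq> Ags" using f unfolding formed_def by blast+
    then show "\<alpha> \<in> Ags" by blast
    obtain s where "forces (co t \<alpha>) (tg t \<alpha>) s" using f unfolding formed_def by blast
    from wit[OF this] have "wit (co t \<alpha>) (tg t \<alpha>) \<in> PiE (co t \<alpha>) Act" by (simp add: forces_def)
    then show "act t \<alpha> \<in> Act \<alpha>" using \<open>\<alpha> \<in> co t \<alpha>\<close> by (auto simp: act_def)
  qed
  have some: "(SOME a. a \<in> Act \<alpha>) \<in> Act \<alpha>" if "\<alpha> \<in> Ags" for \<alpha> using Act[OF that] by (simp add: some_in_eq)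
  have Y_ne: "Y t \<noteq> {}" for t
  proof -
    have "(\<lambda>\<alpha>\<in>Ags. if formed t \<alpha> then act t \<alpha> else SOME a. a \<in> Act \<alpha>) \<in> PiE Ags Act"
      using act some by auto
    moreover have "\<forall>\<alpha>. formed t \<alpha> \<longrightarrow> (\<lambda>\<alpha>\<in>Ags. if formed t \<alpha> then act t \<alpha> else SOME a. a \<in> Act \<alpha>) \<alpha> = act t \<alpha>"
      using act(1) by simp
    ultimately show ?thesis unfolding Y_def by blast
  qed
  have Y_Out: "Y t \<subseteq> Out" for t using res by (auto simp: Y_def)
  have res'_Y: "res' t \<in> Y t" for t
    using Y_ne[of t] by (simp add: res'_def Let_def some_in_eq)
  have dec_ex: "\<exists>l\<in>L. dec l = (C, X, k)" if "C \<subseteq> Ags" "X \<subseteq> Out" "k \<in> {0..<n}" for C X k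
  proof -
    have "(C, X, k) \<in> dec ` L" using that by (simp add: dec n_def)
    then show ?thesis by force
  qed
  have "Out \<noteq> {}" using Y_ne Y_Out by blast
  then have n: "0 < n" using Out by (simp add: n_def card_gt_0_iff)
  have main: "(\<exists>s. forces C X s) \<longleftrightarrow> (\<exists>s\<in>C \<rightarrow>\<^sub>E L. \<forall>t\<in>Ags \<rightarrow>\<^sub>E L. (\<forall>\<alpha>\<in>C. t \<alpha> = s \<alpha>) \<longrightarrow> res' t \<in> X)"
    if C: "C \<subseteq> Ags" for C X
  proof
    assume "\<exists>s. forces C X s"
    then obtain s where "forces C X s" by blast
    \<comment> \<open>Only subsets of \<open>Out\<close> can be announced, so the target is cut
      down; nothing is lost, since all results lie in \<open>Out\<close>.\<close>
    then have s: "forces C (X \<inter> Out) s" using res by (auto simp: forces_def)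
    obtain l where l: "l \<in> L" "dec l = (C, X \<inter> Out, 0)" using dec_ex[OF C, of "X \<inter> Out" 0] n by auto
    have "res' t \<in> X" if t: "\<forall>\<alpha>\<in>C. t \<alpha> = l" for t
    proof -
      obtain u where u: "res' t = res u" "u \<in> PiE Ags Act" "\<forall>\<alpha>. formed t \<alpha> \<longrightarrow> u \<alpha> = act t \<alpha>"
        using res'_Y[of t] by (auto simp: Y_def)
      have ct: "co t \<alpha> = C \<and> tg t \<alpha> = X \<inter> Out" if "\<alpha> \<in> C" for \<alpha>
        using t l that by (simp add: co_def tg_def)
      have "u \<alpha> = wit C (X \<inter> Out) \<alpha>" if "\<alpha> \<in> C" for \<alpha>
      proof -
        have "\<alpha> \<in> co t \<alpha>" "co t \<alpha> \<subseteq> Ags" "forces (co t \<alpha>) (tg t \<alpha>) s"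
          using ct[OF that] s C that by simp_all
        moreover have "\<forall>\<beta>\<in>co t \<alpha>. co t \<beta> = co t \<alpha> \<and> tg t \<beta> = tg t \<alpha>"
          using ct that by simp
        ultimately have "formed t \<alpha>" unfolding formed_def by blast
        then show ?thesis using u(3) ct[OF that] by (simp add: act_def)
      qed
      then have "res u \<in> X \<inter> Out" using wit[OF s] u(2) unfolding forces_def by blast
      then show ?thesis using u(1) by simp
    qed
    moreover have "(\<lambda>\<alpha>\<in>C. l) \<in> C \<rightarrow>\<^sub>E L" using l(1) by auto
    ultimately show "\<exists>s\<in>C \<rightarrow>\<^sub>E L. \<forall>t\<in>Ags \<rightarrow>\<^sub>E L. (\<forall>\<alpha>\<in>C. t \<alpha> = s \<alpha>) \<longrightarrow> res' t \<in> X"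
      by (intro bexI[of _ "\<lambda>\<alpha>\<in>C. l"]) auto
  next
    assume "\<exists>s\<in>C \<rightarrow>\<^sub>E L. \<forall>t\<in>Ags \<rightarrow>\<^sub>E L. (\<forall>\<alpha>\<in>C. t \<alpha> = s \<alpha>) \<longrightarrow> res' t \<in> X"
    then obtain s where s: "s \<in> C \<rightarrow>\<^sub>E L"
      "\<And>t. t \<in> Ags \<rightarrow>\<^sub>E L \<Longrightarrow> \<forall>\<alpha>\<in>C. t \<alpha> = s \<alpha> \<Longrightarrow> res' t \<in> X" by blast
    show "\<exists>s. forces C X s"
    proof (cases "C = Ags")
      \<comment> \<open>Nobody is left outside to block or steer, but a full profile has a single
        result, and this is the result of some profile \<open>u\<close> of the original
        game.\<close>
      case True
      obtain u where u: "res' s = res u" "u \<in> PiE Ags Act" using res'_Y[of s] by (auto simp: Y_def)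
      have "t = u" if "t \<in> PiE Ags Act" "\<forall>\<alpha>\<in>Ags. t \<alpha> = u \<alpha>" for t
        using that u(2) by (intro PiE_ext) auto
      moreover have "res u \<in> X" using s(2)[of s] s(1) u(1) True by simp
      ultimately have "forces C X u" using True u(2) unfolding forces_def by blast
      then show ?thesis by blast
    next
      case False
      then obtain \<beta> where \<beta>: "\<beta> \<in> Ags" "\<beta> \<notin> C" using C by blast
      obtain l where l: "\<And>k. k \<in> {0..<n} \<Longrightarrow> l k \<in> L \<and> dec (l k) = ({}, {}, k)"
        using dec_ex[of "{}" "{}"] by (metis empty_subsetI)
      \<comment> \<open>Outside \<open>C\<close> everybody announces the empty coalition, so no
        formed coalition reaches beyond \<open>C\<close>; only the number announced by \<beta>
        varies with \<open>k\<close>.\<close>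
      define t where "t k = (\<lambda>\<alpha>\<in>Ags. if \<alpha> \<in> C then s \<alpha> else if \<alpha> = \<beta> then l k else l 0)" for k
      have t: "t k \<in> Ags \<rightarrow>\<^sub>E L" "\<forall>\<alpha>\<in>C. t k \<alpha> = s \<alpha>" if "k \<in> {0..<n}" for k
        using s(1) l[OF that] l[of 0] n C by (auto simp: t_def)
      have same: "co (t k) = co (t 0)" "tg (t k) = tg (t 0)" if "k \<in> {0..<n}" for k
        using l[OF that] l[of 0] n by (simp_all add: fun_eq_iff co_def tg_def t_def restrict_def)
      have formed_eq: "formed (t k) = formed (t 0)" and act_eq: "act (t k) = act (t 0)" if "k \<in> {0..<n}" for k
        by (simp_all only: fun_eq_iff formed_def act_def same[OF that] simp_thms)
      have Y_eq: "Y (t k) = Y (t 0)" if "k \<in> {0..<n}" for k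
        using formed_eq[OF that] act_eq[OF that] by (simp add: Y_def)
      have formed_C: "\<alpha> \<in> C" if "formed (t 0) \<alpha>" for \<alpha>
      proof (rule ccontr)
        assume "\<alpha> \<notin> C"
        then have "co (t 0) \<alpha> = {}" using act(1)[OF that] l[of 0] n by (simp add: co_def t_def)
        then show False using that unfolding formed_def by blast
      qed
      define r where "r = (\<Sum>\<alpha>\<in>Ags - {\<beta>}. nm (t 0) \<alpha>)"
      have sum: "(\<Sum>\<alpha>\<in>Ags. nm (t k) \<alpha>) = k + r" if "k \<in> {0..<n}" for k
      proof -
        have "(\<Sum>\<alpha>\<in>Ags. nm (t k) \<alpha>) = nm (t k) \<beta> + (\<Sum>\<alpha>\<in>Ags - {\<beta>}. nm (t k) \<alpha>)"
          using sum.remove[OF Ags \<beta>(1)] by blast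
        also have "nm (t k) \<beta> = k" using \<beta> l[OF that] by (simp add: nm_def t_def)
        also have "(\<Sum>\<alpha>\<in>Ags - {\<beta>}. nm (t k) \<alpha>) = r"
          unfolding r_def by (rule sum.cong) (simp_all add: nm_def t_def)
        finally show ?thesis .
      qed
      have Y_X: "Y (t 0) \<subseteq> X"
      proof
        fix y assume y: "y \<in> Y (t 0)"
        then obtain j where j: "j \<in> {0..<n}" "e j = y" using e Y_Out by blast
        \<comment> \<open>\<beta> solves \<open>k + r = j\<close> modulo \<open>n\<close>, so that
          the sum points at \<open>y\<close>, which is possible and hence chosen. Every possible
          result thus occurs and must lie in \<open>X\<close>.\<close>
        define k where "k = (j - r) mod n"
        have k: "k \<in> {0..<n}" using n by (simp add: k_def)
        have "(k + r) mod n = j" using j(1) by (simp add: k_def mod_simps)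
        then have "res' (t k) = y" using sum[OF k] j(2) y Y_eq[OF k] by (simp add: res'_def)
        then show "y \<in> X" using s(2)[OF t[OF k]] by simp
      qed
      \<comment> \<open>Members of formed coalitions play their witnesses, the rest of
        \<open>C\<close> anything available; every completion of this joint action has its result in
        \<open>Y (t 0)\<close>.\<close>
      define u where "u = (\<lambda>\<alpha>\<in>C. if formed (t 0) \<alpha> then act (t 0) \<alpha> else SOME a. a \<in> Act \<alpha>)"
      have "u \<in> PiE C Act" using act some C by (auto simp: u_def)
      moreover have "res v \<in> X" if v: "v \<in> PiE Ags Act" "\<forall>\<alpha>\<in>C. v \<alpha> = u \<alpha>" for v
      proof -
        have "\<forall>\<alpha>. formed (t 0) \<alpha> \<longrightarrow> v \<alpha> = act (t 0) \<alpha>"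
          using formed_C v(2) by (simp add: u_def)
        then show ?thesis using v(1) Y_X by (auto simp: Y_def)
      qed
      ultimately have "forces C X u" by (simp add: forces_def)
      then show ?thesis by blast
    qed
  qed
  show ?thesis
  proof (intro exI[of _ res'] conjI allI impI)
    show "res' t \<in> Out" for t using res'_Y Y_Out by blast
  qed (use main in \<open>simp only: forces_def Bex_def\<close>)
qed

section \<open>Types and the stages of eventualities\<close>

primrec subs :: "('a, 'p) atl \<Rightarrow> ('a, 'p) atl set" where
  "subs (AProp p) = {AProp p}"
| "subs (ANeg \<phi>) = insert (ANeg \<phi>) (subs \<phi>)"
| "subs (AConj \<phi> \<psi>) = insert (AConj \<phi> \<psi>) (subs \<phi> \<union> subs \<psi>)"
| "subs (ANext C \<phi>) = insert (ANext C \<phi>) (subs \<phi>)"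
| "subs (AGlob C \<phi>) = insert (AGlob C \<phi>) (subs \<phi>)"
| "subs (AUntil C \<phi> \<psi>) = insert (AUntil C \<phi> \<psi>) (subs \<phi> \<union> subs \<psi>)"

lemma finite_subs: "finite (subs \<phi>)"
  by (induction \<phi>) auto

lemma subs_refl: "\<phi> \<in> subs \<phi>"
  by (cases \<phi>) auto

lemma subs_trans: "\<psi> \<in> subs \<phi> \<Longrightarrow> subs \<psi> \<subseteq> subs \<phi>"
  by (induction \<phi>) auto

context game
begin

definition ftype :: "('a, 'p) atl \<Rightarrow> 'w \<Rightarrow> ('a, 'p) atl set" where
  "ftype \<phi> w = {\<psi> \<in> subs \<phi>. atl_sat Ags S w \<psi>}"

lemma in_ftype_iff: "\<psi> \<in> subs \<phi> \<Longrightarrow> \<psi> \<in> ftype \<phi> w \<longleftrightarrow> atl_sat Ags S w \<psi>"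
  by (simp add: ftype_def)

text \<open>An eventuality is a true until formula or a false globally formula: both are least fixpoints,
  whose stages are computed here on the level of types.  The formula \<open>\<phi>\<close> determines the types, \<open>\<chi>\<close> is
  the eventuality.\<close>

definition fulfilled :: "('a, 'p) atl \<Rightarrow> ('a, 'p) atl set \<Rightarrow> bool" where
  "fulfilled \<chi> \<Gamma> = (case \<chi> of AUntil C \<alpha> \<beta> \<Rightarrow> \<beta> \<in> \<Gamma> | AGlob C \<alpha> \<Rightarrow> \<alpha> \<notin> \<Gamma> | _ \<Rightarrow> True)"

definition pre :: "('a, 'p) atl \<Rightarrow> ('a, 'p) atl \<Rightarrow> 'w \<Rightarrow> ('a, 'p) atl set set \<Rightarrow> bool" where
  "pre \<phi> \<chi> w X = (case \<chi> of
      AUntil C \<alpha> \<beta> \<Rightarrow> \<alpha> \<in> ftype \<phi> w \<and> eff Ags S C w {v. ftype \<phi> v \<in> X}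
    | AGlob C \<alpha> \<Rightarrow> \<not> eff Ags S C w {v. ftype \<phi> v \<notin> X}
    | _ \<Rightarrow> False)"

text \<open>A type enters as soon as one state of that type satisfies \<open>pre\<close>; other
  states of the type may fail to. The finite structure has to copy a state of the former kind, which
  \<open>rank_Suc_pre\<close> provides.\<close>

primrec stage :: "('a, 'p) atl \<Rightarrow> ('a, 'p) atl \<Rightarrow> nat \<Rightarrow> ('a, 'p) atl set set" where
  "stage \<phi> \<chi> 0 = {\<Gamma> \<in> ftype \<phi> ` states S. fulfilled \<chi> \<Gamma>}"
| "stage \<phi> \<chi> (Suc n) = stage \<phi> \<chi> n \<union> ftype \<phi> ` {w \<in> states S. pre \<phi> \<chi> w (stage \<phi> \<chi> n)}"

text \<open>For a type in no stage this is an unspecified number. Tracking only compares ranks as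
  natural numbers, so it stays well founded.\<close>

definition rank :: "('a, 'p) atl \<Rightarrow> ('a, 'p) atl \<Rightarrow> ('a, 'p) atl set \<Rightarrow> nat" where
  "rank \<phi> \<chi> \<Gamma> = (LEAST n. \<Gamma> \<in> stage \<phi> \<chi> n)"

lemma finite_ftypes: "finite (ftype \<phi> ` states S)"
  by (rule finite_subset[of _ "Pow (subs \<phi>)"]) (auto simp: ftype_def finite_subs)

lemma stage_mono: "n \<le> k \<Longrightarrow> stage \<phi> \<chi> n \<subseteq> stage \<phi> \<chi> k"
  by (rule lift_Suc_mono_le) auto

lemma stage_ftypes: "stage \<phi> \<chi> n \<subseteq> ftype \<phi> ` states S"
  by (induction n) auto

lemma stages_exhausted: "\<exists>n. \<forall>k. stage \<phi> \<chi> k \<subseteq> stage \<phi> \<chi> n"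
proof -
  let ?R = "\<Union>n. stage \<phi> \<chi> n"
  have "finite ?R" by (rule finite_subset[OF _ finite_ftypes]) (use stage_ftypes in blast)
  moreover obtain k where k: "\<And>\<Gamma>. \<Gamma> \<in> ?R \<Longrightarrow> \<Gamma> \<in> stage \<phi> \<chi> (k \<Gamma>)" by (metis UN_E)
  ultimately have "\<Gamma> \<in> stage \<phi> \<chi> (Max (k ` ?R))" if "\<Gamma> \<in> ?R" for \<Gamma>
    using stage_mono[of "k \<Gamma>" "Max (k ` ?R)" \<phi> \<chi>] that by (auto intro!: Max_ge)
  then show ?thesis by blast
qed

lemma stages_closed:
  obtains R where "R = (\<Union>n. stage \<phi> \<chi> n)"
    "\<And>w. w \<in> states S \<Longrightarrow> fulfilled \<chi> (ftype \<phi> w) \<Longrightarrow> ftype \<phi> w \<in> R"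
    "\<And>w. w \<in> states S \<Longrightarrow> pre \<phi> \<chi> w R \<Longrightarrow> ftype \<phi> w \<in> R"
proof -
  obtain n where n: "\<And>k. stage \<phi> \<chi> k \<subseteq> stage \<phi> \<chi> n" using stages_exhausted by blast
  have R: "(\<Union>n. stage \<phi> \<chi> n) = stage \<phi> \<chi> n" using n by blast
  show ?thesis
  proof (rule that[of "stage \<phi> \<chi> n"])
    show "ftype \<phi> w \<in> stage \<phi> \<chi> n" if "w \<in> states S" "fulfilled \<chi> (ftype \<phi> w)" for w
      using that n[of 0] by auto
    show "ftype \<phi> w \<in> stage \<phi> \<chi> n" if "w \<in> states S" "pre \<phi> \<chi> w (stage \<phi> \<chi> n)" for w
      using that n[of "Suc n"] by auto
  qed (simp add: R)
qed

text \<open>The states whose type lies in some stage form a pre-fixed set, so they include all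
  states where the formula holds.\<close>

lemma until_in_stages:
  assumes "AUntil C \<alpha> \<beta> \<in> subs \<phi>" "C \<subseteq> Ags" "w \<in> states S" "atl_sat Ags S w (AUntil C \<alpha> \<beta>)"
  shows "\<exists>n. ftype \<phi> w \<in> stage \<phi> (AUntil C \<alpha> \<beta>) n"
proof -
  have sub: "\<alpha> \<in> subs \<phi>" "\<beta> \<in> subs \<phi>"
    using subs_trans[OF assms(1)] subs_refl[of \<alpha>] subs_refl[of \<beta>] by auto
  obtain R where R: "R = (\<Union>n. stage \<phi> (AUntil C \<alpha> \<beta>) n)"
    "\<And>w. w \<in> states S \<Longrightarrow> fulfilled (AUntil C \<alpha> \<beta>) (ftype \<phi> w) \<Longrightarrow> ftype \<phi> w \<in> R"
    "\<And>w. w \<in> states S \<Longrightarrow> pre \<phi> (AUntil C \<alpha> \<beta>) w R \<Longrightarrow> ftype \<phi> w \<in> R"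
    by (rule stages_closed) blast
  let ?Z = "{v. ftype \<phi> v \<in> R}"
  have "\<forall>v\<in>states S. atl_sat Ags S v \<beta> \<or> atl_sat Ags S v \<alpha> \<and> eff Ags S C v ?Z \<longrightarrow> v \<in> ?Z"
    using R(2,3) sub by (auto simp: fulfilled_def pre_def ftype_def)
  then have "w \<in> ?Z" using assms(4) unfolding atl_sat_until_lfp[OF assms(2,3)] by blast
  then show ?thesis using R(1) by blast
qed

text \<open>The states whose type lies in no stage form a post-fixed set: \<alpha> holds there and
  \<open>C\<close> can stay among them. So the globally formula holds at each of them.\<close>

lemma not_glob_in_stages:
  assumes "AGlob C \<alpha> \<in> subs \<phi>" "C \<subseteq> Ags" "w \<in> states S" "\<not> atl_sat Ags S w (AGlob C \<alpha>)"
  shows "\<exists>n. ftype \<phi> w \<in> stage \<phi> (AGlob C \<alpha>) n"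
proof (rule ccontr)
  assume no: "\<not> (\<exists>n. ftype \<phi> w \<in> stage \<phi> (AGlob C \<alpha>) n)"
  have sub: "\<alpha> \<in> subs \<phi>" using subs_trans[OF assms(1)] subs_refl by auto
  obtain R where R: "R = (\<Union>n. stage \<phi> (AGlob C \<alpha>) n)"
    "\<And>w. w \<in> states S \<Longrightarrow> fulfilled (AGlob C \<alpha>) (ftype \<phi> w) \<Longrightarrow> ftype \<phi> w \<in> R"
    "\<And>w. w \<in> states S \<Longrightarrow> pre \<phi> (AGlob C \<alpha>) w R \<Longrightarrow> ftype \<phi> w \<in> R"
    by (rule stages_closed) blast
  let ?Z = "{v \<in> states S. ftype \<phi> v \<notin> R}"
  have "atl_sat Ags S v \<alpha> \<and> eff Ags S C v ?Z" if "v \<in> ?Z" for v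
  proof -
    have v: "v \<in> states S" "ftype \<phi> v \<notin> R" using that by auto
    then have "\<alpha> \<in> ftype \<phi> v" "eff Ags S C v {v. ftype \<phi> v \<notin> R}"
      using R(2,3)[OF v(1)] by (auto simp: fulfilled_def pre_def)
    moreover have "{v. ftype \<phi> v \<notin> R} \<inter> states S = ?Z" by blast
    ultimately show ?thesis using eff_Int_states[OF v(1), of C "{v. ftype \<phi> v \<notin> R}"] by (simp add: ftype_def)
  qed
  moreover have "w \<in> ?Z" using no R(1) assms(3) by blast
  ultimately have "atl_sat Ags S w (AGlob C \<alpha>)"
    unfolding atl_sat_glob_gfp[OF assms(2,3)] by (intro exI[of _ ?Z]) blast
  then show False using assms(4) by blast
qed

text \<open>Lets a descent be iterated: after a step to smaller rank the formula is still in the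
  type. One state of a type decides all its subformulas, so the fixpoint unfolding at the state that
  let the type in is enough.\<close>

lemma until_of_stage:
  assumes "AUntil C \<alpha> \<beta> \<in> subs \<phi>" "C \<subseteq> Ags"
  shows "\<Gamma> \<in> stage \<phi> (AUntil C \<alpha> \<beta>) n \<Longrightarrow> AUntil C \<alpha> \<beta> \<in> \<Gamma>"
proof (induction n arbitrary: \<Gamma>)
  case 0
  then obtain w where w: "w \<in> states S" "\<Gamma> = ftype \<phi> w" "\<beta> \<in> \<Gamma>" by (auto simp: fulfilled_def)
  then show ?case
    using atl_sat_until_unfold[OF assms(2) w(1)] assms(1) unfolding w(2) ftype_def by blast
next
  case (Suc n)
  show ?case
  proof (cases "\<Gamma> \<in> stage \<phi> (AUntil C \<alpha> \<beta>) n")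
    case False
    then obtain w where w: "w \<in> states S" "\<Gamma> = ftype \<phi> w" "pre \<phi> (AUntil C \<alpha> \<beta>) w (stage \<phi> (AUntil C \<alpha> \<beta>) n)"
      using Suc.prems by auto
    then have E: "eff Ags S C w {v. ftype \<phi> v \<in> stage \<phi> (AUntil C \<alpha> \<beta>) n}" and \<alpha>: "atl_sat Ags S w \<alpha>"
      by (simp_all add: pre_def ftype_def)
    have "eff Ags S C w {v \<in> states S. atl_sat Ags S v (AUntil C \<alpha> \<beta>)}"
      by (rule eff_mono_on_states[OF E w(1)]) (use Suc.IH in \<open>auto simp: ftype_def simp del: atl_sat.simps\<close>)
    then show ?thesis
      using atl_sat_until_unfold[OF assms(2) w(1)] \<alpha> assms(1) unfolding w(2) ftype_def by blast
  qed (rule Suc.IH)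
qed

lemma not_glob_of_stage:
  assumes "AGlob C \<alpha> \<in> subs \<phi>" "C \<subseteq> Ags"
  shows "\<Gamma> \<in> stage \<phi> (AGlob C \<alpha>) n \<Longrightarrow> AGlob C \<alpha> \<notin> \<Gamma>"
proof (induction n arbitrary: \<Gamma>)
  case 0
  then obtain w where w: "w \<in> states S" "\<Gamma> = ftype \<phi> w" "\<alpha> \<notin> \<Gamma>" by (auto simp: fulfilled_def)
  have "\<alpha> \<in> subs \<phi>" using subs_trans[OF assms(1)] subs_refl by auto
  then show ?case
    using atl_sat_glob_unfold[OF assms(2) w(1)] w(3) unfolding w(2) ftype_def by blast
next
  case (Suc n)
  show ?case
  proof (cases "\<Gamma> \<in> stage \<phi> (AGlob C \<alpha>) n")
    case False
    then obtain w where w: "w \<in> states S" "\<Gamma> = ftype \<phi> w" "pre \<phi> (AGlob C \<alpha>) w (stage \<phi> (AGlob C \<alpha>) n)"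
      using Suc.prems by auto
    have "eff Ags S C w {v. ftype \<phi> v \<notin> stage \<phi> (AGlob C \<alpha>) n}"
      if "eff Ags S C w {v \<in> states S. atl_sat Ags S v (AGlob C \<alpha>)}"
      using that by (rule eff_mono_on_states[OF _ w(1)])
        (use Suc.IH assms(1) in \<open>auto simp: ftype_def simp del: atl_sat.simps\<close>)
    then have "\<not> eff Ags S C w {v \<in> states S. atl_sat Ags S v (AGlob C \<alpha>)}"
      using w(3) by (auto simp: pre_def simp del: atl_sat.simps)
    then show ?thesis
      using atl_sat_glob_unfold[OF assms(2) w(1)] unfolding w(2) ftype_def by blast
  qed (rule Suc.IH)
qed

lemma stage_rank: "\<Gamma> \<in> stage \<phi> \<chi> n \<Longrightarrow> \<Gamma> \<in> stage \<phi> \<chi> (rank \<phi> \<chi> \<Gamma>) \<and> rank \<phi> \<chi> \<Gamma> \<le> n"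
  unfolding rank_def by (auto intro: LeastI Least_le)

lemma rank_Suc_pre:
  assumes "\<Gamma> \<in> stage \<phi> \<chi> k" "rank \<phi> \<chi> \<Gamma> = Suc n"
  shows "\<exists>w\<in>states S. ftype \<phi> w = \<Gamma> \<and> pre \<phi> \<chi> w (stage \<phi> \<chi> n)"
proof -
  have "\<Gamma> \<in> stage \<phi> \<chi> (Suc n)" using stage_rank[OF assms(1)] assms(2) by simp
  moreover have "\<Gamma> \<notin> stage \<phi> \<chi> n" using stage_rank[of \<Gamma> \<phi> \<chi> n] assms(2) by auto
  ultimately show ?thesis by auto
qed

end

text \<open>A state \<open>x\<close> of the finite structure \<open>S'\<close> stands for the type of the state \<open>st x\<close> of \<open>S\<close>, and it
  tracks the eventuality with number \<open>ix x\<close>.  Moving to a type of smaller rank for this eventuality keeps it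
  tracked, any other move passes to the next one, so that each is tracked again and again on every path.\<close>

locale tracking = game Ags S + S': game Ags S'
  for Ags :: "'a set" and S :: "('w, 'a, 'l, 'p) cgs" and S' :: "('x, 'a, 'k, 'p) cgs" +
  fixes \<phi> :: "('a, 'p) atl" and P :: "'p set" and N :: nat and evs :: "nat \<Rightarrow> ('a, 'p) atl"
    and st :: "'x \<Rightarrow> 'w" and ix :: "'x \<Rightarrow> nat" and move :: "'x \<Rightarrow> ('a, 'p) atl set \<Rightarrow> 'x"
  assumes lang: "\<phi> \<in> atl_lang Ags P"
    and evs: "subs \<phi> \<subseteq> evs ` {..<N}"
    and st: "x \<in> states S' \<Longrightarrow> st x \<in> states S" and ix: "x \<in> states S' \<Longrightarrow> ix x < N"
    and move: "x \<in> states S' \<Longrightarrow> v \<in> states S \<Longrightarrow> move x (ftype \<phi> v) \<in> states S'"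
      "x \<in> states S' \<Longrightarrow> v \<in> states S \<Longrightarrow> ftype \<phi> (st (move x (ftype \<phi> v))) = ftype \<phi> v"
      "x \<in> states S' \<Longrightarrow> v \<in> states S \<Longrightarrow> ix (move x (ftype \<phi> v)) =
        (if rank \<phi> (evs (ix x)) (ftype \<phi> v) < rank \<phi> (evs (ix x)) (ftype \<phi> (st x)) then ix x
         else Suc (ix x) mod N)"
    and st_pre: "x \<in> states S' \<Longrightarrow> ftype \<phi> (st x) \<in> stage \<phi> (evs (ix x)) k \<Longrightarrow>
      rank \<phi> (evs (ix x)) (ftype \<phi> (st x)) = Suc n \<Longrightarrow>
      pre \<phi> (evs (ix x)) (st x) (stage \<phi> (evs (ix x)) n)"
    and eff_move: "x \<in> states S' \<Longrightarrow> C \<subseteq> Ags \<Longrightarrow>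
      eff Ags S' C x Z \<longleftrightarrow> eff Ags S C (st x) {v. move x (ftype \<phi> v) \<in> Z}"
    and val: "x \<in> states S' \<Longrightarrow> x \<in> cgs_val S' p \<longleftrightarrow> AProp p \<in> ftype \<phi> (st x)"
begin

text \<open>Lexicographic: first the number of passes until index \<open>e\<close> is tracked,
  counted cyclically modulo \<open>N\<close>, then the rank for the eventuality tracked now.\<close>

definition nearer :: "nat \<Rightarrow> ('x \<times> 'x) set" where
  "nearer e = measures [\<lambda>x. if ix x \<le> e then e - ix x else e + N - ix x,
     \<lambda>x. rank \<phi> (evs (ix x)) (ftype \<phi> (st x))]"

lemma wf_nearer: "wf (nearer e)"
  by (simp add: nearer_def)

text \<open>A move lowers the rank at a constant index, or passes to the next index and so comes one
  step closer to \<open>e\<close>. Passing on from \<open>e\<close> itself would reset the distance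
  to \<open>N - 1\<close>; the last assumption excludes this.\<close>

lemma move_nearer:
  assumes x: "x \<in> states S'" and v: "v \<in> states S" and e: "e < N"
    and "ix x = e \<Longrightarrow> rank \<phi> (evs e) (ftype \<phi> v) < rank \<phi> (evs e) (ftype \<phi> (st x))"
  shows "(move x (ftype \<phi> v), x) \<in> nearer e"
proof (cases "rank \<phi> (evs (ix x)) (ftype \<phi> v) < rank \<phi> (evs (ix x)) (ftype \<phi> (st x))")
  case True
  then show ?thesis using move(2,3)[OF x v] by (simp add: nearer_def)
next
  case False
  then have i: "ix (move x (ftype \<phi> v)) = Suc (ix x) mod N" "ix x \<noteq> e"
    using move(3)[OF x v] assms(4) by auto
  show ?thesis
  proof (cases "Suc (ix x) = N")
    \<comment> \<open>The index wraps from \<open>N - 1\<close> to 0, and the distance drops from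
      \<open>e + 1\<close> to \<open>e\<close>.\<close>
    case True
    then show ?thesis using i e by (auto simp: nearer_def)
  next
    case False
    then show ?thesis using i e ix[OF x] by (auto simp: nearer_def)
  qed
qed

lemma fulfilled_rank_0:
  assumes "\<Gamma> \<in> stage \<phi> \<chi> k" "rank \<phi> \<chi> \<Gamma> = 0"
  shows "fulfilled \<chi> \<Gamma>"
  using stage_rank[OF assms(1)] assms(2) by simp

text \<open>If the formula failed at the type of a state in \<open>Z\<close>, some move would stay
  in \<open>Z\<close>, preserve the failure and be \<open>nearer\<close>. While the formula is
  tracked, \<open>st_pre\<close> says that \<open>C\<close> cannot avoid a smaller rank; otherwise
  the unfolding provides a successor where it fails. Well-foundedness forbids this.\<close>

lemma glob_sound:
  assumes C: "C \<subseteq> Ags" and sub: "AGlob C \<psi> \<in> subs \<phi>"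
    and Z: "Z \<subseteq> states S'" "\<And>x. x \<in> Z \<Longrightarrow> \<psi> \<in> ftype \<phi> (st x)" "\<And>x. x \<in> Z \<Longrightarrow> eff Ags S' C x Z"
    and x: "x \<in> Z"
  shows "AGlob C \<psi> \<in> ftype \<phi> (st x)"
proof -
  let ?\<chi> = "AGlob C \<psi>"
  obtain e where e: "e < N" "evs e = ?\<chi>" using evs sub by auto
  show ?thesis
    using wf_nearer[of e] x
  proof (induction x rule: wf_induct_rule)
    case (less x)
    have x: "x \<in> states S'" using less.prems Z(1) by blast
    have E: "eff Ags S C (st x) {v. move x (ftype \<phi> v) \<in> Z}"
      using Z(3)[OF less.prems] eff_move[OF x C] by blast
    \<comment> \<open>What \<open>C\<close> can force meets every set whose complement
      \<open>C\<close> cannot force.\<close>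
    then have avoid: "\<exists>v\<in>states S. move x (ftype \<phi> v) \<in> Z \<and> v \<notin> X" if "\<not> eff Ags S C (st x) X" for X
      using that eff_mono_on_states[OF E st[OF x], of X] by blast
    show ?case
    proof (rule ccontr)
      assume "?\<chi> \<notin> ftype \<phi> (st x)"
      then have nsat: "\<not> atl_sat Ags S (st x) ?\<chi>" using sub by (simp add: ftype_def)
      have "\<exists>v\<in>states S. move x (ftype \<phi> v) \<in> Z \<and> ?\<chi> \<notin> ftype \<phi> v \<and>
          (ix x = e \<longrightarrow> rank \<phi> ?\<chi> (ftype \<phi> v) < rank \<phi> ?\<chi> (ftype \<phi> (st x)))"
      proof (cases "ix x = e")
        case False
        have "atl_sat Ags S (st x) \<psi>" using Z(2)[OF less.prems] by (simp add: ftype_def)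
        then have "\<not> eff Ags S C (st x) {v \<in> states S. atl_sat Ags S v ?\<chi>}"
          using nsat atl_sat_glob_unfold[OF C st[OF x]] by blast
        then obtain v where "v \<in> states S" "move x (ftype \<phi> v) \<in> Z" "\<not> atl_sat Ags S v ?\<chi>"
          using avoid by blast
        then show ?thesis using False unfolding ftype_def by blast
      next
        case True
        obtain k where k: "ftype \<phi> (st x) \<in> stage \<phi> ?\<chi> k"
          using not_glob_in_stages[OF sub C st[OF x] nsat] by blast
        have "\<not> fulfilled ?\<chi> (ftype \<phi> (st x))"
          using Z(2)[OF less.prems] by (simp add: fulfilled_def)
        then obtain n where n: "rank \<phi> ?\<chi> (ftype \<phi> (st x)) = Suc n"
          using fulfilled_rank_0[OF k] not0_implies_Suc by blast
        then have "pre \<phi> ?\<chi> (st x) (stage \<phi> ?\<chi> n)"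
          using st_pre[OF x, of k n] True e(2) k by simp
        then have "\<not> eff Ags S C (st x) {v. ftype \<phi> v \<notin> stage \<phi> ?\<chi> n}"
          by (simp add: pre_def)
        then obtain v where v: "v \<in> states S" "move x (ftype \<phi> v) \<in> Z" "ftype \<phi> v \<in> stage \<phi> ?\<chi> n"
          using avoid by blast
        have "rank \<phi> ?\<chi> (ftype \<phi> v) < Suc n" using stage_rank[OF v(3)] by simp
        then show ?thesis using v n not_glob_of_stage[OF sub C v(3)] by auto
      qed
      then obtain v where v: "v \<in> states S" "move x (ftype \<phi> v) \<in> Z" "?\<chi> \<notin> ftype \<phi> v"
        "ix x = e \<Longrightarrow> rank \<phi> ?\<chi> (ftype \<phi> v) < rank \<phi> ?\<chi> (ftype \<phi> (st x))" by blast
      have "(move x (ftype \<phi> v), x) \<in> nearer e"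
        by (rule move_nearer[OF x v(1) e(1)]) (simp add: e(2) v(4))
      then have "?\<chi> \<in> ftype \<phi> (st (move x (ftype \<phi> v)))" using less.IH v(2) by blast
      then show False using v(3) move(2)[OF x v(1)] by simp
    qed
  qed
qed

text \<open>Here \<open>C\<close> itself forces types that keep the until formula and, while it is
  tracked, have smaller rank; by induction all resulting states are in \<open>Z\<close>, hence so is
  \<open>x\<close>.\<close>

lemma until_complete:
  assumes C: "C \<subseteq> Ags" and sub: "AUntil C \<psi> \<theta> \<in> subs \<phi>"
    and Z: "\<And>x. x \<in> states S' \<Longrightarrow> \<theta> \<in> ftype \<phi> (st x) \<Longrightarrow> x \<in> Z"
      "\<And>x. x \<in> states S' \<Longrightarrow> \<psi> \<in> ftype \<phi> (st x) \<Longrightarrow> eff Ags S' C x Z \<Longrightarrow> x \<in> Z"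
    and x: "x \<in> states S'" "AUntil C \<psi> \<theta> \<in> ftype \<phi> (st x)"
  shows "x \<in> Z"
proof -
  let ?\<chi> = "AUntil C \<psi> \<theta>"
  obtain e where e: "e < N" "evs e = ?\<chi>" using evs sub by auto
  have sub': "\<psi> \<in> subs \<phi>" "\<theta> \<in> subs \<phi>"
    using subs_trans[OF sub] subs_refl[of \<psi>] subs_refl[of \<theta>] by auto
  show ?thesis
    using wf_nearer[of e] x
  proof (induction x rule: wf_induct_rule)
    case (less x)
    have x: "x \<in> states S'" and sat: "atl_sat Ags S (st x) ?\<chi>"
      using less.prems by (auto simp: ftype_def simp del: atl_sat.simps)
    show ?case
    proof (cases "\<theta> \<in> ftype \<phi> (st x)")
      case False
      have "atl_sat Ags S (st x) \<psi> \<and> eff Ags S C (st x) {v \<in> states S. atl_sat Ags S v ?\<chi>}"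
        using sat False sub' atl_sat_until_unfold[OF C st[OF x]] by (auto simp: ftype_def simp del: atl_sat.simps)
      then have \<psi>: "\<psi> \<in> ftype \<phi> (st x)" and stay: "eff Ags S C (st x) {v \<in> states S. atl_sat Ags S v ?\<chi>}"
        using sub' by (simp_all add: ftype_def)
      obtain X where X: "eff Ags S C (st x) X" "\<And>v. v \<in> X \<Longrightarrow> v \<in> states S \<Longrightarrow> ?\<chi> \<in> ftype \<phi> v \<and>
          (ix x = e \<longrightarrow> rank \<phi> ?\<chi> (ftype \<phi> v) < rank \<phi> ?\<chi> (ftype \<phi> (st x)))"
      proof (cases "ix x = e")
        case True
        obtain k where k: "ftype \<phi> (st x) \<in> stage \<phi> ?\<chi> k"
          using until_in_stages[OF sub C st[OF x] sat] by blast
        have "\<not> fulfilled ?\<chi> (ftype \<phi> (st x))" using False by (simp add: fulfilled_def)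
        then obtain n where n: "rank \<phi> ?\<chi> (ftype \<phi> (st x)) = Suc n"
          using fulfilled_rank_0[OF k] not0_implies_Suc by blast
        then have "pre \<phi> ?\<chi> (st x) (stage \<phi> ?\<chi> n)"
          using st_pre[OF x, of k n] True e(2) k by simp
        then have "eff Ags S C (st x) {v. ftype \<phi> v \<in> stage \<phi> ?\<chi> n}" by (simp add: pre_def)
        then show ?thesis
        proof (rule that)
          fix v assume "v \<in> {v. ftype \<phi> v \<in> stage \<phi> ?\<chi> n}"
          then have v: "ftype \<phi> v \<in> stage \<phi> ?\<chi> n" by blast
          then show "?\<chi> \<in> ftype \<phi> v \<and>
              (ix x = e \<longrightarrow> rank \<phi> ?\<chi> (ftype \<phi> v) < rank \<phi> ?\<chi> (ftype \<phi> (st x)))"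
            using until_of_stage[OF sub C v] stage_rank[OF v] n by auto
        qed
      next
        case False
        then show ?thesis using that[OF stay] sub unfolding ftype_def by blast
      qed
      have "move x (ftype \<phi> v) \<in> Z" if v: "v \<in> X" "v \<in> states S" for v
      proof (rule less.IH)
        show "(move x (ftype \<phi> v), x) \<in> nearer e"
          by (rule move_nearer[OF x v(2) e(1)]) (use X(2)[OF v] e(2) in simp)
      qed (use move(1,2)[OF x v(2)] X(2)[OF v] in simp_all)
      then have "eff Ags S C (st x) {v. move x (ftype \<phi> v) \<in> Z}"
        by (intro eff_mono_on_states[OF X(1) st[OF x]]) blast
      then show ?thesis using Z(2)[OF x \<psi>] eff_move[OF x C, of Z] by blast
    qed (rule Z(1)[OF x])
  qed
qed

text \<open>From type to truth for globally and from truth to type for until, the states whose type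
  contains the formula serve as the fixpoint set, by unfolding in \<open>S\<close>. The two opposite
  directions are the ones that rely on tracking, through \<open>glob_sound\<close> and
  \<open>until_complete\<close>.\<close>

theorem atl_sat_iff_in_ftype:
  assumes "\<psi> \<in> atl_lang Ags P"
  shows "\<psi> \<in> subs \<phi> \<Longrightarrow> x \<in> states S' \<Longrightarrow> atl_sat Ags S' x \<psi> \<longleftrightarrow> \<psi> \<in> ftype \<phi> (st x)"
  using assms
proof (induction arbitrary: x rule: atl_lang.induct)
  case (1 p)
  then show ?case using val by simp
next
  case (2 \<psi>)
  then have "\<psi> \<in> subs \<phi>" using subs_trans[of "ANeg \<psi>" \<phi>] subs_refl by auto
  then show ?case using 2 by (simp add: ftype_def)
next
  case (3 \<psi> \<theta>)
  then have "\<psi> \<in> subs \<phi>" "\<theta> \<in> subs \<phi>" using subs_trans[of "AConj \<psi> \<theta>" \<phi>] subs_refl[of \<psi>] subs_refl[of \<theta>] by auto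
  then show ?case using 3 by (simp add: ftype_def)
next
  case (4 C \<psi>)
  note x = \<open>x \<in> states S'\<close> and C = \<open>C \<subseteq> Ags\<close>
  have sub: "\<psi> \<in> subs \<phi>" using 4 subs_trans[of "ANext C \<psi>" \<phi>] subs_refl by auto
  have "move x (ftype \<phi> v) \<in> {y \<in> states S'. atl_sat Ags S' y \<psi>} \<longleftrightarrow> atl_sat Ags S v \<psi>"
    if v: "v \<in> states S" for v
    using 4(3)[OF sub move(1)[OF x v]] move(1,2)[OF x v]
    by (simp add: in_ftype_iff[OF sub, of v, symmetric])
  then have "eff Ags S C (st x) {v. move x (ftype \<phi> v) \<in> {y \<in> states S'. atl_sat Ags S' y \<psi>}} \<longleftrightarrow>
      eff Ags S C (st x) {v \<in> states S. atl_sat Ags S v \<psi>}"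
    by (intro eff_iff_on_states[OF st[OF x]]) blast
  then show ?case
    using S'.atl_sat_next_eff[OF C x] atl_sat_next_eff[OF C st[OF x]] eff_move[OF x C] in_ftype_iff[OF 4(4)]
    by blast
next
  case (5 C \<psi>)
  note x = \<open>x \<in> states S'\<close> and C = \<open>C \<subseteq> Ags\<close>
  have sub: "\<psi> \<in> subs \<phi>" using 5 subs_trans[of "AGlob C \<psi>" \<phi>] subs_refl by auto
  note IH = 5(3)[OF sub]
  show ?case
  proof
    assume "atl_sat Ags S' x (AGlob C \<psi>)"
    then obtain Z where Z: "Z \<subseteq> states S'" "x \<in> Z" "\<forall>y\<in>Z. atl_sat Ags S' y \<psi> \<and> eff Ags S' C y Z"
      unfolding S'.atl_sat_glob_gfp[OF C x] by blast
    then show "AGlob C \<psi> \<in> ftype \<phi> (st x)"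
      using glob_sound[OF C 5(4) Z(1) _ _ Z(2)] IH by blast
  next
    assume G: "AGlob C \<psi> \<in> ftype \<phi> (st x)"
    let ?Z = "{y \<in> states S'. AGlob C \<psi> \<in> ftype \<phi> (st y)}"
    have "atl_sat Ags S' y \<psi> \<and> eff Ags S' C y ?Z" if y: "y \<in> ?Z" for y
    proof -
      have yS: "y \<in> states S'" using y by blast
      have "AGlob C \<psi> \<in> ftype \<phi> (st y)" using y by blast
      then have u: "\<psi> \<in> ftype \<phi> (st y)" "eff Ags S C (st y) {v \<in> states S. AGlob C \<psi> \<in> ftype \<phi> v}"
        unfolding in_ftype_iff[OF 5(4)] in_ftype_iff[OF sub] using atl_sat_glob_unfold[OF C st[OF yS]] by blast+
      have "eff Ags S C (st y) {v. move y (ftype \<phi> v) \<in> ?Z}"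
        by (rule eff_mono_on_states[OF u(2) st[OF yS]]) (use move(1,2)[OF yS] in auto)
      then show ?thesis using eff_move[OF yS C] u(1) IH[OF yS] by blast
    qed
    then show "atl_sat Ags S' x (AGlob C \<psi>)"
      unfolding S'.atl_sat_glob_gfp[OF C x] using G x by (intro exI[of _ ?Z]) blast
  qed
next
  case (6 C \<psi> \<theta>)
  note x = \<open>x \<in> states S'\<close> and C = \<open>C \<subseteq> Ags\<close>
  have sub: "\<psi> \<in> subs \<phi>" "\<theta> \<in> subs \<phi>" using 6 subs_trans[of "AUntil C \<psi> \<theta>" \<phi>] subs_refl[of \<psi>] subs_refl[of \<theta>] by auto
  note IH = 6(4)[OF sub(1)] 6(5)[OF sub(2)]
  show ?case
  proof
    assume U: "atl_sat Ags S' x (AUntil C \<psi> \<theta>)"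
    let ?Z = "{y \<in> states S'. AUntil C \<psi> \<theta> \<in> ftype \<phi> (st y)}"
    have "y \<in> ?Z" if y: "y \<in> states S'" "atl_sat Ags S' y \<theta> \<or> atl_sat Ags S' y \<psi> \<and> eff Ags S' C y ?Z" for y
    proof -
      have "eff Ags S C (st y) {v \<in> states S. AUntil C \<psi> \<theta> \<in> ftype \<phi> v}" if "eff Ags S' C y ?Z"
      proof -
        have "eff Ags S C (st y) {v. move y (ftype \<phi> v) \<in> ?Z}" using that eff_move[OF y(1) C] by blast
        then show ?thesis
          by (rule eff_mono_on_states[OF _ st[OF y(1)]]) (use move(2)[OF y(1)] in auto)
      qed
      then have "\<theta> \<in> ftype \<phi> (st y) \<or>
          \<psi> \<in> ftype \<phi> (st y) \<and> eff Ags S C (st y) {v \<in> states S. AUntil C \<psi> \<theta> \<in> ftype \<phi> v}"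
        using y(2) IH[OF y(1)] by blast
      then have "AUntil C \<psi> \<theta> \<in> ftype \<phi> (st y)"
        unfolding in_ftype_iff[OF 6(6)] in_ftype_iff[OF sub(1)] in_ftype_iff[OF sub(2)]
        using atl_sat_until_unfold[OF C st[OF y(1)]] by blast
      then show ?thesis using y(1) by blast
    qed
    then have "x \<in> ?Z" using U unfolding S'.atl_sat_until_lfp[OF C x] by blast
    then show "AUntil C \<psi> \<theta> \<in> ftype \<phi> (st x)" by blast
  next
    assume U: "AUntil C \<psi> \<theta> \<in> ftype \<phi> (st x)"
    show "atl_sat Ags S' x (AUntil C \<psi> \<theta>)"
      unfolding S'.atl_sat_until_lfp[OF C x]
    proof (intro allI impI)
      fix Z assume Z: "\<forall>y\<in>states S'. atl_sat Ags S' y \<theta> \<or> atl_sat Ags S' y \<psi> \<and> eff Ags S' C y Z \<longrightarrow> y \<in> Z"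
      show "x \<in> Z"
        by (rule until_complete[OF C 6(6) _ _ x U]) (use Z IH in blast)+
    qed
  qed
qed

end

section \<open>Assembling the finite structure\<close>

context game
begin

text \<open>The rank determines \<open>n\<close>, so a single witness serves for all
  \<open>k\<close> and \<open>n\<close>. If the rank is 0 or the type is in no stage, any state of
  the type will do.\<close>

lemma ex_rank_witness:
  assumes "\<Gamma> \<in> ftype \<phi> ` states S"
  shows "\<exists>w\<in>states S. ftype \<phi> w = \<Gamma> \<and>
    (\<forall>k n. \<Gamma> \<in> stage \<phi> \<chi> k \<longrightarrow> rank \<phi> \<chi> \<Gamma> = Suc n \<longrightarrow> pre \<phi> \<chi> w (stage \<phi> \<chi> n))"
proof (cases "\<exists>k n. \<Gamma> \<in> stage \<phi> \<chi> k \<and> rank \<phi> \<chi> \<Gamma> = Suc n")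
  case True
  then obtain k n where "\<Gamma> \<in> stage \<phi> \<chi> k" and n: "rank \<phi> \<chi> \<Gamma> = Suc n" by blast
  from rank_Suc_pre[OF this] obtain w where "w \<in> states S" "ftype \<phi> w = \<Gamma>" "pre \<phi> \<chi> w (stage \<phi> \<chi> n)"
    by blast
  then show ?thesis using n by (intro bexI[of _ w]) auto
next
  case False
  then show ?thesis using assms by blast
qed

theorem finite_model:
  assumes Ags: "finite Ags" and \<phi>: "\<phi> \<in> atl_lang Ags P" and w0: "w0 \<in> states S"
    and inf: "infinite (UNIV :: 'x set)" "infinite (UNIV :: 'k set)"
  obtains S' :: "('x, 'a, 'k, 'p) cgs" and x
  where "is_cgs Ags P S'" "x \<in> states S'" "atl_sat Ags S' x \<phi> \<longleftrightarrow> atl_sat Ags S w0 \<phi>"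
proof -
  define Out where "Out = ftype \<phi> ` states S"
  have Out: "finite Out" "Out \<noteq> {}" using finite_ftypes w0 by (auto simp: Out_def)
  define N where "N = card (subs \<phi>)"
  have N: "0 < N" using finite_subs[of \<phi>] subs_refl[of \<phi>] by (auto simp: N_def card_gt_0_iff)
  \<comment> \<open>All subformulas are enumerated. For one that is neither until nor globally every
    type is in stage 0, so its rank is constantly 0 and tracking passes on at once.\<close>
  obtain evs where evs: "bij_betw evs {0..<N} (subs \<phi>)"
    unfolding N_def using ex_bij_betw_nat_finite[OF finite_subs] by blast
  define K where "K = Pow Ags \<times> Pow Out \<times> {0..<int (card Out)}"
  have "0 < card Out" using Out by (simp add: card_gt_0_iff)
  then have K: "finite K" "({}, {}, 0) \<in> K" using Ags Out by (auto simp: K_def)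
  obtain g :: "_ \<Rightarrow> 'k" where g: "inj_on g K" using finite_inj_into_infinite[OF K(1) inf(2)] by blast
  define L where "L = g ` K"
  define lab where "lab = inv_into K g"
  have L: "finite L" "L \<noteq> {}" "lab ` L = K" using K g by (auto simp: L_def lab_def)
  have "finite (Out \<times> {..<N})" using Out by simp
  then obtain enc :: "_ \<Rightarrow> 'x" where enc: "inj_on enc (Out \<times> {..<N})"
    using finite_inj_into_infinite inf(1) by blast
  define dec where "dec = inv_into (Out \<times> {..<N}) enc"
  have dec: "dec (enc (\<Gamma>, i)) = (\<Gamma>, i)" if "\<Gamma> \<in> Out" "i < N" for \<Gamma> i
    using enc that by (simp add: dec_def)
  define X where "X = enc ` (Out \<times> {..<N})"
  have dec_X: "fst (dec x) \<in> Out" "snd (dec x) < N" if "x \<in> X" for x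
    using that dec by (auto simp: X_def)
  have "\<forall>\<chi> \<Gamma>. \<exists>w. \<Gamma> \<in> Out \<longrightarrow> w \<in> states S \<and> ftype \<phi> w = \<Gamma> \<and>
      (\<forall>k n. \<Gamma> \<in> stage \<phi> \<chi> k \<longrightarrow> rank \<phi> \<chi> \<Gamma> = Suc n \<longrightarrow> pre \<phi> \<chi> w (stage \<phi> \<chi> n))"
    using ex_rank_witness unfolding Out_def by blast
  \<comment> \<open>No single representative can serve all eventualities of a type, hence the
    dependence on \<chi>.\<close>
  then obtain rep where rep: "\<And>\<chi> \<Gamma>. \<Gamma> \<in> Out \<Longrightarrow> rep \<chi> \<Gamma> \<in> states S \<and> ftype \<phi> (rep \<chi> \<Gamma>) = \<Gamma> \<and>
      (\<forall>k n. \<Gamma> \<in> stage \<phi> \<chi> k \<longrightarrow> rank \<phi> \<chi> \<Gamma> = Suc n \<longrightarrow> pre \<phi> \<chi> (rep \<chi> \<Gamma>) (stage \<phi> \<chi> n))"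
    by metis
  define simulates where "simulates w res' \<longleftrightarrow> (\<forall>t. res' t \<in> Out) \<and> (\<forall>C X. C \<subseteq> Ags \<longrightarrow>
      (\<exists>s\<in>\<Pi>\<^sub>E \<alpha>\<in>C. acts S \<alpha> w. \<forall>t\<in>\<Pi>\<^sub>E \<alpha>\<in>Ags. acts S \<alpha> w. (\<forall>\<alpha>\<in>C. t \<alpha> = s \<alpha>) \<longrightarrow> ftype \<phi> (delta S w t) \<in> X) \<longleftrightarrow>
      (\<exists>s\<in>C \<rightarrow>\<^sub>E L. \<forall>t\<in>Ags \<rightarrow>\<^sub>E L. (\<forall>\<alpha>\<in>C. t \<alpha> = s \<alpha>) \<longrightarrow> res' t \<in> X))" for w res'
  \<comment> \<open>The result of the one-step game is taken to be the type of the next state, of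
    which there are finitely many.\<close>
  have "\<exists>res'. simulates w res'" if w: "w \<in> states S" for w
    unfolding simulates_def
    by (rule finite_game_form[where dec = lab])
      (use Ags Out w L(3) acts_nonempty delta_closed in \<open>auto simp: K_def Out_def joint_acts_def\<close>)
  then obtain res where "\<And>w. w \<in> states S \<Longrightarrow> simulates w (res w)" by metis
  then have res: "\<And>w t. w \<in> states S \<Longrightarrow> res w t \<in> Out"
    and res_eff: "\<And>w C X. w \<in> states S \<Longrightarrow> C \<subseteq> Ags \<Longrightarrow>
      (\<exists>s\<in>\<Pi>\<^sub>E \<alpha>\<in>C. acts S \<alpha> w. \<forall>t\<in>\<Pi>\<^sub>E \<alpha>\<in>Ags. acts S \<alpha> w. (\<forall>\<alpha>\<in>C. t \<alpha> = s \<alpha>) \<longrightarrow> ftype \<phi> (delta S w t) \<in> X) \<longleftrightarrow>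
      (\<exists>s\<in>C \<rightarrow>\<^sub>E L. \<forall>t\<in>Ags \<rightarrow>\<^sub>E L. (\<forall>\<alpha>\<in>C. t \<alpha> = s \<alpha>) \<longrightarrow> res w t \<in> X)"
    unfolding simulates_def by simp_all
  define ix where "ix x = snd (dec x)" for x
  define st where "st x = rep (evs (ix x)) (fst (dec x))" for x
  define move where "move x \<Gamma> = enc (\<Gamma>, if rank \<phi> (evs (ix x)) \<Gamma> < rank \<phi> (evs (ix x)) (ftype \<phi> (st x))
      then ix x else Suc (ix x) mod N)" for x \<Gamma>
  define S' :: "('x, 'a, 'k, 'p) cgs" where
    "S' = \<lparr>states = X, acts = (\<lambda>_ _. L), delta = (\<lambda>x t. move x (res (st x) t)),
       cgs_val = (\<lambda>p. {x \<in> X. AProp p \<in> fst (dec x)})\<rparr>"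
  have st_type: "st x \<in> states S" "ftype \<phi> (st x) = fst (dec x)" if "x \<in> X" for x
    using rep dec_X(1)[OF that] by (simp_all add: st_def)
  have move: "move x \<Gamma> \<in> X" "dec (move x \<Gamma>) = (\<Gamma>, if rank \<phi> (evs (ix x)) \<Gamma> < rank \<phi> (evs (ix x)) (ftype \<phi> (st x))
      then ix x else Suc (ix x) mod N)" if "x \<in> X" "\<Gamma> \<in> Out" for x \<Gamma>
    using dec_X(2)[OF that(1)] that(2) N unfolding move_def X_def ix_def by (auto intro!: dec)
  have cgs: "is_cgs Ags P S'"
    using Out N L move(1) res st_type(1) by (auto simp: is_cgs_def S'_def X_def[symmetric]) (auto simp: X_def)
  interpret S': game Ags S' using cgs by (rule is_cgs_game)
  have eff_move: "eff Ags S' C x Z \<longleftrightarrow> eff Ags S C (st x) {v. move x (ftype \<phi> v) \<in> Z}"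
    if "x \<in> X" "C \<subseteq> Ags" for x C Z
  proof -
    have "eff Ags S' C x Z \<longleftrightarrow>
        (\<exists>s\<in>C \<rightarrow>\<^sub>E L. \<forall>t\<in>Ags \<rightarrow>\<^sub>E L. (\<forall>\<alpha>\<in>C. t \<alpha> = s \<alpha>) \<longrightarrow> res (st x) t \<in> {\<Gamma>. move x \<Gamma> \<in> Z})"
      by (simp add: eff_iff S'_def)
    also have "\<dots> \<longleftrightarrow> eff Ags S C (st x) {v. move x (ftype \<phi> v) \<in> Z}"
      unfolding res_eff[OF st_type(1)[OF that(1)] that(2), symmetric]
      by (simp add: eff_iff)
    finally show ?thesis .
  qed
  interpret tracking Ags S S' \<phi> P N evs st ix move
  proof unfold_locales
    show "\<phi> \<in> atl_lang Ags P" by (rule \<phi>)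
    show "subs \<phi> \<subseteq> evs ` {..<N}" using evs by (simp add: bij_betw_def atLeast0LessThan)
    show "pre \<phi> (evs (ix x)) (st x) (stage \<phi> (evs (ix x)) n)"
      if "x \<in> states S'" "ftype \<phi> (st x) \<in> stage \<phi> (evs (ix x)) k" "rank \<phi> (evs (ix x)) (ftype \<phi> (st x)) = Suc n"
      for x k n
    proof -
      have x: "x \<in> X" using that(1) by (simp add: S'_def)
      show ?thesis
        using rep[OF dec_X(1)[OF x], of "evs (ix x)"] that(2,3) st_type(2)[OF x] by (auto simp: st_def)
    qed
    fix x assume "x \<in> states S'"
    then have x: "x \<in> X" by (simp add: S'_def)
    show "st x \<in> states S" "ix x < N" using st_type(1)[OF x] dec_X(2)[OF x] by (simp_all add: ix_def)
    show "x \<in> cgs_val S' p \<longleftrightarrow> AProp p \<in> ftype \<phi> (st x)" for p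
      using x st_type(2)[OF x] by (simp add: S'_def)
    show "eff Ags S' C x Z \<longleftrightarrow> eff Ags S C (st x) {v. move x (ftype \<phi> v) \<in> Z}" if "C \<subseteq> Ags" for C Z
      by (rule eff_move[OF x that])
    fix v assume "v \<in> states S"
    then have v: "ftype \<phi> v \<in> Out" by (simp add: Out_def)
    show "move x (ftype \<phi> v) \<in> states S'" using move(1)[OF x v] by (simp add: S'_def)
    show "ftype \<phi> (st (move x (ftype \<phi> v))) = ftype \<phi> v"
      using st_type(2)[OF move(1)[OF x v]] move(2)[OF x v] by simp
    show "ix (move x (ftype \<phi> v)) = (if rank \<phi> (evs (ix x)) (ftype \<phi> v) < rank \<phi> (evs (ix x)) (ftype \<phi> (st x))
        then ix x else Suc (ix x) mod N)"
      using move(2)[OF x v] by (simp add: ix_def)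
  qed
  \<comment> \<open>Any initial index would do: \<open>st x\<close> has the type of
    \<open>w0\<close>, and truth of \<phi> at \<open>x\<close> is read off that type.\<close>
  define x where "x = enc (ftype \<phi> w0, 0)"
  have x: "x \<in> X" "fst (dec x) = ftype \<phi> w0" using w0 N dec by (auto simp: x_def X_def Out_def)
  have "atl_sat Ags S' x \<phi> \<longleftrightarrow> atl_sat Ags S w0 \<phi>"
    using atl_sat_iff_in_ftype[OF \<phi> subs_refl, of x] x st_type(2)[OF x(1)] in_ftype_iff[OF subs_refl, of \<phi> w0]
    by (simp add: S'_def)
  then show ?thesis using that[OF cgs, of x] x(1) by (simp add: S'_def)
qed

end

theorem proposition2p16:
  fixes Ags :: "'a set" and P :: "'p set" and \<phi> :: "('a, 'p) atl"
  assumes "finite Ags" and "countable P"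
    and "infinite (UNIV :: 'w set)" and "infinite (UNIV :: 'l set)"
    and "infinite (UNIV :: 'm set)" and "infinite (UNIV :: 't set)"
    and "\<phi> \<in> atl_lang Ags P"
  shows "(\<forall>S :: ('w, 'a, 'l, 'p) cgs. is_cgs Ags P S \<longrightarrow>
            (\<forall>w\<in>states S. atl_sat Ags S w \<phi>)) \<longleftrightarrow>
         (\<forall>M :: ('m, 'a, 't, 'p) bdt. is_bdt Ags P M \<and> deterministic Ags M \<longrightarrow>
            (\<forall>(m, h)\<in>indices M. stit_sat M m h (Tr \<phi>)))"
proof (intro iffI allI impI ballI)
  fix M :: "('m, 'a, 't, 'p) bdt" and i
  assume valid: "\<forall>S :: ('w, 'a, 'l, 'p) cgs. is_cgs Ags P S \<longrightarrow> (\<forall>w\<in>states S. atl_sat Ags S w \<phi>)"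
    and M: "is_bdt Ags P M \<and> deterministic Ags M" and "i \<in> indices M"
  then obtain m h where i: "i = (m, h)" "h \<in> hists_at M m" by (auto simp: indices_def hists_at_def)
  interpret det_bdt Ags M using M by unfold_locales (auto simp: is_bdt_def)
  have "m \<in> states to_cgs" using hists_at_moments[OF i(2)] by simp
  \<comment> \<open>Validity speaks of finite structures over \<open>'w\<close> and
    \<open>'l\<close>, while \<open>to_cgs\<close> has cells as actions and may be infinite;
    \<open>finite_model\<close> supplies a structure of the required kind that agrees on
    \<phi>.\<close>
  then obtain S' :: "('w, 'a, 'l, 'p) cgs" and x where "is_cgs Ags P S'" "x \<in> states S'"
    "atl_sat Ags S' x \<phi> \<longleftrightarrow> atl_sat Ags to_cgs m \<phi>"
    by (rule cgs.finite_model[OF assms(1,7) _ assms(3,4)])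
  then have "atl_sat Ags to_cgs m \<phi>" using valid by blast
  then show "case i of (m, h) \<Rightarrow> stit_sat M m h (Tr \<phi>)"
    using stit_sat_Tr[OF assms(7) i(2)] i(1) by simp
next
  fix S :: "('w, 'a, 'l, 'p) cgs" and w
  assume valid: "\<forall>M :: ('m, 'a, 't, 'p) bdt. is_bdt Ags P M \<and> deterministic Ags M \<longrightarrow>
      (\<forall>(m, h)\<in>indices M. stit_sat M m h (Tr \<phi>))"
    and S: "is_cgs Ags P S" "w \<in> states S"
  obtain M :: "('m, 'a, 't, 'p) bdt" and m h where M: "is_bdt Ags P M" "deterministic Ags M" "(m, h) \<in> indices M"
    "\<And>\<phi>. \<phi> \<in> atl_lang Ags P \<Longrightarrow> stit_sat M m h (Tr \<phi>) \<longleftrightarrow> atl_sat Ags S w \<phi>"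
    by (rule bdt_of_finite_cgs[OF assms(1) S assms(5,6)]) blast
  then have "stit_sat M m h (Tr \<phi>)" using valid by blast
  then show "atl_sat Ags S w \<phi>" using M(4)[OF assms(7)] by blast
qed

end
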